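(* Let $\mathcal{T}$ be the ring torus and $\mathcal{Q}$ the quadric described in the context, and let $\mathcal{D}$ be a multiple component of $\mathcal{C}_{\mathbb{R}}=\mathcal{T}\cap\mathcal{Q}$. Then $\mathcal{D}$ is either a parallel circle or a meridian circle of $\mathcal{T}$.
   Context: Fix real numbers $0<r<R$. Put $p_2(x,y)=2(R^2-r^2+x^2+y^2)$, $p_0(x,y)=(R^2+2Rr+r^2-x^2-y^2)(R^2-2Rr+r^2-x^2-y^2)$, $T=z^4+p_2z^2+p_0\in\mathbb{R}[x,y,z]$, and $\mathcal{T}=\{T=0\}\subset\mathbb{R}^3$ (a ring torus centered at the origin with axis of revolution the $z$-axis). Let $q_1=ex+fy+i$ and $q_0=ax^2+by^2+dxy+gx+hy+j$ with real coefficients, $Q=z^2+q_1z+q_0$, and $\mathcal{Q}=\{Q=0\}\subset\mathbb{R}^3$. Standing assumption: the quadric is irreducible, i.e. neither the square of a plane nor the union of two planes. A multiple component of $\mathcal{C}_{\mathbb{R}}$ is a real (one-dimensional) irreducible component of the intersection of the torus and the quadric which occurs in that intersection with multiplicity at least two; in particular the quadric and the torus are tangent along it. A parallel circle of $\mathcal{T}$ is a circle on $\mathcal{T}$ lying in a plane $z=\text{const}$ and centered on the $z$-axis; a meridian circle is one of the two circles of radius $r$ in which a plane containing the $z$-axis cuts $\mathcal{T}$. *)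

theory Defs
  imports
    "HOL-Algebra.QuotRing"
    "HOL-Library.Extended_Nat"
    "HOL-Computational_Algebra.Computational_Algebra"
    "HOL-Analysis.Analysis"
begin

text \<open>
  The ring of real polynomials in \<open>x, y, z\<close> is rendered as \<open>\<real>[x][y][z]\<close>: the innermost
  variable is \<open>x\<close>, the outermost one is \<open>z\<close>.
\<close>

type_synonym poly3 = "real poly poly poly"

definition C3 :: "real \<Rightarrow> poly3" where "C3 c = [:[:[:c:]:]:]"
definition X3 :: poly3 where "X3 = [:[:[:0, 1:]:]:]"
definition Y3 :: poly3 where "Y3 = [:[:0, 1:]:]"
definition Z3 :: poly3 where "Z3 = [:0, 1:]"

definition eval3 :: "poly3 \<Rightarrow> real ^ 3 \<Rightarrow> real" where
  "eval3 F v = poly (poly (poly F [:[:v $ 3:]:]) [:v $ 2:]) (v $ 1)"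

definition zero_set :: "poly3 \<Rightarrow> (real ^ 3) set" where
  "zero_set F = {v. eval3 F v = 0}"

definition torus_p2 :: "real \<Rightarrow> real \<Rightarrow> poly3" where
  "torus_p2 R r = C3 2 * (C3 (R\<^sup>2 - r\<^sup>2) + X3\<^sup>2 + Y3\<^sup>2)"

definition torus_p0 :: "real \<Rightarrow> real \<Rightarrow> poly3" where
  "torus_p0 R r =
     (C3 (R\<^sup>2 + 2 * R * r + r\<^sup>2) - X3\<^sup>2 - Y3\<^sup>2) * (C3 (R\<^sup>2 - 2 * R * r + r\<^sup>2) - X3\<^sup>2 - Y3\<^sup>2)"

definition torus_poly :: "real \<Rightarrow> real \<Rightarrow> poly3" where
  "torus_poly R r = Z3 ^ 4 + torus_p2 R r * Z3\<^sup>2 + torus_p0 R r"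

definition quadric_q1 :: "real \<Rightarrow> real \<Rightarrow> real \<Rightarrow> poly3" where
  "quadric_q1 e f i = C3 e * X3 + C3 f * Y3 + C3 i"

definition quadric_q0 :: "real \<Rightarrow> real \<Rightarrow> real \<Rightarrow> real \<Rightarrow> real \<Rightarrow> real \<Rightarrow> poly3" where
  "quadric_q0 a b d g h j =
     C3 a * X3\<^sup>2 + C3 b * Y3\<^sup>2 + C3 d * X3 * Y3 + C3 g * X3 + C3 h * Y3 + C3 j"

definition quadric_poly ::
  "real \<Rightarrow> real \<Rightarrow> real \<Rightarrow> real \<Rightarrow> real \<Rightarrow> real \<Rightarrow> real \<Rightarrow> real \<Rightarrow> real \<Rightarrow> poly3" where
  "quadric_poly a b d e f g h i j = Z3\<^sup>2 + quadric_q1 e f i * Z3 + quadric_q0 a b d g h j"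

definition algebraic_set :: "(real ^ 3) set \<Rightarrow> bool" where
  "algebraic_set V \<longleftrightarrow> (\<exists>S. V = (\<Inter>F\<in>S. zero_set F))"

definition irreducible_set :: "(real ^ 3) set \<Rightarrow> bool" where
  "irreducible_set V \<longleftrightarrow> algebraic_set V \<and> V \<noteq> {} \<and>
     (\<forall>A B. algebraic_set A \<and> algebraic_set B \<and> V = A \<union> B \<longrightarrow> V = A \<or> V = B)"

definition irreducible_component :: "(real ^ 3) set \<Rightarrow> (real ^ 3) set \<Rightarrow> bool" where
  "irreducible_component D V \<longleftrightarrow> irreducible_set D \<and> D \<subseteq> V \<and>
     (\<forall>W. irreducible_set W \<and> D \<subseteq> W \<and> W \<subseteq> V \<longrightarrow> W = D)"

text \<open>Krull dimension for the Zariski topology.\<close>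

definition alg_dim :: "(real ^ 3) set \<Rightarrow> enat" where
  "alg_dim V = (SUP n \<in> {n. \<exists>W :: nat \<Rightarrow> (real ^ 3) set.
     (\<forall>k\<le>n. irreducible_set (W k) \<and> W k \<subseteq> V) \<and> (\<forall>k<n. W k \<subset> W (Suc k))}. enat n)"

definition vanishing_ideal :: "(real ^ 3) set \<Rightarrow> poly3 set" where
  "vanishing_ideal V = {F. \<forall>v\<in>V. eval3 F v = 0}"

text \<open>
  The localization \<open>A\<^sub>P\<close> of an integral domain \<open>A\<close> at a prime ideal \<open>P\<close>, as a subring of the
  field of fractions.
\<close>

definition localization :: "'a::idom set \<Rightarrow> 'a fract ring" where
  "localization P =
     \<lparr>carrier = {Fraction_Field.Fract a s | a s. s \<notin> P}, monoid.mult = (*), one = 1, zero = 0, add = (+)\<rparr>"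

text \<open>The length of a commutative ring as a module over itself.\<close>

definition ring_length :: "('a, 'b) ring_scheme \<Rightarrow> enat" where
  "ring_length B = (SUP n \<in> {n. \<exists>J :: nat \<Rightarrow> 'a set.
     (\<forall>k\<le>n. ideal (J k) B) \<and> (\<forall>k<n. J k \<subset> J (Suc k))}. enat n)"

text \<open>
  The multiplicity of the intersection of the surfaces \<open>F = 0\<close> and \<open>G = 0\<close> along an irreducible
  curve \<open>D\<close> contained in both: the length of \<open>A\<^sub>P / (F, G)\<close>, where \<open>A = \<real>[x,y,z]\<close> and
  \<open>P\<close> is the ideal of \<open>D\<close>.
\<close>

definition intersection_multiplicity :: "poly3 \<Rightarrow> poly3 \<Rightarrow> (real ^ 3) set \<Rightarrow> enat" where
  "intersection_multiplicity F G D =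
     (let L = localization (vanishing_ideal D)
      in ring_length (L Quot (genideal L {Fraction_Field.Fract F 1, Fraction_Field.Fract G 1})))"

definition multiple_component :: "(real ^ 3) set \<Rightarrow> poly3 \<Rightarrow> poly3 \<Rightarrow> bool" where
  "multiple_component D F G \<longleftrightarrow>
     irreducible_component D (zero_set F \<inter> zero_set G) \<and> alg_dim D = 1 \<and>
     intersection_multiplicity F G D \<ge> 2"

definition circle3 :: "real ^ 3 \<Rightarrow> real ^ 3 \<Rightarrow> real \<Rightarrow> (real ^ 3) set" where
  "circle3 c n \<rho> = {v. n \<bullet> (v - c) = 0 \<and> dist v c = \<rho>}"

definition z_axis :: "(real ^ 3) set" where
  "z_axis = {v. v $ 1 = 0 \<and> v $ 2 = 0}"

definition parallel_circle :: "real \<Rightarrow> real \<Rightarrow> (real ^ 3) set \<Rightarrow> bool" where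
  "parallel_circle R r D \<longleftrightarrow> D \<subseteq> zero_set (torus_poly R r) \<and>
     (\<exists>c \<rho>. c \<in> z_axis \<and> \<rho> > 0 \<and> D = circle3 c (axis 3 1) \<rho>)"

definition meridian_circle :: "real \<Rightarrow> real \<Rightarrow> (real ^ 3) set \<Rightarrow> bool" where
  "meridian_circle R r D \<longleftrightarrow>
     (\<exists>n c c'. n \<noteq> 0 \<and> z_axis \<subseteq> {v. n \<bullet> v = 0} \<and> n \<bullet> c = 0 \<and> n \<bullet> c' = 0 \<and>
        circle3 c n r \<noteq> circle3 c' n r \<and>
        zero_set (torus_poly R r) \<inter> {v. n \<bullet> v = 0} = circle3 c n r \<union> circle3 c' n r \<and>
        D = circle3 c n r)"

end

theory Submission
  imports Defs "HOL-Computational_Algebra.Field_as_Ring"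
begin

text \<open>
  Along a multiple component \<open>D\<close> the torus \<open>T\<close> and the quadric \<open>Q\<close> are tangent: if the minor
  \<open>T\<^sub>x Q\<^sub>y - T\<^sub>y Q\<^sub>x\<close> of the Jacobian matrix did not vanish identically on \<open>D\<close>, then \<open>T\<close> and
  \<open>Q\<close> would generate the maximal ideal of the local ring of \<open>D\<close>, and the multiplicity would be
  one (\<open>jacobian_vanishes_on_multiple_component\<close>). The local ring needs no general theory here,
  because the projection of \<open>D\<close> to the \<open>xy\<close>-plane is cut out by a single prime polynomial \<open>p\<close>, and
  up to denominators the ideal of \<open>D\<close> is generated by \<open>p\<close> and one more polynomial
  (\<open>curve_projection_ideal\<close>, \<open>generic_generators\<close>).

  The torus is a surface of revolution, so this minor is a multiple of \<open>x Q\<^sub>y - y Q\<^sub>x\<close>, the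
  derivative of \<open>Q\<close> along the rotation about the axis. Write a point of the torus as
  \<open>x + \<i> y = \<rho> U\<close>, \<open>\<rho> = R + r Re V\<close>, \<open>z = r Im V\<close> with complex numbers \<open>U\<close>, \<open>V\<close> of
  modulus one. Then \<open>U\<^sup>2 V\<^sup>2 Q\<close> becomes a polynomial of degree at most four in \<open>U\<close> over \<open>\<complex>[V]\<close>,
  and it has a double zero in \<open>U\<close> at infinitely many points \<open>(V, U)\<close> coming from \<open>D\<close>. Unless
  infinitely many of these points share the same \<open>V\<close> (a parallel circle), the polynomial is
  divisible by the square of a prime \<open>P\<close> of positive degree in \<open>U\<close>
  (\<open>square_factor_of_double_zeros\<close>).

  The coefficients of \<open>U\<^sup>4\<close> and \<open>U\<^sup>0\<close> are \<open>\<kappa> (V \<rho>)\<^sup>2\<close> and its conjugate, where \<open>\<kappa> = 0\<close> means that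
  the quadratic part of \<open>Q\<close> is rotationally symmetric up to terms containing \<open>z\<close>, and
  \<open>V \<rho>\<close> has just two zeros, \<open>v\<close> and \<open>1 / v\<close>. This leaves few possibilities for \<open>P\<close>.
  If \<open>\<kappa> = 0\<close>, the contact points lie on one meridian (\<open>constant_longitude_contact\<close>). If \<open>\<kappa> \<noteq> 0\<close>
  and \<open>P\<close> has degree two, \<open>Q\<close> is the square of a plane (\<open>square_if_double_conic\<close>). If
  \<open>P = P\<^sub>1 U + P\<^sub>0\<close>, both coefficients divide \<open>V \<rho>\<close>, are coprime, and have the same modulus on the
  unit circle; so either both are constant, \<open>U\<close> is constant and the points lie on one meridian, or
  \<open>P\<close> is \<open>(V - v) U + \<omega> (v V - 1)\<close> up to a factor, the equation of a Villarceau circle. In that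
  case the remaining factor is the square of the other circle in the same bitangent plane, and
  \<open>Q\<close> is again the square of a plane (\<open>square_if_villarceau\<close>). The irreducibility of \<open>Q\<close> excludes
  the squares.

  So \<open>D\<close> has infinitely many points in common with a parallel or a meridian circle. Such a circle
  is an irreducible real curve, and hence equal to \<open>D\<close>, which is irreducible of dimension one
  (\<open>curve_eq_circle\<close>).
\<close>

section \<open>Polynomials in two variables\<close>

lemma degree_le_2_poly_eq:
  assumes "degree p \<le> 2"
  shows "p = [:coeff p 0, coeff p 1, coeff p 2:]"
proof (rule poly_eqI)
  fix n show "coeff p n = coeff [:coeff p 0, coeff p 1, coeff p 2:] n"
    using assms coeff_eq_0[of p n]
    by (auto simp: coeff_pCons numeral_2_eq_2 split: nat.splits)
qed

text \<open>
  An element \<open>g\<close> of least degree in the ideal \<open>(p, q)\<close> divides \<open>p\<close> and \<open>q\<close> up to nonzero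
  constants, because the pseudo-remainders lie in the ideal and have smaller degree. Say
  \<open>c p = g s\<close>. As \<open>p\<close> is prime, it divides \<open>g\<close> or \<open>s\<close>. In the first case it divides a constant,
  which then lies in the ideal; in the second, \<open>g\<close> itself is a constant.
\<close>

lemma prime_elem_poly_bezout:
  fixes p q :: "'a::idom poly"
  assumes p: "prime_elem p" and ndvd: "\<not> p dvd q"
  shows "\<exists>u v c. c \<noteq> 0 \<and> u * p + v * q = [:c:]"
proof -
  define I where "I = {g. g \<noteq> 0 \<and> (\<exists>u v. g = u * p + v * q)}"
  have q0: "q \<noteq> 0" using ndvd by auto
  have "q \<in> I" unfolding I_def using q0 by (auto intro: exI[of _ 0] exI[of _ 1])
  then obtain g where g: "g \<in> I" and gmin: "\<And>f. f \<in> I \<Longrightarrow> degree g \<le> degree f"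
    using ex_has_least_nat[of "\<lambda>g. g \<in> I" q degree] by auto
  from g obtain u v where g0: "g \<noteq> 0" and uv: "g = u * p + v * q" unfolding I_def by auto
  have dvd: "\<exists>c s. c \<noteq> 0 \<and> smult c (u' * p + v' * q) = g * s" for u' v'
  proof -
    define f where "f = u' * p + v' * q"
    obtain s t where st: "pseudo_divmod f g = (s, t)" by force
    define c where "c = coeff g (degree g) ^ (Suc (degree f) - degree g)"
    from pseudo_divmod[OF g0 st] have 1: "smult c f = g * s + t"
      and 2: "t = 0 \<or> degree t < degree g" by (auto simp: c_def)
    have "t = (smult c u' - s * u) * p + (smult c v' - s * v) * q"
      using 1 unfolding uv f_def by (simp add: algebra_simps smult_add_right)
    then have "t \<noteq> 0 \<Longrightarrow> t \<in> I" unfolding I_def by blast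
    with 2 gmin have "t = 0" by fastforce
    moreover have "c \<noteq> 0" using g0 by (simp add: c_def)
    ultimately show ?thesis using 1 f_def by auto
  qed
  obtain c s where c: "c \<noteq> 0" "smult c p = g * s" using dvd[of 1 0] by auto
  obtain c' s' where c': "c' \<noteq> 0" "smult c' q = g * s'" using dvd[of 0 1] by auto
  have "p dvd g * s" unfolding c(2)[symmetric] by (rule dvd_smult) simp
  then consider "p dvd g" | "p dvd s" using p prime_elem_dvd_mult_iff by blast
  then show ?thesis
  proof cases
    case 1
    then have "p dvd smult c' q" unfolding c'(2) by (rule dvd_mult2)
    then have "p dvd [:c':] * q" by simp
    with p ndvd have "p dvd [:c':]" using prime_elem_dvd_mult_iff by blast
    then obtain k where "[:c':] = k * p" by (auto simp: dvd_def mult.commute)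
    with c'(1) show ?thesis by (intro exI[of _ k] exI[of _ 0] exI[of _ c']) simp
  next
    case 2
    then obtain s1 where s1: "s = p * s1" by auto
    have "p \<noteq> 0" using p by auto
    moreover have "p * [:c:] = p * (g * s1)" using c(2) s1 by (simp add: ac_simps)
    ultimately have "[:c:] = g * s1" by (metis mult_cancel_left)
    then have "degree (g * s1) = 0" by (metis degree_pCons_0)
    moreover have "s1 \<noteq> 0" using \<open>[:c:] = g * s1\<close> c(1) by auto
    ultimately have "degree g = 0" using g0 by (simp add: degree_mult_eq)
    then obtain b where "g = [:b:]" by (auto elim: degree_eq_zeroE)
    with g0 uv have "b \<noteq> 0" "u * p + v * q = [:b:]" by auto
    then show ?thesis by blast
  qed
qed

lemma pCons_const_dvd_if_poly_eq_0:
  fixes p :: "'a::idom poly poly"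
  assumes "map_poly (\<lambda>c. poly c x) p = 0"
  shows "[:[:-x, 1:]:] dvd p"
proof -
  have "[:-x, 1:] dvd coeff p n" for n
  proof -
    have "coeff (map_poly (\<lambda>c. poly c x) p) n = 0" using assms by simp
    then show ?thesis by (simp add: coeff_map_poly poly_eq_0_iff_dvd)
  qed
  then show ?thesis by (simp add: const_poly_dvd_iff)
qed

lemma poly_map_poly_eval:
  "poly (map_poly (\<lambda>c. poly c x) p) y = poly (poly p [:y:]) (x::'a::comm_semiring_0)"
  by (induction p) (simp_all add: map_poly_pCons)

text \<open>
  The ideal \<open>(p, q)\<close> contains a nonzero polynomial in \<open>x\<close> alone, so only finitely many abscissas
  occur. On a vertical line \<open>x = x\<^sub>0\<close>, the two polynomials cannot both vanish identically: \<open>x - x\<^sub>0\<close>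
  would divide both, hence be associated to \<open>p\<close>, and \<open>p\<close> would divide \<open>q\<close>.
\<close>

lemma finite_common_zeros:
  fixes p q :: "'a::field poly poly"
  assumes p: "prime_elem p" and ndvd: "\<not> p dvd q"
  shows "finite {(x, y). poly (poly p [:y:]) x = 0 \<and> poly (poly q [:y:]) x = 0}" (is "finite ?Z")
proof -
  obtain u v c where c: "c \<noteq> 0" and uv: "u * p + v * q = [:c:]"
    using prime_elem_poly_bezout[OF p ndvd] by blast
  define X where "X = {x. poly c x = 0}"
  have fX: "finite X" unfolding X_def using c by (rule poly_roots_finite)
  define ev where "ev f x = map_poly (\<lambda>c. poly c x) f" for f :: "'a poly poly" and x
  have fY: "finite {y. poly (ev p x) y = 0 \<and> poly (ev q x) y = 0}" for x
  proof -
    have "ev p x \<noteq> 0 \<or> ev q x \<noteq> 0"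
    proof (rule ccontr)
      assume "\<not> ?thesis"
      then have pq: "[:[:-x, 1:]:] dvd p" "[:[:-x, 1:]:] dvd q"
        by (auto simp: ev_def intro: pCons_const_dvd_if_poly_eq_0)
      from pq(1) obtain k where k: "p = [:[:-x, 1:]:] * k" by auto
      have "irreducible p" using p by (rule prime_elem_imp_irreducible)
      with k consider "is_unit [:[:-x, 1:]:]" | "is_unit k" using irreducibleD by blast
      then show False
      proof cases
        case 1
        then show False by (auto simp: is_unit_pCons_iff is_unit_poly_iff)
      next
        case 2
        then have "p dvd [:[:-x, 1:]:]" unfolding k by (metis mult_unit_dvd_iff dvd_refl)
        with pq(2) ndvd show False using dvd_trans by blast
      qed
    qed
    then show ?thesis
      using poly_roots_finite[of "ev p x"] poly_roots_finite[of "ev q x"]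
      by (elim disjE) (auto elim: rev_finite_subset)
  qed
  have "?Z \<subseteq> Sigma X (\<lambda>x. {y. poly (ev p x) y = 0 \<and> poly (ev q x) y = 0})"
  proof (clarsimp simp: ev_def poly_map_poly_eval X_def)
    fix x y assume "poly (poly p [:y:]) x = 0" "poly (poly q [:y:]) x = 0"
    then have "poly (poly (u * p + v * q) [:y:]) x = 0" by simp
    then show "poly c x = 0" unfolding uv by simp
  qed
  then show ?thesis using fX fY by (meson finite_SigmaI finite_subset)
qed

text \<open>
  The property \<open>J\<close> will be membership in a prime ideal, or having infinitely many zeros in a
  given set.
\<close>

lemma prime_divisor_inherits:
  fixes c :: "'a::factorial_semiring"
  assumes "c \<noteq> 0" "J c" and unit: "\<And>x. is_unit x \<Longrightarrow> \<not> J x"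
    and mult: "\<And>x y. J (x * y) \<Longrightarrow> J x \<or> J y"
  shows "\<exists>p. prime_elem p \<and> p dvd c \<and> J p"
  using assms(1,2)
proof (induction c rule: prime_divisors_induct)
  case (factor p x)
  then show ?case using mult[of p x]
    by (metis dvd_triv_left dvd_mult mult_not_zero prime_imp_prime_elem)
qed (use unit in auto)

section \<open>Localization at a prime ideal\<close>

text \<open>
  The localization is formed at a plain set in the ring structure of the type, so prime ideals
  are described in the same terms.
\<close>

locale prime_ideal_set =
  fixes P :: "'a::idom set"
  assumes zero_in: "0 \<in> P" and one_notin: "1 \<notin> P"
    and add_in: "a \<in> P \<Longrightarrow> b \<in> P \<Longrightarrow> a + b \<in> P"
    and mult_in: "a \<in> P \<Longrightarrow> c * a \<in> P"
    and prime: "a * b \<in> P \<Longrightarrow> a \<in> P \<or> b \<in> P"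
begin

lemma nonzero: "s \<notin> P \<Longrightarrow> s \<noteq> 0"
  using zero_in by auto

lemma mult_notin: "s \<notin> P \<Longrightarrow> t \<notin> P \<Longrightarrow> s * t \<notin> P"
  using prime by blast

lemma uminus_in: "a \<in> P \<Longrightarrow> - a \<in> P"
  using mult_in[of a "- 1"] by simp

lemma carrier_localization: "carrier (localization P) = {Fraction_Field.Fract a s | a s. s \<notin> P}"
  by (simp add: localization_def)

lemma localization_sel [simp]:
  "x \<otimes>\<^bsub>localization P\<^esub> y = x * y" "\<one>\<^bsub>localization P\<^esub> = 1"
  "x \<oplus>\<^bsub>localization P\<^esub> y = x + y" "\<zero>\<^bsub>localization P\<^esub> = 0"
  by (simp_all add: localization_def)

lemma Fract_in_carrier: "s \<notin> P \<Longrightarrow> Fraction_Field.Fract a s \<in> carrier (localization P)"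
  unfolding carrier_localization by blast

lemma cring_localization: "cring (localization P)"
proof (rule cringI)
  have zero: "0 \<in> carrier (localization P)"
    using Fract_in_carrier[OF one_notin, of 0] by (simp add: Zero_fract_def[symmetric])
  have add: "x + y \<in> carrier (localization P)"
    if "x \<in> carrier (localization P)" "y \<in> carrier (localization P)" for x y
    using that unfolding carrier_localization by (force simp: nonzero dest: mult_notin)
  have neg: "- x \<in> carrier (localization P)" if "x \<in> carrier (localization P)" for x
    using that unfolding carrier_localization by fastforce
  show "abelian_group (localization P)"
    by (rule abelian_groupI) (auto simp: zero add add.assoc add.commute intro!: bexI[OF _ neg])
  have one: "1 \<in> carrier (localization P)"
    using Fract_in_carrier[OF one_notin, of 1] by (simp add: One_fract_def[symmetric])
  have mult: "x * y \<in> carrier (localization P)"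
    if "x \<in> carrier (localization P)" "y \<in> carrier (localization P)" for x y
    using that unfolding carrier_localization by (force dest: mult_notin)
  show "Group.comm_monoid (localization P)"
    by (rule comm_monoidI) (auto simp: one mult mult.assoc mult.commute)
qed (simp add: distrib_right)

definition max_ideal :: "'a fract set" where
  "max_ideal = {Fraction_Field.Fract a s | a s. a \<in> P \<and> s \<notin> P}"

lemma ideal_max_ideal: "ideal max_ideal (localization P)"
proof -
  interpret cring "localization P" by (rule cring_localization)
  have inv: "\<ominus>\<^bsub>localization P\<^esub> x = - x" if "x \<in> carrier (localization P)" for x
  proof (rule minus_equality)
    show "- x \<oplus>\<^bsub>localization P\<^esub> x = \<zero>\<^bsub>localization P\<^esub>" by simp
    show "- x \<in> carrier (localization P)" using that unfolding carrier_localization by fastforce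
  qed fact
  have sub: "max_ideal \<subseteq> carrier (localization P)"
    unfolding max_ideal_def carrier_localization by blast
  have l: "x * a \<in> max_ideal" if ax: "a \<in> max_ideal" "x \<in> carrier (localization P)" for a x
  proof -
    obtain b s c t where "a = Fraction_Field.Fract b s" "b \<in> P" "s \<notin> P"
      and "x = Fraction_Field.Fract c t" "t \<notin> P"
      using ax unfolding max_ideal_def carrier_localization by blast
    then have "x * a = Fraction_Field.Fract (c * b) (t * s)" "c * b \<in> P" "t * s \<notin> P"
      by (simp_all add: mult_in mult_notin)
    then show ?thesis unfolding max_ideal_def by blast
  qed
  show ?thesis
  proof (rule idealI)
    show "subgroup max_ideal (add_monoid (localization P))"
    proof (rule add.subgroupI)
      show "max_ideal \<noteq> {}" unfolding max_ideal_def using zero_in one_notin by blast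
      fix a assume a: "a \<in> max_ideal"
      obtain a' s where a': "a = Fraction_Field.Fract a' s" "a' \<in> P" "s \<notin> P"
        using a unfolding max_ideal_def by blast
      then have "- a = Fraction_Field.Fract (- a') s" by simp
      then have "- a \<in> max_ideal" using a' uminus_in unfolding max_ideal_def by blast
      then show "\<ominus>\<^bsub>localization P\<^esub> a \<in> max_ideal" using inv a sub by auto
      fix b assume "b \<in> max_ideal"
      then obtain b' t where b': "b = Fraction_Field.Fract b' t" "b' \<in> P" "t \<notin> P"
        unfolding max_ideal_def by blast
      have "a \<oplus>\<^bsub>localization P\<^esub> b = Fraction_Field.Fract (t * a' + s * b') (s * t)"
        using a' b' by (simp add: nonzero mult.commute)
      moreover have "t * a' + s * b' \<in> P" "s * t \<notin> P"
        using a' b' by (simp_all add: mult_in add_in mult_notin)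
      ultimately show "a \<oplus>\<^bsub>localization P\<^esub> b \<in> max_ideal" unfolding max_ideal_def by blast
    qed (rule sub)
    fix a x assume "a \<in> max_ideal" "x \<in> carrier (localization P)"
    then show "x \<otimes>\<^bsub>localization P\<^esub> a \<in> max_ideal" "a \<otimes>\<^bsub>localization P\<^esub> x \<in> max_ideal"
      using l[of a x] by (simp_all add: mult.commute)
  qed (rule ring_axioms)
qed

lemma maximalideal_max_ideal: "maximalideal max_ideal (localization P)"
proof (rule maximalidealI[OF ideal_max_ideal])
  interpret cring "localization P" by (rule cring_localization)
  have "1 \<notin> max_ideal"
  proof
    assume "1 \<in> max_ideal"
    then obtain a s where as: "Fraction_Field.Fract 1 1 = Fraction_Field.Fract a s" "a \<in> P" "s \<notin> P"
      unfolding max_ideal_def One_fract_def by blast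
    then have "s = a" using nonzero[OF as(3)] by (simp add: eq_fract)
    then show False using as by simp
  qed
  then show "carrier (localization P) \<noteq> max_ideal" using one_closed by auto
  fix J assume J: "ideal J (localization P)" "max_ideal \<subseteq> J" "J \<subseteq> carrier (localization P)"
  show "J = max_ideal \<or> J = carrier (localization P)"
  proof (cases "J \<subseteq> max_ideal")
    case False
    then obtain x where x: "x \<in> J" "x \<notin> max_ideal" by auto
    then obtain a s where as: "x = Fraction_Field.Fract a s" "s \<notin> P"
      using J(3) unfolding carrier_localization by auto
    then have "a \<notin> P" using x(2) unfolding max_ideal_def by blast
    then have "Fraction_Field.Fract s a \<otimes>\<^bsub>localization P\<^esub> x \<in> J"
      using ideal.I_l_closed[OF J(1) x(1)] Fract_in_carrier by blast
    also have "Fraction_Field.Fract s a \<otimes>\<^bsub>localization P\<^esub> x = \<one>\<^bsub>localization P\<^esub>"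
      using as \<open>a \<notin> P\<close> by (simp add: One_fract_def eq_fract nonzero mult_notin mult.commute)
    finally show ?thesis using ideal.one_imp_carrier[OF J(1)] by blast
  qed (use J(2) in blast)
qed

lemma genideal_eq_max_ideal:
  assumes F: "F \<in> P" and G: "G \<in> P"
    and gen: "\<And>H. H \<in> P \<Longrightarrow> \<exists>s u v. s \<notin> P \<and> s * H = u * F + v * G"
  shows "genideal (localization P) {Fraction_Field.Fract F 1, Fraction_Field.Fract G 1} = max_ideal"
    (is "genideal _ ?S = _")
proof
  interpret cring "localization P" by (rule cring_localization)
  have "?S \<subseteq> max_ideal" unfolding max_ideal_def using F G one_notin by blast
  then show "genideal (localization P) ?S \<subseteq> max_ideal" by (rule genideal_minimal[OF ideal_max_ideal])
  have "?S \<subseteq> carrier (localization P)" using one_notin Fract_in_carrier by blast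
  then have I: "ideal (genideal (localization P) ?S) (localization P)"
    and S: "?S \<subseteq> genideal (localization P) ?S"
    by (rule genideal_ideal, rule genideal_self)
  interpret I: ideal "genideal (localization P) ?S" "localization P" by (rule I)
  show "max_ideal \<subseteq> genideal (localization P) ?S"
  proof
    fix x assume "x \<in> max_ideal"
    then obtain H t where x: "x = Fraction_Field.Fract H t" and H: "H \<in> P" and t: "t \<notin> P"
      unfolding max_ideal_def by blast
    obtain s u v where s: "s \<notin> P" and sH: "s * H = u * F + v * G" using gen[OF H] by blast
    have "Fraction_Field.Fract u (s * t) * Fraction_Field.Fract F 1 +
        Fraction_Field.Fract v (s * t) * Fraction_Field.Fract G 1 \<in> genideal (localization P) ?S"
      by (rule I.a_closed[unfolded localization_sel]; rule I.I_l_closed[unfolded localization_sel])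
        (use S Fract_in_carrier[OF mult_notin[OF s t]] in auto)
    also have "Fraction_Field.Fract u (s * t) * Fraction_Field.Fract F 1 +
        Fraction_Field.Fract v (s * t) * Fraction_Field.Fract G 1 = x"
    proof -
      have "(u * F * (s * t) + v * G * (s * t)) * t = (s * H) * (s * t) * t"
        unfolding sH by (simp add: algebra_simps)
      then show ?thesis
        unfolding x using s t by (simp add: eq_fract nonzero mult_notin algebra_simps)
    qed
    finally show "x \<in> genideal (localization P) ?S" .
  qed
qed

end

lemma field_ring_length_le_1:
  assumes "field K"
  shows "ring_length K \<le> 1"
  unfolding ring_length_def
proof (rule SUP_least, clarify)
  fix n and J :: "nat \<Rightarrow> _"
  assume J: "\<forall>k\<le>n. ideal (J k) K" "\<forall>k<n. J k \<subset> J (Suc k)"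
  interpret field K by fact
  have "n < 2"
  proof (rule ccontr)
    assume "\<not> n < 2"
    then have two: "J k \<in> {{\<zero>\<^bsub>K\<^esub>}, carrier K}" if "k \<le> 2" for k
      using J(1) that unfolding all_ideals[symmetric] by simp
    have "J 0 \<subset> J 1" "J 1 \<subset> J 2"
      using J(2) \<open>\<not> n < 2\<close> by (auto simp: numeral_2_eq_2)
    then have "J 0 \<noteq> J 1" "J 1 \<noteq> J 2" "J 0 \<noteq> J 2" by (auto simp: psubset_eq)
    then show False using two[of 0] two[of 1] two[of 2] by auto
  qed
  then show "enat n \<le> 1" by (cases n) (auto simp: one_enat_def)
qed

text \<open>
  The quotient is the residue field of the local ring, and a field has only two ideals.
\<close>

lemma intersection_multiplicity_le_1:
  assumes "prime_ideal_set (vanishing_ideal D)"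
    and "F \<in> vanishing_ideal D" "G \<in> vanishing_ideal D"
    and "\<And>H. H \<in> vanishing_ideal D \<Longrightarrow> \<exists>s u v. s \<notin> vanishing_ideal D \<and> s * H = u * F + v * G"
  shows "intersection_multiplicity F G D \<le> 1"
proof -
  interpret prime_ideal_set "vanishing_ideal D" by fact
  let ?L = "localization (vanishing_ideal D)"
  have "genideal ?L {Fraction_Field.Fract F 1, Fraction_Field.Fract G 1} = max_ideal"
    using assms(2-4) by (rule genideal_eq_max_ideal)
  then have "maximalideal (genideal ?L {Fraction_Field.Fract F 1, Fraction_Field.Fract G 1}) ?L"
    using maximalideal_max_ideal by simp
  then show ?thesis
    unfolding intersection_multiplicity_def Let_def
    by (intro field_ring_length_le_1 maximalideal.quotient_is_field cring_localization)
qed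

section \<open>Ideals of real space curves\<close>

text \<open>
  The statement describes \<open>P\<close> after localization: over the field of fractions of the coefficient
  ring modulo \<open>p\<close>, the ideal is generated by one polynomial. This is a polynomial \<open>q \<in> P\<close> of least
  degree among those not divisible by \<open>p\<close>. Its leading coefficient is prime to \<open>p\<close>, since the
  leading term could be dropped otherwise, and so the factor introduced by pseudo-division by \<open>q\<close>
  lies outside \<open>P\<close>. The pseudo-remainder has smaller degree and is therefore divisible by \<open>p\<close>.
\<close>

lemma generic_generators:
  fixes P :: "'a::idom poly set"
  assumes P: "prime_ideal_set P" and p: "prime_elem p" and contr: "\<And>b. [:b:] \<in> P \<longleftrightarrow> p dvd b"
  shows "\<exists>q\<in>P. \<forall>H\<in>P. \<exists>s \<alpha> \<beta>. s \<notin> P \<and> s * H = \<alpha> * [:p:] + \<beta> * q"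
proof -
  interpret prime_ideal_set P by fact
  show ?thesis
  proof (cases "\<forall>H\<in>P. [:p:] dvd H")
    case True
    show ?thesis
    proof (intro bexI[of _ 0] ballI zero_in)
      fix H assume "H \<in> P"
      then obtain k where "H = [:p:] * k" using True by blast
      then show "\<exists>s \<alpha> \<beta>. s \<notin> P \<and> s * H = \<alpha> * [:p:] + \<beta> * 0"
        using one_notin by (intro exI[of _ 1] exI[of _ k]) (simp add: mult.commute)
    qed
  next
    case False
    then obtain q where q: "q \<in> P" "\<not> [:p:] dvd q"
      and qmin: "\<And>f. f \<in> P \<Longrightarrow> \<not> [:p:] dvd f \<Longrightarrow> degree q \<le> degree f"
      using ex_has_least_nat[of "\<lambda>f. f \<in> P \<and> \<not> [:p:] dvd f" _ degree] by blast
    have q0: "q \<noteq> 0" using q(2) by auto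
    have lc: "\<not> p dvd lead_coeff q"
    proof
      assume dvd: "p dvd lead_coeff q"
      define m where "m = monom (lead_coeff q) (degree q)"
      have m: "m = monom 1 (degree q) * [:lead_coeff q:]"
        by (simp add: m_def smult_monom)
      have "[:lead_coeff q:] \<in> P" using contr dvd by blast
      then have "- m \<in> P" unfolding m by (intro uminus_in mult_in)
      then have "q - m \<in> P" using add_in[OF q(1)] by fastforce
      moreover have "[:p:] dvd m" using dvd by (auto simp: m_def const_poly_dvd_iff)
      then have "\<not> [:p:] dvd q - m" using q(2) by (metis dvd_diff diff_diff_eq2 add_diff_cancel_right' dvd_add diff_add_cancel)
      ultimately have "degree q \<le> degree (q - m)" by (rule qmin)
      show False
      proof (cases "degree q = 0")
        case True
        then have "q = m" by (auto simp: m_def monom_0 elim!: degree_eq_zeroE)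
        then show False using q(2) \<open>[:p:] dvd m\<close> by simp
      next
        case False
        have "degree (q - m) < degree q"
        proof (rule degree_lessI)
          show "q - m \<noteq> 0 \<or> 0 < degree q" using False by simp
          show "\<forall>k\<ge>degree q. coeff (q - m) k = 0"
            by (auto simp: m_def coeff_eq_0)
        qed
        then show False using \<open>degree q \<le> degree (q - m)\<close> by simp
      qed
    qed
    show ?thesis
    proof (intro bexI[of _ q] ballI q(1))
      fix H assume H: "H \<in> P"
      obtain g t where gt: "pseudo_divmod H q = (g, t)" by force
      define c where "c = lead_coeff q ^ (Suc (degree H) - degree q)"
      from pseudo_divmod[OF q0 gt] have eq: "smult c H = q * g + t"
        and deg: "t = 0 \<or> degree t < degree q" by (auto simp: c_def)
      have "t = [:c:] * H + (- g) * q" using eq by (simp add: algebra_simps)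
      then have "t \<in> P" using H q(1) by (simp only: add_in mult_in)
      then have "[:p:] dvd t" using qmin deg by fastforce
      then obtain k where k: "t = [:p:] * k" by blast
      have "\<not> p dvd c" unfolding c_def using lc p prime_elem_dvd_power by blast
      then have "[:c:] \<notin> P" using contr by blast
      moreover have "[:c:] * H = k * [:p:] + g * q" using eq k by (simp add: algebra_simps)
      ultimately show "\<exists>s \<alpha> \<beta>. s \<notin> P \<and> s * H = \<alpha> * [:p:] + \<beta> * q" by blast
    qed
  qed
qed

lemma eval3_simps [simp]:
  "eval3 (F + G) v = eval3 F v + eval3 G v" "eval3 (F - G) v = eval3 F v - eval3 G v"
  "eval3 (- F) v = - eval3 F v" "eval3 (F * G) v = eval3 F v * eval3 G v"
  "eval3 (F ^ n) v = eval3 F v ^ n"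
  "eval3 0 v = 0" "eval3 1 v = 1" "eval3 (C3 c) v = c"
  "eval3 X3 v = v $ 1" "eval3 Y3 v = v $ 2" "eval3 Z3 v = v $ 3"
  by (simp_all add: eval3_def C3_def X3_def Y3_def Z3_def)

lemma eval3_numeral [simp]: "eval3 (numeral k) v = numeral k"
  by (simp add: eval3_def numeral_poly)

lemma zero_set_mult: "zero_set (F * G) = zero_set F \<union> zero_set G"
  by (auto simp: zero_set_def)

lemma algebraic_set_zero_set: "algebraic_set (zero_set F)"
  unfolding algebraic_set_def by (intro exI[of _ "{F}"]) simp

lemma algebraic_set_Int:
  assumes "algebraic_set A" "algebraic_set B"
  shows "algebraic_set (A \<inter> B)"
proof -
  obtain S T where "A = (\<Inter>F\<in>S. zero_set F)" "B = (\<Inter>F\<in>T. zero_set F)"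
    using assms unfolding algebraic_set_def by blast
  then have "A \<inter> B = (\<Inter>F\<in>S \<union> T. zero_set F)" by auto
  then show ?thesis unfolding algebraic_set_def by blast
qed

lemma algebraic_set_Un:
  assumes "algebraic_set A" "algebraic_set B"
  shows "algebraic_set (A \<union> B)"
proof -
  obtain S T where ST: "A = (\<Inter>F\<in>S. zero_set F)" "B = (\<Inter>F\<in>T. zero_set F)"
    using assms unfolding algebraic_set_def by blast
  have "A \<union> B = (\<Inter>H\<in>{F * G | F G. F \<in> S \<and> G \<in> T}. zero_set H)"
  proof
    show "A \<union> B \<subseteq> (\<Inter>H\<in>{F * G | F G. F \<in> S \<and> G \<in> T}. zero_set H)"
      unfolding ST by (auto simp: zero_set_mult)
    show "(\<Inter>H\<in>{F * G | F G. F \<in> S \<and> G \<in> T}. zero_set H) \<subseteq> A \<union> B"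
    proof (rule subsetI, rule ccontr)
      fix v assume v: "v \<in> (\<Inter>H\<in>{F * G | F G. F \<in> S \<and> G \<in> T}. zero_set H)" "v \<notin> A \<union> B"
      then obtain F G where "F \<in> S" "G \<in> T" "v \<notin> zero_set F" "v \<notin> zero_set G" unfolding ST by auto
      then have "v \<notin> zero_set (F * G)" by (simp add: zero_set_mult)
      then show False using v(1) \<open>F \<in> S\<close> \<open>G \<in> T\<close> by blast
    qed
  qed
  then show ?thesis unfolding algebraic_set_def by blast
qed

lemma algebraic_set_singleton: "algebraic_set {v}"
proof -
  have "{v} = zero_set (X3 - C3 (v $ 1)) \<inter> (zero_set (Y3 - C3 (v $ 2)) \<inter> zero_set (Z3 - C3 (v $ 3)))"
    by (auto simp: zero_set_def vec_eq_iff forall_3)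
  then show ?thesis by (metis algebraic_set_Int algebraic_set_zero_set)
qed

lemma algebraic_set_empty: "algebraic_set {}"
proof -
  have "{} = zero_set 1" by (auto simp: zero_set_def)
  then show ?thesis by (metis algebraic_set_zero_set)
qed

lemma algebraic_set_finite: "finite A \<Longrightarrow> algebraic_set A"
proof (induction A rule: finite_induct)
  case (insert x A)
  then show ?case using algebraic_set_Un[OF algebraic_set_singleton[of x]] by simp
qed (rule algebraic_set_empty)

lemma irreducible_set_singleton: "irreducible_set {v}"
  unfolding irreducible_set_def using algebraic_set_singleton by blast

lemma finite_irreducible_set:
  assumes "finite A" "irreducible_set A"
  shows "\<exists>v. A = {v}"
proof -
  obtain v where v: "v \<in> A" using assms(2) unfolding irreducible_set_def by blast
  have "A = {v} \<union> (A - {v})" using v by blast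
  moreover have "algebraic_set {v}" "algebraic_set (A - {v})" using assms(1) by (simp_all add: algebraic_set_finite)
  ultimately have "A = {v} \<or> A = A - {v}" using assms(2) unfolding irreducible_set_def by metis
  then show ?thesis using v by blast
qed

lemma alg_dim_ge:
  assumes "\<forall>k\<le>n. irreducible_set (W k) \<and> W k \<subseteq> V" "\<forall>k<n. W k \<subset> W (Suc k)"
  shows "enat n \<le> alg_dim V"
  unfolding alg_dim_def using assms by (intro SUP_upper) blast

text \<open>
  A finite irreducible set is a single point, so there is no strict chain of them.
\<close>

lemma infinite_if_alg_dim_pos:
  assumes "alg_dim D \<noteq> 0"
  shows "infinite D"
proof
  assume fin: "finite D"
  have "alg_dim D \<le> 0"
    unfolding alg_dim_def
  proof (rule SUP_least, clarify)
    fix n and W :: "nat \<Rightarrow> (real ^ 3) set"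
    assume W: "\<forall>k\<le>n. irreducible_set (W k) \<and> W k \<subseteq> D" "\<forall>k<n. W k \<subset> W (Suc k)"
    have "n = 0"
    proof (rule ccontr)
      assume "n \<noteq> 0"
      then have 1: "irreducible_set (W 0)" "irreducible_set (W 1)" "W 1 \<subseteq> D" "W 0 \<subset> W 1"
        using W by (auto simp: Suc_le_eq)
      have "finite (W 0)" "finite (W 1)" using 1 fin by (meson finite_subset psubset_imp_subset)+
      then obtain u v where "W 0 = {u}" "W 1 = {v}" using 1 finite_irreducible_set by metis
      then show False using 1 by auto
    qed
    then show "enat n \<le> 0" by (simp add: zero_enat_def)
  qed
  then show False using assms by simp
qed

lemma prime_ideal_set_vanishing_ideal:
  assumes D: "irreducible_set D"
  shows "prime_ideal_set (vanishing_ideal D)"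
proof
  show "1 \<notin> vanishing_ideal D" using D by (auto simp: vanishing_ideal_def irreducible_set_def)
  fix F G :: poly3 assume FG: "F * G \<in> vanishing_ideal D"
  then have "D \<subseteq> zero_set F \<union> zero_set G" by (auto simp: vanishing_ideal_def zero_set_def)
  then have "D = (D \<inter> zero_set F) \<union> (D \<inter> zero_set G)" by blast
  moreover have "algebraic_set D" using D by (simp add: irreducible_set_def)
  ultimately have "D = D \<inter> zero_set F \<or> D = D \<inter> zero_set G"
    using D algebraic_set_Int algebraic_set_zero_set unfolding irreducible_set_def by metis
  then show "F \<in> vanishing_ideal D \<or> G \<in> vanishing_ideal D"
    by (auto simp: vanishing_ideal_def zero_set_def)
qed (auto simp: vanishing_ideal_def)

section \<open>Multiple components and tangency\<close>

definition partial_x :: "poly3 \<Rightarrow> poly3" where "partial_x = map_poly (map_poly pderiv)"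
definition partial_y :: "poly3 \<Rightarrow> poly3" where "partial_y = map_poly pderiv"

text \<open>
  For a surface of revolution \<open>F = 0\<close> about the \<open>z\<close>-axis, this one minor of the Jacobian matrix is
  a multiple of the derivative of \<open>G\<close> along the rotation.
\<close>

definition jacobian_xy :: "poly3 \<Rightarrow> poly3 \<Rightarrow> poly3" where
  "jacobian_xy F G = partial_x F * partial_y G - partial_y F * partial_x G"

lemma vec3_eta: "vector [v $ 1, v $ 2, v $ 3] = (v :: real ^ 3)"
  by (simp add: vec_eq_iff forall_3)

text \<open>
  Identifying the formal derivatives with the analytic ones gives the product rule, and the
  derivatives of concrete polynomials, by uniqueness of the derivative.
\<close>

lemma DERIV_eval3_x:
  "((\<lambda>x. eval3 F (vector [x, y, z])) has_real_derivative eval3 (partial_x F) (vector [x, y, z])) (at x)"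
proof -
  have 1: "poly (map_poly pderiv c) [:y:] = pderiv (poly c [:y:])" for c :: "real poly poly"
    by (induction c) (simp_all add: map_poly_pCons pderiv_add pderiv_smult)
  have "poly (poly (partial_x F) [:[:z:]:]) [:y:] = pderiv (poly (poly F [:[:z:]:]) [:y:])"
    by (induction F) (simp_all add: partial_x_def map_poly_pCons pderiv_add pderiv_smult 1)
  then show ?thesis by (simp add: eval3_def)
qed

lemma DERIV_eval3_y:
  "((\<lambda>y. eval3 F (vector [x, y, z])) has_real_derivative eval3 (partial_y F) (vector [x, y, z])) (at y)"
proof -
  have 1: "((\<lambda>y. poly (poly c [:y:]) x) has_real_derivative poly (poly (pderiv c) [:y:]) x) (at y)"
    for c :: "real poly poly"
    by (induction c) (auto simp: pderiv_pCons intro!: derivative_eq_intros)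
  have "((\<lambda>y. poly (poly (poly F [:[:z:]:]) [:y:]) x) has_real_derivative
      poly (poly (poly (partial_y F) [:[:z:]:]) [:y:]) x) (at y)"
    by (induction F) (auto simp: partial_y_def map_poly_pCons intro!: derivative_eq_intros 1)
  then show ?thesis by (simp add: eval3_def)
qed

lemma eval3_partial_x_eqI:
  fixes v :: "real ^ 3"
  assumes "((\<lambda>x. eval3 F (vector [x, v $ 2, v $ 3])) has_real_derivative D) (at (v $ 1))"
  shows "eval3 (partial_x F) v = D"
  using DERIV_unique[OF DERIV_eval3_x assms] by (simp add: vec3_eta)

lemma eval3_partial_y_eqI:
  fixes v :: "real ^ 3"
  assumes "((\<lambda>y. eval3 F (vector [v $ 1, y, v $ 3])) has_real_derivative D) (at (v $ 2))"
  shows "eval3 (partial_y F) v = D"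
  using DERIV_unique[OF DERIV_eval3_y assms] by (simp add: vec3_eta)

lemma eval3_partial_mult:
  "eval3 (partial_x (F * G)) v = eval3 (partial_x F) v * eval3 G v + eval3 F v * eval3 (partial_x G) v"
  "eval3 (partial_y (F * G)) v = eval3 (partial_y F) v * eval3 G v + eval3 F v * eval3 (partial_y G) v"
  using DERIV_eval3_x[of F "v $ 2" "v $ 3" "v $ 1"] DERIV_eval3_x[of G "v $ 2" "v $ 3" "v $ 1"]
    DERIV_eval3_y[of F "v $ 1" "v $ 3" "v $ 2"] DERIV_eval3_y[of G "v $ 1" "v $ 3" "v $ 2"]
  by (auto intro!: eval3_partial_x_eqI eval3_partial_y_eqI derivative_eq_intros simp: vec3_eta)

lemma eval3_partial_add:
  "eval3 (partial_x (F + G)) v = eval3 (partial_x F) v + eval3 (partial_x G) v"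
  "eval3 (partial_y (F + G)) v = eval3 (partial_y F) v + eval3 (partial_y G) v"
  using DERIV_eval3_x[of F "v $ 2" "v $ 3" "v $ 1"] DERIV_eval3_x[of G "v $ 2" "v $ 3" "v $ 1"]
    DERIV_eval3_y[of F "v $ 1" "v $ 3" "v $ 2"] DERIV_eval3_y[of G "v $ 1" "v $ 3" "v $ 2"]
  by (auto intro!: eval3_partial_x_eqI eval3_partial_y_eqI derivative_eq_intros simp: vec3_eta)

text \<open>
  Let \<open>p\<close>, \<open>q\<close> generate the ideal of the curve up to denominators, and express \<open>F\<close> and \<open>G\<close> by
  them. On the curve, the Jacobian minor of \<open>F\<close>, \<open>G\<close> is the one of \<open>p\<close>, \<open>q\<close> times the determinant
  \<open>\<Delta>\<close> of this change of generators, up to denominators. If it does not vanish identically, then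
  neither does \<open>\<Delta>\<close>, which is thus invertible in the local ring, and Cramer's rule recovers \<open>p\<close>
  and \<open>q\<close> from \<open>F\<close> and \<open>G\<close>.
\<close>

lemma transversal_curve_generators:
  assumes D: "irreducible_set D" and p: "prime_elem p"
    and contr: "\<And>b. [:b:] \<in> vanishing_ideal D \<longleftrightarrow> p dvd b"
    and F: "F \<in> vanishing_ideal D" and G: "G \<in> vanishing_ideal D"
    and J: "jacobian_xy F G \<notin> vanishing_ideal D" and H: "H \<in> vanishing_ideal D"
  shows "\<exists>s u v. s \<notin> vanishing_ideal D \<and> s * H = u * F + v * G"
proof -
  let ?P = "vanishing_ideal D"
  interpret prime_ideal_set ?P using D by (rule prime_ideal_set_vanishing_ideal)
  obtain q where q: "q \<in> ?P"
    and gen: "\<And>H. H \<in> ?P \<Longrightarrow> \<exists>s \<alpha> \<beta>. s \<notin> ?P \<and> s * H = \<alpha> * [:p:] + \<beta> * q"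
    using generic_generators[OF prime_ideal_set_axioms p contr] by blast
  obtain s1 \<alpha>1 \<beta>1 where s1: "s1 \<notin> ?P" and F1: "s1 * F = \<alpha>1 * [:p:] + \<beta>1 * q" using gen[OF F] by blast
  obtain s2 \<alpha>2 \<beta>2 where s2: "s2 \<notin> ?P" and G1: "s2 * G = \<alpha>2 * [:p:] + \<beta>2 * q" using gen[OF G] by blast
  obtain s \<alpha> \<beta> where s: "s \<notin> ?P" and H1: "s * H = \<alpha> * [:p:] + \<beta> * q" using gen[OF H] by blast
  define \<Delta> where "\<Delta> = \<alpha>1 * \<beta>2 - \<alpha>2 * \<beta>1"
  have \<Delta>: "\<Delta> \<notin> ?P"
  proof
    assume \<Delta>: "\<Delta> \<in> ?P"
    have "s1 * s2 * jacobian_xy F G \<notin> ?P" using s1 s2 J mult_notin by blast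
    then obtain v where v: "v \<in> D" and nz: "eval3 (s1 * s2 * jacobian_xy F G) v \<noteq> 0"
      by (auto simp: vanishing_ideal_def)
    have "[:p:] \<in> ?P" using contr[of p] by simp
    then have zero: "eval3 F v = 0" "eval3 G v = 0" "eval3 [:p:] v = 0" "eval3 q v = 0" "eval3 \<Delta> v = 0"
      using v F G q \<Delta> by (auto simp: vanishing_ideal_def)
    have dx1: "eval3 s1 v * eval3 (partial_x F) v = eval3 \<alpha>1 v * eval3 (partial_x [:p:]) v + eval3 \<beta>1 v * eval3 (partial_x q) v"
      using arg_cong[OF F1, of "\<lambda>F. eval3 (partial_x F) v"]
      by (simp only: eval3_partial_add eval3_partial_mult zero mult_zero_right add_0_left)
    have dy1: "eval3 s1 v * eval3 (partial_y F) v = eval3 \<alpha>1 v * eval3 (partial_y [:p:]) v + eval3 \<beta>1 v * eval3 (partial_y q) v"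
      using arg_cong[OF F1, of "\<lambda>F. eval3 (partial_y F) v"]
      by (simp only: eval3_partial_add eval3_partial_mult zero mult_zero_right add_0_left)
    have dx2: "eval3 s2 v * eval3 (partial_x G) v = eval3 \<alpha>2 v * eval3 (partial_x [:p:]) v + eval3 \<beta>2 v * eval3 (partial_x q) v"
      using arg_cong[OF G1, of "\<lambda>F. eval3 (partial_x F) v"]
      by (simp only: eval3_partial_add eval3_partial_mult zero mult_zero_right add_0_left)
    have dy2: "eval3 s2 v * eval3 (partial_y G) v = eval3 \<alpha>2 v * eval3 (partial_y [:p:]) v + eval3 \<beta>2 v * eval3 (partial_y q) v"
      using arg_cong[OF G1, of "\<lambda>F. eval3 (partial_y F) v"]
      by (simp only: eval3_partial_add eval3_partial_mult zero mult_zero_right add_0_left)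
    have "eval3 (s1 * s2 * jacobian_xy F G) v =
        (eval3 s1 v * eval3 (partial_x F) v) * (eval3 s2 v * eval3 (partial_y G) v) -
        (eval3 s1 v * eval3 (partial_y F) v) * (eval3 s2 v * eval3 (partial_x G) v)"
      by (simp add: jacobian_xy_def algebra_simps)
    also have "\<dots> = eval3 \<Delta> v * (eval3 (partial_x [:p:]) v * eval3 (partial_y q) v -
        eval3 (partial_y [:p:]) v * eval3 (partial_x q) v)"
      unfolding dx1 dy1 dx2 dy2 \<Delta>_def by (simp add: algebra_simps)
    finally show False using nz zero by simp
  qed
  have "(s * \<Delta>) * H = \<alpha> * (\<Delta> * [:p:]) + \<beta> * (\<Delta> * q)"
    using arg_cong[OF H1, of "\<lambda>x. \<Delta> * x"] by (simp only: algebra_simps)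
  also have "\<Delta> * [:p:] = \<beta>2 * (s1 * F) - \<beta>1 * (s2 * G)" unfolding F1 G1 \<Delta>_def by (simp only: algebra_simps)
  also have "\<Delta> * q = \<alpha>1 * (s2 * G) - \<alpha>2 * (s1 * F)" unfolding F1 G1 \<Delta>_def by (simp only: algebra_simps)
  also have "\<alpha> * (\<beta>2 * (s1 * F) - \<beta>1 * (s2 * G)) + \<beta> * (\<alpha>1 * (s2 * G) - \<alpha>2 * (s1 * F)) =
      (\<alpha> * \<beta>2 * s1 - \<beta> * \<alpha>2 * s1) * F + (\<beta> * \<alpha>1 * s2 - \<alpha> * \<beta>1 * s2) * G"
    by (simp add: algebra_simps)
  finally show ?thesis using mult_notin[OF s \<Delta>] by blast
qed

text \<open>
  As \<open>Q\<close> and \<open>T\<close> have no common factor, eliminating \<open>z\<close> gives a nonzero polynomial in \<open>x\<close>, \<open>y\<close> that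
  vanishes on \<open>D\<close>; let \<open>p\<close> be a prime factor vanishing on \<open>D\<close>. Another polynomial in \<open>x\<close>, \<open>y\<close> that
  vanishes on \<open>D\<close> but is not divisible by \<open>p\<close> would leave finitely many points for the projection of
  \<open>D\<close>, and then \<open>D\<close> would be finite because the vertical fibres of \<open>Q\<close> are.
\<close>

lemma curve_projection_ideal:
  assumes D: "irreducible_set D" "infinite D"
    and Q: "prime_elem Q" "Q \<in> vanishing_ideal D" and T: "T \<in> vanishing_ideal D" "\<not> Q dvd T"
    and fib: "\<And>x y. finite {z. eval3 Q (vector [x, y, z]) = 0}"
  shows "\<exists>p. prime_elem p \<and> (\<forall>b. [:b:] \<in> vanishing_ideal D \<longleftrightarrow> p dvd b)"
proof -
  let ?P = "vanishing_ideal D"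
  interpret prime_ideal_set ?P using D(1) by (rule prime_ideal_set_vanishing_ideal)
  obtain u w c where c: "c \<noteq> 0" and uw: "u * Q + w * T = [:c:]"
    using prime_elem_poly_bezout[OF Q(1) T(2)] by blast
  have "[:c:] \<in> ?P" unfolding uw[symmetric] by (intro add_in mult_in Q(2) T(1))
  moreover have "[:x:] \<notin> ?P" if "is_unit x" for x
  proof
    assume "[:x:] \<in> ?P"
    moreover from \<open>is_unit x\<close> obtain y where "1 = x * y" by (elim dvdE)
    ultimately have "[:y:] * [:x:] \<in> ?P" "[:y:] * [:x:] = 1"
      by (simp_all only: mult_in, simp add: mult.commute pCons_one)
    then show False using one_notin by simp
  qed
  moreover have "[:x:] \<in> ?P \<or> [:y:] \<in> ?P" if "[:x * y:] \<in> ?P" for x y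
    using prime[of "[:x:]" "[:y:]"] that by (simp add: mult.commute)
  ultimately obtain p where p: "prime_elem p" "[:p:] \<in> ?P"
    using prime_divisor_inherits[of c "\<lambda>x. [:x:] \<in> ?P"] c by blast
  have "p dvd b" if b: "[:b:] \<in> ?P" for b
  proof (rule ccontr)
    assume "\<not> p dvd b"
    then have fin: "finite {(x, y). poly (poly p [:y:]) x = 0 \<and> poly (poly b [:y:]) x = 0}" (is "finite ?Z")
      by (rule finite_common_zeros[OF p(1)])
    have "D \<subseteq> (\<lambda>((x, y), z). vector [x, y, z]) ` (SIGMA xy:?Z. {z. eval3 Q (vector [fst xy, snd xy, z]) = 0})"
    proof
      fix v assume v: "v \<in> D"
      have "eval3 [:p:] v = 0" "eval3 [:b:] v = 0" "eval3 Q v = 0"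
        using v p(2) b Q(2) by (auto simp: vanishing_ideal_def)
      then have "((v $ 1, v $ 2), v $ 3) \<in> (SIGMA xy:?Z. {z. eval3 Q (vector [fst xy, snd xy, z]) = 0})"
        by (simp add: eval3_def)
      then show "v \<in> (\<lambda>((x, y), z). vector [x, y, z]) `
          (SIGMA xy:?Z. {z. eval3 Q (vector [fst xy, snd xy, z]) = 0})"
        by (rule rev_image_eqI) (simp add: vec3_eta)
    qed
    moreover have "finite (SIGMA xy:?Z. {z. eval3 Q (vector [fst xy, snd xy, z]) = 0})"
      using fin fib by blast
    ultimately show False using D(2) finite_surj by blast
  qed
  moreover have "[:b:] \<in> ?P" if "p dvd b" for b
  proof -
    from that obtain k where "b = p * k" by blast
    then have "[:b:] = [:k:] * [:p:]" by (simp add: mult.commute)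
    then show ?thesis using mult_in[OF p(2)] by (simp only:)
  qed
  ultimately show ?thesis using p(1) by blast
qed

lemma quadric_poly_pCons:
  "quadric_poly a b d e f g h i j =
     [:[:[:j, g, a:], [:h, d:], [:b:]:], [:[:i, e:], [:f:]:], 1:]"
  by (simp add: quadric_poly_def quadric_q1_def quadric_q0_def C3_def X3_def Y3_def Z3_def
      power2_eq_square one_pCons)

lemma torus_poly_pCons:
  "torus_poly R r =
     [:[:[:(R + r)\<^sup>2, 0, - 1:], 0, [:- 1:]:] * [:[:(R - r)\<^sup>2, 0, - 1:], 0, [:- 1:]:], 0,
       [:[:2 * (R\<^sup>2 - r\<^sup>2), 0, 2:], 0, [:2:]:], 0, 1:]"
  by (simp add: torus_poly_def torus_p2_def torus_p0_def C3_def X3_def Y3_def Z3_def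
      power2_eq_square one_pCons eval_nat_numeral algebra_simps)

text \<open>
  The torus polynomial is \<open>z\<^sup>4 + t\<^sub>2 z\<^sup>2 + t\<^sub>0\<close>. In a factorization into two quadratics in \<open>z\<close> with linear
  coefficients \<open>q\<^sub>1\<close> and \<open>-q\<^sub>1\<close>, either \<open>q\<^sub>1 = 0\<close>, and \<open>t\<^sub>2\<^sup>2 - 4 t\<^sub>0 = 16 R\<^sup>2 (x\<^sup>2 + y\<^sup>2)\<close> would be a
  square; or the constant coefficients agree, and \<open>t\<^sub>0\<close> would be a square, although it is negative
  at \<open>(R, 0)\<close>, which is inside the tube.
\<close>

lemma monic_quadratic_not_dvd_torus:
  assumes r: "0 < r" and R: "r < R"
  shows "\<not> [:q0, q1, 1:] dvd torus_poly R r"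
proof
  define A B t0 t2 :: "real poly poly"
    where "A = [:[:(R + r)\<^sup>2, 0, - 1:], 0, [:- 1:]:]" and "B = [:[:(R - r)\<^sup>2, 0, - 1:], 0, [:- 1:]:]"
      and "t0 = A * B" and "t2 = [:[:2 * (R\<^sup>2 - r\<^sup>2), 0, 2:], 0, [:2:]:]"
  have T: "torus_poly R r = [:t0, 0, t2, 0, 1:]"
    unfolding torus_poly_pCons A_def B_def t0_def t2_def ..
  assume "[:q0, q1, 1:] dvd torus_poly R r"
  then obtain S where S: "[:t0, 0, t2, 0, 1:] = [:q0, q1, 1:] * S" unfolding T by blast
  have "degree [:t0, 0, t2, 0, 1:] = 4" by simp
  moreover have "S \<noteq> 0" using S by auto
  ultimately have "degree S = 2" using degree_mult_eq[of "[:q0, q1, 1:]" S] unfolding S by simp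
  then obtain s0 s1 s2 where S': "S = [:s0, s1, s2:]" using degree_le_2_poly_eq[of S] by auto
  have "[:q0, q1, 1:] * S = [:q0 * s0, q0 * s1 + q1 * s0, q0 * s2 + q1 * s1 + s0, q1 * s2 + s1, s2:]"
    unfolding S' by simp
  note c = S[unfolded this pCons_eq_iff]
  have c0: "t0 = q0 * s0" and c1: "q0 * s1 + q1 * s0 = 0" and c2: "t2 = q0 * s2 + q1 * s1 + s0"
    and c3: "q1 * s2 + s1 = 0" and c4: "s2 = 1" using c by auto
  have s1: "s1 = - q1" using c3 c4 by (simp add: add_eq_0_iff)
  have "q1 * (s0 - q0) = 0" using c1 s1 by (simp add: algebra_simps)
  then consider "q1 = 0" | "s0 = q0" by auto
  then show False
  proof cases
    case 1
    then have sum: "t2 = q0 + s0" using c2 c4 by simp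
    define W where "W = q0 - s0"
    have "W\<^sup>2 = t2\<^sup>2 - 4 * t0" unfolding W_def sum c0 by (simp add: power2_eq_square algebra_simps)
    also have "\<dots> = [:[:0, 0, 16 * R\<^sup>2:], 0, [:16 * R\<^sup>2:]:]"
      by (simp add: t2_def t0_def A_def B_def power2_eq_square algebra_simps numeral_poly)
    finally have W: "W\<^sup>2 = [:[:0, 0, 16 * R\<^sup>2:], 0, [:16 * R\<^sup>2:]:]" .
    have R0: "R \<noteq> 0" using r R by simp
    have "W \<noteq> 0" using W R0 by auto
    then have "degree W = 1" using arg_cong[OF W, of degree] R0 by (simp add: degree_power_eq)
    then obtain w0 w1 where W': "W = [:w0, w1:]"
      using degree_le_2_poly_eq[of W] coeff_eq_0[of W 2] by auto
    have "W\<^sup>2 = [:w0 * w0, w0 * w1 + w0 * w1, w1 * w1:]"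
      unfolding W' power2_eq_square by (simp add: mult.commute)
    note w = W[unfolded this pCons_eq_iff]
    have "w0 * w1 + w0 * w1 = 0" "w0 \<noteq> 0" "w1 \<noteq> 0" using w R0 by auto
    then have "smult 2 (w0 * w1) = 0" by (metis one_add_one smult_1_left smult_add_left)
    then show False using \<open>w0 \<noteq> 0\<close> \<open>w1 \<noteq> 0\<close> by simp
  next
    case 2
    have "poly (poly t0 0) R = (poly (poly q0 0) R)\<^sup>2" unfolding c0 2 by (simp add: power2_eq_square)
    moreover have "poly (poly t0 0) R = (r * (2 * R + r)) * (- (r * (2 * R - r)))"
      by (simp add: t0_def A_def B_def power2_eq_square algebra_simps)
    moreover have "0 < (r * (2 * R + r)) * (r * (2 * R - r))" using r R by (intro mult_pos_pos) auto
    ultimately show False using zero_le_power2[of "poly (poly q0 0) R"] by linarith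
  qed
qed

lemma finite_quadric_fibre:
  "finite {z. eval3 (quadric_poly a b d e f g h i j) (vector [x, y, z]) = 0}"
proof -
  define q0 q1 where "q0 = a * x\<^sup>2 + b * y\<^sup>2 + d * x * y + g * x + h * y + j" and "q1 = e * x + f * y + i"
  have "finite {z. poly [:q0, q1, 1:] z = 0}" by (rule poly_roots_finite) simp
  moreover have "{z. eval3 (quadric_poly a b d e f g h i j) (vector [x, y, z]) = 0} = {z. poly [:q0, q1, 1:] z = 0}"
    by (simp add: quadric_poly_def quadric_q1_def quadric_q0_def q0_def q1_def power2_eq_square algebra_simps)
  ultimately show ?thesis by simp
qed

text \<open>
  Otherwise \<open>T\<close> and \<open>Q\<close> generate the maximal ideal of the local ring of \<open>D\<close>.
\<close>

lemma jacobian_vanishes_on_multiple_component: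
  assumes r: "0 < r" and R: "r < R"
    and irr: "irreducible (quadric_poly a b d e f g h i j)"
    and mult: "multiple_component D (torus_poly R r) (quadric_poly a b d e f g h i j)"
  shows "jacobian_xy (torus_poly R r) (quadric_poly a b d e f g h i j) \<in> vanishing_ideal D"
proof (rule ccontr)
  let ?T = "torus_poly R r" and ?Q = "quadric_poly a b d e f g h i j"
  assume J: "jacobian_xy ?T ?Q \<notin> vanishing_ideal D"
  have D: "irreducible_set D" and sub: "D \<subseteq> zero_set ?T \<inter> zero_set ?Q" and dim: "alg_dim D = 1"
    and ge: "2 \<le> intersection_multiplicity ?T ?Q D"
    using mult by (auto simp: multiple_component_def irreducible_component_def)
  have "infinite D" using dim by (intro infinite_if_alg_dim_pos) simp
  have T: "?T \<in> vanishing_ideal D" and Q: "?Q \<in> vanishing_ideal D"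
    using sub by (auto simp: vanishing_ideal_def zero_set_def)
  have "prime_elem ?Q" using irr by (rule irreducible_imp_prime_elem)
  moreover have "\<not> ?Q dvd ?T"
    unfolding quadric_poly_pCons by (rule monic_quadratic_not_dvd_torus[OF r R])
  ultimately obtain p where p: "prime_elem p" and contr: "\<And>b. [:b:] \<in> vanishing_ideal D \<longleftrightarrow> p dvd b"
    using curve_projection_ideal[OF D \<open>infinite D\<close> _ Q T] finite_quadric_fibre by blast
  have "intersection_multiplicity ?T ?Q D \<le> 1"
    by (rule intersection_multiplicity_le_1[OF prime_ideal_set_vanishing_ideal[OF D] T Q])
      (rule transversal_curve_generators[OF D p contr T Q J])
  with ge have "(2 :: enat) \<le> 1" by (rule order_trans)
  then show False by simp
qed

section \<open>A quadric restricted to the torus\<close>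

lemma unit_mult_cnj: "cmod V = 1 \<Longrightarrow> V * cnj V = 1"
  by (simp add: complex_norm_square[symmetric])

lemma torus_radius_pos:
  assumes "0 < r" "r < R" "cmod V = 1"
  shows "0 < R + r * Re V"
proof -
  have "\<bar>Re V\<bar> \<le> 1" using assms(3) abs_Re_le_cmod[of V] by simp
  then have "r * (- 1) \<le> r * Re V" using assms(1) by (intro mult_left_mono) (auto simp: abs_le_iff)
  then show ?thesis using assms(2) by linarith
qed

text \<open>
  For \<open>V = exp (\<i> \<phi>)\<close>, a point of the circle \<open>\<rho> = R + r cos \<phi>\<close>, \<open>z = r sin \<phi>\<close> has coordinates
  that are Laurent polynomials in \<open>V\<close>. Multiplied by the power of \<open>V\<close> that clears the denominators,
  \<open>\<rho>\<close> and \<open>z\<close> become \<open>rho_poly\<close> and \<open>height_poly\<close>, the function \<open>(\<epsilon> z + \<gamma>) / 2\<close> becomes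
  \<open>lin_poly\<close>, and \<open>z\<^sup>2 + i z + j + \<beta> \<rho>\<^sup>2\<close> becomes \<open>mid_poly\<close>.
\<close>

definition rho_poly :: "real \<Rightarrow> real \<Rightarrow> complex poly" where
  "rho_poly R r = [:of_real (r / 2), of_real R, of_real (r / 2):]"

definition height_poly :: "real \<Rightarrow> complex poly" where
  "height_poly r = [:\<i> * of_real (r / 2), 0, - \<i> * of_real (r / 2):]"

definition lin_poly :: "real \<Rightarrow> complex \<Rightarrow> complex \<Rightarrow> complex poly" where
  "lin_poly r \<epsilon> \<gamma> = smult (\<epsilon> / 2) (height_poly r) + smult (\<gamma> / 2) [:0, 1:]"

definition mid_poly :: "real \<Rightarrow> real \<Rightarrow> real \<Rightarrow> real \<Rightarrow> real \<Rightarrow> complex poly" where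
  "mid_poly R r \<beta> i j = (height_poly r)\<^sup>2 + smult (of_real i) ([:0, 1:] * height_poly r) +
     smult (of_real j) ([:0, 1:]\<^sup>2) + smult (of_real \<beta>) ((rho_poly R r)\<^sup>2)"

text \<open>
  These are the relations between the coefficients that make the quadric the square of the plane
  \<open>z + Re (\<epsilon> (x + \<i> y)) / 2 + i / 2\<close>.
\<close>

definition square_coeffs :: "complex \<Rightarrow> complex \<Rightarrow> complex \<Rightarrow> real \<Rightarrow> real \<Rightarrow> real \<Rightarrow> bool" where
  "square_coeffs \<kappa> \<epsilon> \<gamma> \<beta> i j \<longleftrightarrow>
     \<epsilon>\<^sup>2 = 16 * \<kappa> \<and> \<beta> = (cmod \<epsilon>)\<^sup>2 / 8 \<and> \<gamma> = \<epsilon> * of_real i / 2 \<and> j = i\<^sup>2 / 4"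

text \<open>
  A quadric with leading term \<open>z\<^sup>2\<close>, as a function of \<open>w = x + \<i> y\<close> and \<open>z\<close>, takes this form with
  complex \<open>\<kappa>\<close>, \<open>\<epsilon>\<close>, \<open>\<gamma>\<close> and real \<open>\<beta>\<close>, \<open>i\<close>, \<open>j\<close>; here it is evaluated on the torus.
\<close>

definition torus_form ::
  "real \<Rightarrow> real \<Rightarrow> complex \<Rightarrow> complex \<Rightarrow> complex \<Rightarrow> real \<Rightarrow> real \<Rightarrow> real \<Rightarrow> complex \<times> complex \<Rightarrow> real" where
  "torus_form R r \<kappa> \<epsilon> \<gamma> \<beta> i j = (\<lambda>(V, U).
     let \<rho> = R + r * Re V; z = r * Im V; w = of_real \<rho> * U
     in 2 * Re (\<kappa> * w\<^sup>2) + Re ((\<epsilon> * of_real z + \<gamma>) * w) + z\<^sup>2 + i * z + j + \<beta> * \<rho>\<^sup>2)"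

text \<open>
  The derivative of \<open>torus_form\<close> with respect to the argument of \<open>U\<close>.
\<close>

definition torus_form_deriv ::
  "real \<Rightarrow> real \<Rightarrow> complex \<Rightarrow> complex \<Rightarrow> complex \<Rightarrow> complex \<times> complex \<Rightarrow> real" where
  "torus_form_deriv R r \<kappa> \<epsilon> \<gamma> = (\<lambda>(V, U).
     let \<rho> = R + r * Re V; z = r * Im V; w = of_real \<rho> * U
     in - 4 * Im (\<kappa> * w\<^sup>2) - Im ((\<epsilon> * of_real z + \<gamma>) * w))"

text \<open>
  On the product of the unit circles this is \<open>U\<^sup>2 V\<^sup>2\<close> times \<open>torus_form\<close>, as a polynomial in \<open>U\<close>
  with coefficients in \<open>\<complex>[V]\<close>.
\<close>

definition torus_quartic ::
  "real \<Rightarrow> real \<Rightarrow> complex \<Rightarrow> complex \<Rightarrow> complex \<Rightarrow> real \<Rightarrow> real \<Rightarrow> real \<Rightarrow> complex poly poly" where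
  "torus_quartic R r \<kappa> \<epsilon> \<gamma> \<beta> i j =
     [:smult (cnj \<kappa>) ((rho_poly R r)\<^sup>2), rho_poly R r * lin_poly r (cnj \<epsilon>) (cnj \<gamma>),
       mid_poly R r \<beta> i j, rho_poly R r * lin_poly r \<epsilon> \<gamma>, smult \<kappa> ((rho_poly R r)\<^sup>2):]"

lemma lin_poly_eq:
  "lin_poly r \<epsilon> \<gamma> = [:\<epsilon> * \<i> * of_real r / 4, \<gamma> / 2, - \<epsilon> * \<i> * of_real r / 4:]"
  by (simp add: lin_poly_def height_poly_def)

lemma mid_poly_eq:
  "mid_poly R r \<beta> i j =
     [:of_real ((\<beta> - 1) * r\<^sup>2 / 4), \<i> * of_real (i * r / 2) + of_real (\<beta> * R * r),
       of_real (r\<^sup>2 / 2 + j + \<beta> * (R\<^sup>2 + r\<^sup>2 / 2)),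
       - \<i> * of_real (i * r / 2) + of_real (\<beta> * R * r), of_real ((\<beta> - 1) * r\<^sup>2 / 4):]"
  by (simp add: mid_poly_def height_poly_def rho_poly_def power2_eq_square algebra_simps
      add_divide_distrib diff_divide_distrib) 

lemma rho_poly_nz: "r \<noteq> 0 \<Longrightarrow> rho_poly R r \<noteq> 0"
  by (simp add: rho_poly_def)

lemma degree_rho_poly: "r \<noteq> 0 \<Longrightarrow> degree (rho_poly R r) = 2"
  by (simp add: rho_poly_def)

section \<open>Contact along a double conic or a Villarceau circle\<close>

text \<open>
  For \<open>\<kappa> = 0\<close> the quartic is \<open>U\<close> times a quadratic polynomial, and the hypothesis says that the
  discriminant of the latter vanishes. Hence \<open>rho_poly\<close> divides \<open>mid_poly\<close>. Comparing coefficients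
  determines the quotient \<open>m\<close>, and the leading coefficient of \<open>m\<^sup>2\<close> equals both a square and minus a
  square of real numbers, so both are zero.
\<close>

lemma constant_longitude_coeffs:
  assumes r: "0 < r" and R: "r < R"
    and eq: "(mid_poly R r \<beta> i j)\<^sup>2 =
      smult 4 ((rho_poly R r)\<^sup>2 * (lin_poly r \<epsilon> \<gamma> * lin_poly r (cnj \<epsilon>) (cnj \<gamma>)))"
  shows "\<epsilon> = 0 \<and> \<gamma> \<noteq> 0 \<and> mid_poly R r \<beta> i j = rho_poly R r * [:0, of_real (2 * R):]"
proof -
  let ?rho = "rho_poly R r"
  have "?rho\<^sup>2 dvd (mid_poly R r \<beta> i j)\<^sup>2"
    unfolding eq by (simp add: dvd_smult)
  then have "?rho dvd mid_poly R r \<beta> i j"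
    by simp
  then obtain m where m: "mid_poly R r \<beta> i j = ?rho * m" by auto
  have "degree m \<le> 2"
  proof (cases "m = 0")
    case False
    have "degree (?rho * m) \<le> 4"
      unfolding m[symmetric] mid_poly_eq by (auto simp: degree_pCons_eq_if)
    then show ?thesis using False r by (simp add: degree_mult_eq rho_poly_nz degree_rho_poly)
  qed simp
  then obtain m0 m1 m2 where m_eq: "m = [:m0, m1, m2:]"
    using degree_le_2_poly_eq by blast
  have prod: "?rho * m = [:of_real (r/2) * m0, of_real (r/2) * m1 + of_real R * m0,
      of_real (r/2) * m2 + of_real R * m1 + of_real (r/2) * m0,
      of_real R * m2 + of_real (r/2) * m1, of_real (r/2) * m2:]"
    by (simp add: m_eq rho_poly_def algebra_simps)
  note c = m[unfolded prod mid_poly_eq pCons_eq_iff]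
  have c0: "of_real ((\<beta> - 1) * r\<^sup>2 / 4) = of_real (r/2) * m0"
    and c1: "\<i> * of_real (i * r / 2) + of_real (\<beta> * R * r) = of_real (r/2) * m1 + of_real R * m0"
    and c3: "- \<i> * of_real (i * r / 2) + of_real (\<beta> * R * r) = of_real R * m2 + of_real (r/2) * m1"
    and c4: "of_real ((\<beta> - 1) * r\<^sup>2 / 4) = of_real (r/2) * m2"
    using c by blast+
  have rnz: "of_real (r/2) \<noteq> (0::complex)" using r by simp
  have "of_real ((\<beta> - 1) * r\<^sup>2 / 4) = of_real (r/2) * (of_real ((\<beta> - 1) * r / 2) :: complex)"
    by (simp add: power2_eq_square)
  with c0 c4 rnz have m02: "m0 = of_real ((\<beta> - 1) * r / 2)" "m2 = of_real ((\<beta> - 1) * r / 2)"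
    by (metis mult_cancel_left)+
  have i0: "i = 0"
  proof -
    from c1 c3 m02 have "\<i> * of_real (i * r / 2) = - \<i> * of_real (i * r / 2)"
      by (metis add.commute add_right_imp_eq)
    then show ?thesis using r by (simp add: complex_eq_iff)
  qed
  have m1: "m1 = of_real ((\<beta> + 1) * R)"
  proof -
    have "of_real (r/2) * m1 = of_real (\<beta> * R * r) - of_real R * (of_real ((\<beta> - 1) * r / 2) :: complex)"
      using c1 by (simp add: i0 m02)
    also have "\<dots> = of_real (r/2) * of_real ((\<beta> + 1) * R)"
      unfolding of_real_mult[symmetric] of_real_diff[symmetric] of_real_eq_iff by (simp add: field_simps)
    finally show ?thesis using rnz mult_cancel_left by blast
  qed
  have "?rho\<^sup>2 * m\<^sup>2 = ?rho\<^sup>2 * smult 4 (lin_poly r \<epsilon> \<gamma> * lin_poly r (cnj \<epsilon>) (cnj \<gamma>))"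
    using eq unfolding m by (simp add: power_mult_distrib)
  then have m_sq: "m\<^sup>2 = smult 4 (lin_poly r \<epsilon> \<gamma> * lin_poly r (cnj \<epsilon>) (cnj \<gamma>))"
    using rho_poly_nz[of r R] r by (simp only: mult_cancel_left power_eq_0_iff) simp
  have "coeff (m\<^sup>2) 4 = m2\<^sup>2"
    by (simp add: m_eq power2_eq_square eval_nat_numeral)
  moreover have "coeff (m\<^sup>2) 4 = 4 * ((- \<epsilon> * \<i> * of_real r / 4) * (- cnj \<epsilon> * \<i> * of_real r / 4))"
    unfolding m_sq lin_poly_eq by (simp add: eval_nat_numeral)
  ultimately have "m2\<^sup>2 = - (\<epsilon> * cnj \<epsilon> * of_real r ^ 2 / 4)"
    by (simp add: power2_eq_square)
  then have "of_real (((\<beta> - 1) * r / 2)\<^sup>2) = (of_real (- ((cmod \<epsilon>)\<^sup>2 * r ^ 2 / 4)) :: complex)"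
    by (simp add: m02 complex_norm_square[symmetric])
  then have "((\<beta> - 1) * r / 2)\<^sup>2 = - ((cmod \<epsilon>)\<^sup>2 * r ^ 2 / 4)"
    by (simp only: of_real_eq_iff)
  moreover have "0 \<le> (cmod \<epsilon>)\<^sup>2 * r ^ 2 / 4" "0 \<le> ((\<beta> - 1) * r / 2)\<^sup>2" by simp_all
  ultimately have z: "((\<beta> - 1) * r / 2)\<^sup>2 = 0" "(cmod \<epsilon>)\<^sup>2 * r ^ 2 / 4 = 0" by linarith+
  then have b1: "\<beta> = 1" and e0: "\<epsilon> = 0" using r by auto
  have m_final: "m = [:0, of_real (2 * R):]" by (simp add: m_eq m02 m1 b1)
  have "\<gamma> \<noteq> 0"
  proof
    assume "\<gamma> = 0"
    then have "m\<^sup>2 = 0" unfolding m_sq lin_poly_eq by (simp add: e0)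
    then show False using m_final r R by simp
  qed
  then show ?thesis using e0 m m_final by simp
qed

text \<open>
  The hypotheses say that the quartic is \<open>E (P\<^sub>2 U\<^sup>2 + P\<^sub>1 U + P\<^sub>0)\<^sup>2\<close>. The product \<open>W = E P\<^sub>0 P\<^sub>2\<close> is
  known up to sign from the outer coefficients, so \<open>W\<close> eliminates \<open>E\<close> and the \<open>P\<^sub>k\<close> from
  \<open>e4\<close>, \<open>e3\<close> and \<open>e2\<close>: what remains expresses the square of \<open>lin_poly\<close> by \<open>mid_poly\<close> with a
  changed \<open>\<beta>\<close>. Comparing coefficients gives all relations except the sign in \<open>\<beta>\<close>, which follows
  from \<open>e1\<close>.
\<close>

lemma square_if_double_conic:
  fixes P0 P1 P2 E :: "complex poly"
  assumes r: "0 < r" and R: "r < R" and \<kappa>: "\<kappa> \<noteq> 0"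
    and e4: "E * P2\<^sup>2 = smult \<kappa> ((rho_poly R r)\<^sup>2)"
    and e3: "smult 2 (E * P1 * P2) = rho_poly R r * lin_poly r \<epsilon> \<gamma>"
    and e2: "E * (P1\<^sup>2 + smult 2 (P0 * P2)) = mid_poly R r \<beta> i j"
    and e1: "smult 2 (E * P1 * P0) = rho_poly R r * lin_poly r (cnj \<epsilon>) (cnj \<gamma>)"
    and e0: "E * P0\<^sup>2 = smult (cnj \<kappa>) ((rho_poly R r)\<^sup>2)"
  shows "square_coeffs \<kappa> \<epsilon> \<gamma> \<beta> i j"
proof -
  let ?rho = "rho_poly R r" and ?L = "lin_poly r \<epsilon> \<gamma>" and ?L' = "lin_poly r (cnj \<epsilon>) (cnj \<gamma>)"
  have rho0: "?rho \<noteq> 0" using r by (simp add: rho_poly_nz)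
  define W where "W = E * P0 * P2"
  have "W\<^sup>2 = (E * P2\<^sup>2) * (E * P0\<^sup>2)" by (simp add: W_def power2_eq_square algebra_simps)
  also have "\<dots> = (smult (of_real (cmod \<kappa>)) (?rho\<^sup>2))\<^sup>2"
    unfolding e4 e0 using complex_norm_square[of \<kappa>, symmetric] by (simp add: power2_eq_square mult.commute)
  finally have "W = smult (of_real (cmod \<kappa>)) (?rho\<^sup>2) \<or> W = - smult (of_real (cmod \<kappa>)) (?rho\<^sup>2)"
    by (simp add: power2_eq_iff)
  then obtain \<tau> :: real where \<tau>: "\<tau> = 1 \<or> \<tau> = -1" and W: "W = smult (of_real (\<tau> * cmod \<kappa>)) (?rho\<^sup>2)"
    by (metis (no_types) mult_1 mult_minus1 of_real_minus smult_minus_left)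
  define \<beta>' where "\<beta>' = \<beta> - 2 * \<tau> * cmod \<kappa>"
  have "?rho\<^sup>2 * ?L\<^sup>2 = (smult 2 (E * P1 * P2))\<^sup>2" unfolding e3 by (simp add: power_mult_distrib)
  also have "\<dots> = smult 4 ((E * P2\<^sup>2) * (E * (P1\<^sup>2 + smult 2 (P0 * P2)) - smult 2 W))"
    by (simp add: W_def power2_eq_square algebra_simps)
  also have "\<dots> = ?rho\<^sup>2 * smult (4 * \<kappa>) (mid_poly R r \<beta> i j - smult 2 W)"
    unfolding e4 e2 by simp
  finally have "?L\<^sup>2 = smult (4 * \<kappa>) (mid_poly R r \<beta> i j - smult 2 W)"
    using rho0 by (simp del: mult_smult_right add: mult_smult_right[symmetric])
  also have "mid_poly R r \<beta> i j - smult 2 W = mid_poly R r \<beta>' i j"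
    unfolding W mid_poly_def \<beta>'_def by (simp add: algebra_simps smult_diff_left smult_add_left)
  finally have LL: "?L\<^sup>2 = smult (4 * \<kappa>) (mid_poly R r \<beta>' i j)" .
  define A B where "A = \<epsilon> * \<i> * of_real r / 4" and "B = \<gamma> / 2"
  have "?L = [:A, B, - A:]" by (simp add: lin_poly_eq A_def B_def)
  then have "?L\<^sup>2 = [:A\<^sup>2, 2 * A * B, B\<^sup>2 - 2 * A\<^sup>2, - 2 * A * B, A\<^sup>2:]"
    by (simp add: power2_eq_square)
  note c = LL[unfolded this mid_poly_eq smult_pCons pCons_eq_iff]
  have c0: "A\<^sup>2 = 4 * \<kappa> * of_real ((\<beta>' - 1) * r\<^sup>2 / 4)"
    and c1: "2 * A * B = 4 * \<kappa> * (\<i> * of_real (i * r / 2) + of_real (\<beta>' * R * r))"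
    and c2: "B\<^sup>2 - 2 * A\<^sup>2 = 4 * \<kappa> * of_real (r\<^sup>2 / 2 + j + \<beta>' * (R\<^sup>2 + r\<^sup>2 / 2))"
    and c3: "- 2 * A * B = 4 * \<kappa> * (- \<i> * of_real (i * r / 2) + of_real (\<beta>' * R * r))"
    using c by blast+
  have rnz: "of_real r \<noteq> (0::complex)" using r by simp
  have "8 * \<kappa> * of_real (\<beta>' * R * r) = 0"
    using arg_cong2[OF c1 c3, of "(+)"] by (simp add: algebra_simps)
  then have b: "\<beta>' = 0" using \<kappa> r R by simp
  have AA: "A\<^sup>2 = - (\<epsilon>\<^sup>2 * (of_real r)\<^sup>2 / 16)"
    by (simp add: A_def power_mult_distrib power_divide)
  have "(of_real r)\<^sup>2 * \<epsilon>\<^sup>2 = (of_real r)\<^sup>2 * (16 * \<kappa>)"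
    using c0 unfolding AA b by (simp add: mult.commute)
  then have ee: "\<epsilon>\<^sup>2 = 16 * \<kappa>" using rnz mult_cancel_left power_eq_0_iff by blast
  then have e_nz: "\<epsilon> \<noteq> 0" using \<kappa> by auto
  have "(\<i> * of_real r) * (\<epsilon> * \<gamma>) = (\<i> * of_real r) * (8 * \<kappa> * of_real i)"
    using c1 unfolding A_def B_def b by (simp add: ac_simps)
  then have "\<epsilon> * \<gamma> = 8 * \<kappa> * of_real i"
    using rnz by (metis complex_i_not_zero mult_cancel_left mult_eq_0_iff)
  also have "\<dots> = \<epsilon> * (\<epsilon> * of_real i / 2)" using ee by (simp add: power2_eq_square)
  finally have g: "\<gamma> = \<epsilon> * of_real i / 2" using e_nz mult_cancel_left by blast
  have "B\<^sup>2 = 4 * \<kappa> * of_real (r\<^sup>2 / 2 + j) - 2 * (\<kappa> * (of_real r)\<^sup>2)"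
    using c2 unfolding AA b ee by (simp add: algebra_simps)
  also have "\<dots> = 4 * \<kappa> * of_real j" by (simp add: algebra_simps)
  finally have "\<gamma>\<^sup>2 = \<epsilon>\<^sup>2 * of_real j"
    unfolding B_def ee by (simp add: power_divide)
  then have "of_real (i\<^sup>2 / 4) = (of_real j :: complex)"
    using e_nz unfolding g by (simp add: power_mult_distrib power_divide field_simps)
  then have jj: "j = i\<^sup>2 / 4" by (simp only: of_real_eq_iff)
  have "W * (?rho * ?L) = (E * P2\<^sup>2) * smult 2 (E * P1 * P0)"
    unfolding e3[symmetric] W_def by (simp add: power2_eq_square algebra_simps)
  also have "\<dots> = smult \<kappa> (?rho\<^sup>2) * (?rho * ?L')" unfolding e1 e4 ..
  finally have "(?rho\<^sup>2 * ?rho) * smult (of_real (\<tau> * cmod \<kappa>)) ?L = (?rho\<^sup>2 * ?rho) * smult \<kappa> ?L'"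
    unfolding W by (simp add: mult.assoc)
  then have "smult (of_real (\<tau> * cmod \<kappa>)) ?L = smult \<kappa> ?L'"
    using rho0 by (metis mult_cancel_left mult_eq_0_iff power2_eq_square)
  from arg_cong[OF this[unfolded lin_poly_eq], of "\<lambda>p. coeff p 0"]
  have t1: "of_real (\<tau> * cmod \<kappa>) * \<epsilon> = \<kappa> * cnj \<epsilon>" using rnz by (simp add: mult.assoc)
  have abs_e: "(cmod \<epsilon>)\<^sup>2 = 16 * cmod \<kappa>"
    using arg_cong[OF ee, of cmod] by (simp add: norm_power norm_mult)
  have "16 * (\<kappa> * cnj \<epsilon>) = \<epsilon> * (\<epsilon> * cnj \<epsilon>)"
    unfolding mult.assoc[symmetric] power2_eq_square[of \<epsilon>, symmetric] ee ..
  also have "\<dots> = 16 * (of_real (cmod \<kappa>) * \<epsilon>)"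
    unfolding complex_norm_square[symmetric] abs_e by simp
  finally have "\<kappa> * cnj \<epsilon> = of_real (cmod \<kappa>) * \<epsilon>" using mult_cancel_left zero_neq_numeral by metis
  then have "of_real (\<tau> * cmod \<kappa>) = (of_real (cmod \<kappa>) :: complex)"
    using e_nz t1 by (metis mult_cancel_right)
  then have "\<tau> = 1" using \<kappa> by (simp only: of_real_eq_iff) simp
  then have "\<beta> = (cmod \<epsilon>)\<^sup>2 / 8" using b abs_e unfolding \<beta>'_def by simp
  then show ?thesis using ee g jj by (simp add: square_coeffs_def)
qed

text \<open>
  The polynomial \<open>A U + \<omega> B\<close> defines a Villarceau circle. When its square divides the quartic,
  the cofactor \<open>E\<^sub>2 U\<^sup>2 + E\<^sub>1 U + E\<^sub>0\<close> is determined: \<open>e4\<close> and \<open>e0\<close> give \<open>E\<^sub>2\<close> and \<open>E\<^sub>0\<close>, and \<open>e3\<close> and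
  \<open>e1\<close> show that \<open>E\<^sub>1\<close> is a constant multiple of \<open>A B\<close>. The constant follows from the fact that
  the extreme coefficients of \<open>lin_poly\<close> are opposite, which reflects that \<open>z\<close> is a multiple of
  \<open>V - 1 / V\<close>. The cofactor is then \<open>\<kappa> s\<^sup>2 (B U - \<omega> A)\<^sup>2\<close>, and \<open>B U - \<omega> A\<close>
  defines the second Villarceau circle in the same plane; \<open>e2\<close> fixes the coefficients that are
  left.
\<close>

lemma square_if_villarceau:
  fixes E0 E1 E2 :: "complex poly" and v :: real
  defines "A \<equiv> [:- of_real v, 1:]" and "B \<equiv> [:- 1, of_real v:]"
  assumes r: "0 < r" and R: "r < R"
    and v: "r * v\<^sup>2 + 2 * R * v + r = 0" and \<omega>: "cmod \<omega> = 1"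
    and e4: "A\<^sup>2 * E2 = smult \<kappa> ((rho_poly R r)\<^sup>2)"
    and e3: "A\<^sup>2 * E1 + smult (2 * \<omega>) (A * B * E2) = rho_poly R r * lin_poly r \<epsilon> \<gamma>"
    and e2: "A\<^sup>2 * E0 + smult (2 * \<omega>) (A * B * E1) + smult (\<omega>\<^sup>2) (B\<^sup>2 * E2) = mid_poly R r \<beta> i j"
    and e1: "smult (\<omega>\<^sup>2) (B\<^sup>2 * E1) + smult (2 * \<omega>) (A * B * E0) =
      rho_poly R r * lin_poly r (cnj \<epsilon>) (cnj \<gamma>)"
    and e0: "smult (\<omega>\<^sup>2) (B\<^sup>2 * E0) = smult (cnj \<kappa>) ((rho_poly R r)\<^sup>2)"
  shows "square_coeffs \<kappa> \<epsilon> \<gamma> \<beta> i j"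
proof -
  have v0: "v \<noteq> 0" using v r by auto
  have v1: "v\<^sup>2 \<noteq> 1"
  proof
    assume "v\<^sup>2 = 1"
    then have "v = 1 \<or> v = -1" by (simp add: power2_eq_1_iff)
    then show False using v r R by auto
  qed
  have vp: "1 + v\<^sup>2 \<noteq> 0" by (metis add_pos_nonneg less_irrefl zero_le_power2 zero_less_one)
  define s where "s = r / (2 * v)"
  define S :: complex where "S = of_real s"
  have s0: "S \<noteq> 0" using r v0 by (simp add: S_def s_def)
  have A0: "A \<noteq> 0" and B0: "B \<noteq> 0" by (simp_all add: A_def B_def)
  have "s * v = r / 2" using v0 by (simp add: s_def)
  moreover have "s * (v\<^sup>2 + 1) = - R"
  proof -
    have "r * (v\<^sup>2 + 1) = - 2 * R * v" using v by (simp add: algebra_simps)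
    then show ?thesis using v0 by (simp add: s_def field_simps)
  qed
  ultimately have sv: "S * of_real v = of_real (r / 2)" "S * (of_real v * of_real v + 1) = - of_real R"
    unfolding S_def by (metis of_real_mult, metis of_real_1 of_real_add of_real_minus of_real_mult power2_eq_square)
  have rho: "rho_poly R r = smult S (A * B)"
  proof -
    have "A * B = [:of_real v, - (of_real v * of_real v + 1), of_real v:]"
      by (simp add: A_def B_def)
    moreover have "S * (- (of_real v * of_real v + 1)) = of_real R"
      by (simp only: mult_minus_right sv(2) minus_minus)
    ultimately show ?thesis unfolding rho_poly_def by (simp only: smult_pCons sv smult_0_right)
  qed
  define \<omega>' where "\<omega>' = cnj \<omega>"
  have ww: "\<omega> * \<omega>' = 1" unfolding \<omega>'_def using complex_norm_square[of \<omega>] \<omega> by simp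
  have "A\<^sup>2 * E2 = A\<^sup>2 * smult (\<kappa> * S\<^sup>2) (B\<^sup>2)"
    unfolding e4 rho by (simp add: power_mult_distrib smult_power)
  then have E2: "E2 = smult (\<kappa> * S\<^sup>2) (B\<^sup>2)" using A0 by (simp only: mult_cancel_left) simp
  have "B\<^sup>2 * E0 = smult ((\<omega> * \<omega>')\<^sup>2) (B\<^sup>2 * E0)" by (simp add: ww)
  also have "\<dots> = smult (\<omega>'\<^sup>2) (smult (\<omega>\<^sup>2) (B\<^sup>2 * E0))" by (simp add: power_mult_distrib mult.commute)
  also have "\<dots> = B\<^sup>2 * smult (\<omega>'\<^sup>2 * cnj \<kappa> * S\<^sup>2) (A\<^sup>2)"
    unfolding e0 rho by (simp add: power_mult_distrib smult_power ac_simps)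
  finally have E0: "E0 = smult (\<omega>'\<^sup>2 * cnj \<kappa> * S\<^sup>2) (A\<^sup>2)" using B0 by (simp only: mult_cancel_left) simp
  have "A * (A * E1 + smult (2 * \<omega> * \<kappa> * S\<^sup>2) (B ^ 3)) = A * smult S (B * lin_poly r \<epsilon> \<gamma>)"
    using e3 unfolding E2 rho by (simp add: power2_eq_square power3_eq_cube algebra_simps)
  then have e3': "A * E1 + smult (2 * \<omega> * \<kappa> * S\<^sup>2) (B ^ 3) = smult S (B * lin_poly r \<epsilon> \<gamma>)"
    using A0 mult_cancel_left by blast
  have "\<omega> * \<omega>'\<^sup>2 = \<omega>'" using ww by (simp add: power2_eq_square mult.assoc[symmetric])
  then have w3: "2 * \<omega> * (\<omega>'\<^sup>2 * cnj \<kappa> * S\<^sup>2) = 2 * \<omega>' * cnj \<kappa> * S\<^sup>2" by (simp add: mult.assoc[symmetric])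
  have "B * (smult (\<omega>\<^sup>2) (B * E1) + smult (2 * \<omega>' * cnj \<kappa> * S\<^sup>2) (A ^ 3)) =
      B * smult S (A * lin_poly r (cnj \<epsilon>) (cnj \<gamma>))"
    using e1 unfolding E0 rho w3[symmetric] by (simp add: power2_eq_square power3_eq_cube algebra_simps)
  then have e1': "smult (\<omega>\<^sup>2) (B * E1) + smult (2 * \<omega>' * cnj \<kappa> * S\<^sup>2) (A ^ 3) =
      smult S (A * lin_poly r (cnj \<epsilon>) (cnj \<gamma>))"
    using B0 mult_cancel_left by blast
  have "poly E1 (of_real v) = 0"
  proof -
    have "\<omega>\<^sup>2 * ((of_real v * of_real v - 1) * poly E1 (of_real v)) = 0"
      using arg_cong[OF e1', of "\<lambda>p. poly p (of_real v)"] by (auto simp: A_def B_def)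
    moreover have "of_real v * of_real v - 1 \<noteq> (0::complex)"
      using v1 by (metis eq_iff_diff_eq_0 of_real_1 of_real_eq_iff of_real_mult power2_eq_square)
    moreover have "\<omega> \<noteq> 0" using ww by auto
    ultimately show ?thesis by simp
  qed
  then obtain F where F: "E1 = A * F" unfolding A_def using poly_eq_0_iff_dvd by blast
  have "poly F (inverse (of_real v)) = 0"
  proof -
    have pB: "poly B (inverse (of_real v)) = 0"
      and pA: "poly A (inverse (of_real v)) = inverse (of_real v) - of_real v"
      using v0 by (simp_all add: A_def B_def)
    have "(inverse (of_real v) - of_real v) * ((inverse (of_real v) - of_real v) * poly F (inverse (of_real v))) = 0"
      using arg_cong[OF e3', of "\<lambda>p. poly p (inverse (of_real v))"]
      by (simp add: F pA pB)
    moreover have "inverse (of_real v) - of_real v \<noteq> (0::complex)"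
    proof
      assume "inverse (of_real v) - of_real v = (0::complex)"
      then have "of_real (v\<^sup>2) = (of_real 1 :: complex)"
        using v0 by (simp add: field_simps power2_eq_square)
      then show False using v1 by (simp only: of_real_eq_iff)
    qed
    ultimately show ?thesis by simp
  qed
  then obtain G where G: "F = [:- inverse (of_real v), 1:] * G" using poly_eq_0_iff_dvd by blast
  have "[:- inverse (of_real v), 1:] = smult (inverse (of_real v)) B" using v0 by (simp add: B_def)
  then have FB: "F = B * smult (inverse (of_real v)) G" unfolding G by simp
  define H where "H = smult (inverse (of_real v)) G"
  have E1: "E1 = A * (B * H)" using F FB H_def by simp
  have "B * (A\<^sup>2 * H + smult (2 * \<omega> * \<kappa> * S\<^sup>2) (B\<^sup>2)) = B * smult S (lin_poly r \<epsilon> \<gamma>)"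
    using e3' unfolding E1 by (simp add: power2_eq_square power3_eq_cube algebra_simps)
  then have i0: "A\<^sup>2 * H + smult (2 * \<omega> * \<kappa> * S\<^sup>2) (B\<^sup>2) = smult S (lin_poly r \<epsilon> \<gamma>)"
    using B0 mult_cancel_left by blast
  have "A * (smult (\<omega>\<^sup>2) (B\<^sup>2 * H) + smult (2 * \<omega>' * cnj \<kappa> * S\<^sup>2) (A\<^sup>2)) =
      A * smult S (lin_poly r (cnj \<epsilon>) (cnj \<gamma>))"
    using e1' unfolding E1 by (simp add: power2_eq_square power3_eq_cube algebra_simps)
  then have ii0: "smult (\<omega>\<^sup>2) (B\<^sup>2 * H) + smult (2 * \<omega>' * cnj \<kappa> * S\<^sup>2) (A\<^sup>2) =
      smult S (lin_poly r (cnj \<epsilon>) (cnj \<gamma>))"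
    using A0 mult_cancel_left by blast
  have "degree H = 0"
  proof (cases "H = 0")
    case False
    have "A\<^sup>2 * H = smult S (lin_poly r \<epsilon> \<gamma>) - smult (2 * \<omega> * \<kappa> * S\<^sup>2) (B\<^sup>2)"
      using i0 by (simp only: eq_diff_eq)
    also have "degree \<dots> \<le> 2"
      by (intro degree_diff_le order.trans[OF degree_smult_le])
        (auto simp: lin_poly_eq B_def power2_eq_square degree_pCons_eq_if)
    finally have "degree (A\<^sup>2 * H) \<le> 2" .
    moreover have "degree (A\<^sup>2 * H) = 2 + degree H"
      using False A0 by (simp add: degree_mult_eq degree_power_eq A_def)
    ultimately show ?thesis by simp
  qed simp
  then obtain \<eta> where H: "H = [:\<eta>:]" by (auto elim: degree_eq_zeroE)
  define w where "w = (of_real v :: complex)"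
  have A2: "A\<^sup>2 = [:w\<^sup>2, - 2 * w, 1:]" and B2: "B\<^sup>2 = [:1, - 2 * w, w\<^sup>2:]"
    by (simp_all add: A_def B_def w_def power2_eq_square)
  have w1: "1 + w\<^sup>2 \<noteq> 0" using vp unfolding w_def by (metis of_real_0 of_real_1 of_real_add of_real_eq_iff of_real_power)
  have "[:\<eta> * w\<^sup>2 + 2 * \<omega> * \<kappa> * S\<^sup>2, - 2 * w * (\<eta> + 2 * \<omega> * \<kappa> * S\<^sup>2), \<eta> + 2 * \<omega> * \<kappa> * S\<^sup>2 * w\<^sup>2:] =
      [:S * (\<epsilon> * \<i> * of_real r / 4), S * (\<gamma> / 2), - S * (\<epsilon> * \<i> * of_real r / 4):]"
    using i0 unfolding A2 B2 H lin_poly_eq by (simp add: algebra_simps)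
  then have i1: "\<eta> * w\<^sup>2 + 2 * \<omega> * \<kappa> * S\<^sup>2 = S * (\<epsilon> * \<i> * of_real r / 4)"
    and i2: "- 2 * w * (\<eta> + 2 * \<omega> * \<kappa> * S\<^sup>2) = S * (\<gamma> / 2)"
    and i3: "\<eta> + 2 * \<omega> * \<kappa> * S\<^sup>2 * w\<^sup>2 = - S * (\<epsilon> * \<i> * of_real r / 4)"
    unfolding pCons_eq_iff by blast+
  have "(\<eta> + 2 * \<omega> * \<kappa> * S\<^sup>2) * (1 + w\<^sup>2) = 0"
    using arg_cong2[OF i1 i3, of "(+)"] by (simp add: algebra_simps)
  then have eta: "\<eta> = - (2 * \<omega> * \<kappa> * S\<^sup>2)" using w1 by (simp add: eq_neg_iff_add_eq_0)
  then have g0: "\<gamma> = 0" using i2 s0 by simp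
  have "[:\<omega>\<^sup>2 * \<eta> + 2 * \<omega>' * cnj \<kappa> * S\<^sup>2 * w\<^sup>2, - 2 * w * (\<omega>\<^sup>2 * \<eta> + 2 * \<omega>' * cnj \<kappa> * S\<^sup>2),
       \<omega>\<^sup>2 * \<eta> * w\<^sup>2 + 2 * \<omega>' * cnj \<kappa> * S\<^sup>2:] =
      [:S * (cnj \<epsilon> * \<i> * of_real r / 4), S * (cnj \<gamma> / 2), - S * (cnj \<epsilon> * \<i> * of_real r / 4):]"
    using ii0 unfolding A2 B2 H lin_poly_eq by (simp add: algebra_simps)
  then have "- 2 * w * (\<omega>\<^sup>2 * \<eta> + 2 * \<omega>' * cnj \<kappa> * S\<^sup>2) = S * (cnj \<gamma> / 2)"
    unfolding pCons_eq_iff by blast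
  then have "\<omega>\<^sup>2 * \<eta> + 2 * \<omega>' * cnj \<kappa> * S\<^sup>2 = 0" using g0 v0 by (simp add: w_def)
  then have "2 * S\<^sup>2 * (\<omega>\<^sup>2 * \<omega> * \<kappa>) = 2 * S\<^sup>2 * (\<omega>' * cnj \<kappa>)" unfolding eta by (auto simp: algebra_simps)
  then have wk: "\<omega>\<^sup>2 * \<omega> * \<kappa> = \<omega>' * cnj \<kappa>" using s0 by simp
  have "\<omega>\<^sup>2 * \<kappa> = (\<omega> * \<omega>') * (\<omega>\<^sup>2 * \<kappa>)" by (simp add: ww)
  also have "\<dots> = \<omega>' * (\<omega>\<^sup>2 * \<omega> * \<kappa>)" by (simp only: ac_simps)
  finally have k1: "\<omega>\<^sup>2 * \<kappa> = \<omega>'\<^sup>2 * cnj \<kappa>"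
    unfolding wk by (simp add: power2_eq_square mult.assoc)
  have "cnj (\<omega>\<^sup>2 * \<kappa>) = \<omega>\<^sup>2 * \<kappa>" using k1 by (simp add: \<omega>'_def)
  then have "\<omega>\<^sup>2 * \<kappa> \<in> \<real>" by (simp only: Reals_cnj_iff)
  then obtain k where k: "\<omega>\<^sup>2 * \<kappa> = of_real k" by (rule Reals_cases)
  define c where "c = k * s\<^sup>2 * (1 - v\<^sup>2)\<^sup>2"
  have AB: "smult (S\<^sup>2) (A\<^sup>2 * B\<^sup>2) = (rho_poly R r)\<^sup>2"
    unfolding rho by (simp add: power_mult_distrib smult_power)
  have "mid_poly R r \<beta> i j = smult (\<omega>'\<^sup>2 * cnj \<kappa> * S\<^sup>2) (A\<^sup>2 * A\<^sup>2) +
      smult (- 4 * (\<omega>\<^sup>2 * \<kappa>)) (smult (S\<^sup>2) (A\<^sup>2 * B\<^sup>2)) + smult (\<omega>\<^sup>2 * \<kappa> * S\<^sup>2) (B\<^sup>2 * B\<^sup>2)"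
    unfolding e2[symmetric] E0 E1 E2 H eta by (simp add: power2_eq_square algebra_simps)
  also have "\<dots> = smult (of_real k * S\<^sup>2) ((A\<^sup>2 - B\<^sup>2)\<^sup>2) - smult (2 * of_real k) (smult (S\<^sup>2) (A\<^sup>2 * B\<^sup>2))"
  proof -
    define X Y m where "X = A\<^sup>2" and "Y = B\<^sup>2" and "m = of_real k * S\<^sup>2"
    have sq: "(X - Y)\<^sup>2 = X * X - (X * Y + X * Y) + Y * Y"
      by (simp add: power2_eq_square algebra_simps)
    have "smult m (X * X) + smult (- 4 * m) (X * Y) + smult m (Y * Y) =
        smult m ((X - Y)\<^sup>2) - smult (2 * m) (X * Y)"
      unfolding sq by (intro poly_eqI) (simp only: coeff_add coeff_diff coeff_smult, simp add: algebra_simps)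
    then show ?thesis
      unfolding k1[symmetric] k X_def Y_def m_def by (simp add: mult.assoc)
  qed
  also have "A\<^sup>2 - B\<^sup>2 = smult (of_real (1 - v\<^sup>2)) [:- 1, 0, 1:]"
    unfolding A2 B2 by (simp add: w_def)
  also have "smult (of_real k * S\<^sup>2) ((smult (of_real (1 - v\<^sup>2)) [:- 1, 0, 1:])\<^sup>2) = smult (of_real c) [:1, 0, -2, 0, 1:]"
  proof -
    have "[:- 1, 0, 1:]\<^sup>2 = ([:1, 0, -2, 0, 1:] :: complex poly)" by (simp add: power2_eq_square)
    moreover have "of_real k * S\<^sup>2 * (of_real (1 - v\<^sup>2))\<^sup>2 = of_real c"
      unfolding c_def S_def by (simp only: of_real_mult of_real_power)
    ultimately show ?thesis by (simp only: smult_power smult_smult)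
  qed
  finally have "mid_poly R r \<beta> i j + smult (2 * of_real k) ((rho_poly R r)\<^sup>2) = smult (of_real c) [:1, 0, -2, 0, 1:]"
    unfolding AB by simp
  moreover have "mid_poly R r \<beta> i j + smult (2 * of_real k) ((rho_poly R r)\<^sup>2) = mid_poly R r (\<beta> + 2 * k) i j"
    by (simp add: mid_poly_def smult_add_left)
  ultimately have m: "mid_poly R r (\<beta> + 2 * k) i j = smult (of_real c) [:1, 0, -2, 0, 1:]" by simp
  note m' = m[unfolded mid_poly_eq smult_pCons pCons_eq_iff]
  have m0: "of_real ((\<beta> + 2 * k - 1) * r\<^sup>2 / 4) = of_real c * (1::complex)"
    and m1: "\<i> * of_real (i * r / 2) + of_real ((\<beta> + 2 * k) * R * r) = of_real c * 0"
    and m2: "of_real (r\<^sup>2 / 2 + j + (\<beta> + 2 * k) * (R\<^sup>2 + r\<^sup>2 / 2)) = of_real c * (-2::complex)"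
    using m' by blast+
  from m1 have ib: "i = 0" "\<beta> + 2 * k = 0" using r R by (simp_all add: complex_eq_iff)
  have c: "c = - r\<^sup>2 / 4" using m0 unfolding ib mult_1_right of_real_eq_iff by simp
  have "of_real (r\<^sup>2 / 2 + j) = (of_real (c * - 2) :: complex)" using m2 unfolding ib by simp
  then have j: "j = 0" unfolding of_real_eq_iff c by simp
  have eps: "S * (\<epsilon> * \<i> * of_real r / 4) = 2 * \<omega> * \<kappa> * S\<^sup>2 * (1 - w\<^sup>2)"
    unfolding i1[symmetric] eta by (simp add: algebra_simps)
  have "- (S\<^sup>2 * (of_real r)\<^sup>2 * \<epsilon>\<^sup>2) = 16 * (S * (\<epsilon> * \<i> * of_real r / 4))\<^sup>2"
    by (simp add: power_mult_distrib power_divide)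
  also have "\<dots> = 64 * \<kappa> * S\<^sup>2 * (\<omega>\<^sup>2 * \<kappa> * S\<^sup>2 * (1 - w\<^sup>2)\<^sup>2)"
    unfolding eps by (simp add: power_mult_distrib power2_eq_square)
  also have "\<omega>\<^sup>2 * \<kappa> * S\<^sup>2 * (1 - w\<^sup>2)\<^sup>2 = of_real c"
    unfolding k c_def S_def w_def by simp
  also have "64 * \<kappa> * S\<^sup>2 * of_real c = - (S\<^sup>2 * (of_real r)\<^sup>2 * (16 * \<kappa>))" unfolding c by simp
  finally have ee: "\<epsilon>\<^sup>2 = 16 * \<kappa>" using s0 r by simp
  have abs_e: "(cmod \<epsilon>)\<^sup>2 = 16 * cmod \<kappa>"
    using arg_cong[OF ee, of cmod] by (simp add: norm_power norm_mult)
  have "cmod \<kappa> = \<bar>k\<bar>" using arg_cong[OF k, of cmod] \<omega> by (simp add: norm_mult norm_power)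
  moreover have "k \<le> 0"
  proof (rule ccontr)
    assume "\<not> ?thesis"
    then have "c \<ge> 0" unfolding c_def by simp
    then show False using c r by simp
  qed
  ultimately have "\<beta> = (cmod \<epsilon>)\<^sup>2 / 8" using abs_e ib by simp
  then show ?thesis using ee g0 ib j by (simp add: square_coeffs_def)
qed

section \<open>Divisors of the restricted quadric\<close>

lemma poly_rho_poly:
  assumes "cmod V = 1"
  shows "poly (rho_poly R r) V = V * of_real (R + r * Re V)"
proof -
  have "V * of_real (Re V) = (V * V + V * cnj V) / 2"
    by (simp add: complex_eq_iff field_simps)
  then have Re: "V * of_real (Re V) = (V * V + 1) / 2"
    unfolding unit_mult_cnj[OF assms] .
  have "V * of_real (R + r * Re V) = of_real R * V + of_real r * (V * of_real (Re V))"
    by (simp add: algebra_simps)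
  also have "\<dots> = poly (rho_poly R r) V"
    unfolding Re by (simp add: rho_poly_def algebra_simps add_divide_distrib)
  finally show ?thesis ..
qed

lemma poly_height_poly:
  assumes "cmod V = 1"
  shows "poly (height_poly r) V = V * of_real (r * Im V)"
proof -
  have "V * of_real (Im V) = \<i> * (V * cnj V - V * V) / 2"
    by (simp add: complex_eq_iff field_simps)
  then have Im: "V * of_real (Im V) = \<i> * (1 - V * V) / 2"
    unfolding unit_mult_cnj[OF assms] .
  have "V * of_real (r * Im V) = of_real r * (V * of_real (Im V))" by simp
  also have "\<dots> = poly (height_poly r) V"
    unfolding Im by (simp add: height_poly_def algebra_simps diff_divide_distrib)
  finally show ?thesis ..
qed

lemma poly_lin_poly:
  assumes "cmod V = 1"
  shows "poly (lin_poly r \<epsilon> \<gamma>) V = V * ((\<epsilon> * of_real (r * Im V) + \<gamma>) / 2)"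
proof -
  define z where "z = r * Im V"
  have "poly (height_poly r) V = V * of_real z" unfolding z_def by (rule poly_height_poly[OF assms])
  then have "poly (lin_poly r \<epsilon> \<gamma>) V = V * ((\<epsilon> * of_real z + \<gamma>) / 2)"
    by (simp add: lin_poly_def algebra_simps add_divide_distrib)
  then show ?thesis unfolding z_def .
qed

lemma poly_mid_poly:
  assumes "cmod V = 1"
  shows "poly (mid_poly R r \<beta> i j) V = V\<^sup>2 *
    of_real ((r * Im V)\<^sup>2 + i * (r * Im V) + j + \<beta> * (R + r * Re V)\<^sup>2)"
proof -
  define z \<rho> where "z = r * Im V" and "\<rho> = R + r * Re V"
  have "poly (height_poly r) V = V * of_real z" "poly (rho_poly R r) V = V * of_real \<rho>"
    unfolding z_def \<rho>_def by (fact poly_height_poly[OF assms], fact poly_rho_poly[OF assms])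
  then have "poly (mid_poly R r \<beta> i j) V = V\<^sup>2 * of_real (z\<^sup>2 + i * z + j + \<beta> * \<rho>\<^sup>2)"
    by (simp add: mid_poly_def algebra_simps power2_eq_square)
  then show ?thesis unfolding z_def \<rho>_def .
qed

lemma torus_quartic_double_zero:
  assumes V: "cmod V = 1" and U: "cmod U = 1"
    and q: "torus_form R r \<kappa> \<epsilon> \<gamma> \<beta> i j (V, U) = 0" and k: "torus_form_deriv R r \<kappa> \<epsilon> \<gamma> (V, U) = 0"
  shows "poly (poly (torus_quartic R r \<kappa> \<epsilon> \<gamma> \<beta> i j) [:U:]) V = 0"
    and "poly (poly (pderiv (torus_quartic R r \<kappa> \<epsilon> \<gamma> \<beta> i j)) [:U:]) V = 0"
proof -
  define \<rho> z where "\<rho> = R + r * Re V" and "z = r * Im V"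
  define w w' where "w = of_real \<rho> * U" and "w' = cnj w"
  define l l' where "l = (\<epsilon> * of_real z + \<gamma>) / 2" and "l' = (cnj \<epsilon> * of_real z + cnj \<gamma>) / 2"
  define m where "m = z\<^sup>2 + i * z + j + \<beta> * \<rho>\<^sup>2"
  have Uc: "U * cnj U = 1" using U by (rule unit_mult_cnj)
  have \<rho>: "of_real \<rho> = U * w'"
    using Uc by (simp add: w'_def w_def algebra_simps)
  have l': "l' = cnj l" by (simp add: l_def l'_def)
  have q0: "\<kappa> * w\<^sup>2 + cnj \<kappa> * w'\<^sup>2 + (l * w + l' * w') + of_real m = 0"
  proof -
    have "\<kappa> * w\<^sup>2 + cnj (\<kappa> * w\<^sup>2) + (l * w + cnj (l * w)) + of_real m =
        of_real (2 * Re (\<kappa> * w\<^sup>2) + 2 * Re (l * w) + m)"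
      by (simp only: complex_add_cnj) simp
    also have "2 * Re (\<kappa> * w\<^sup>2) + 2 * Re (l * w) + m = 0"
      using q by (simp add: torus_form_def Let_def \<rho>_def z_def w_def l_def m_def)
    finally show ?thesis unfolding w'_def l' by simp
  qed
  have k0: "2 * (\<kappa> * w\<^sup>2 - cnj \<kappa> * w'\<^sup>2) + (l * w - l' * w') = 0"
  proof -
    have "2 * (\<kappa> * w\<^sup>2 - cnj (\<kappa> * w\<^sup>2)) + (l * w - cnj (l * w)) =
        \<i> * of_real (4 * Im (\<kappa> * w\<^sup>2) + 2 * Im (l * w))"
      by (simp only: complex_diff_cnj) (simp add: algebra_simps)
    also have "4 * Im (\<kappa> * w\<^sup>2) + 2 * Im (l * w) = 0"
      using k by (simp add: torus_form_deriv_def Let_def \<rho>_def z_def w_def l_def)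
    finally show ?thesis unfolding w'_def l' by simp
  qed
  have w: "w = U * U * w'" unfolding w_def \<rho> by simp
  have rho: "poly (rho_poly R r) V = V * (U * w')"
    using poly_rho_poly[OF V, of R r] \<rho> unfolding \<rho>_def by simp
  have lin: "poly (lin_poly r \<epsilon> \<gamma>) V = V * l" "poly (lin_poly r (cnj \<epsilon>) (cnj \<gamma>)) V = V * l'"
    unfolding poly_lin_poly[OF V] l_def l'_def z_def by simp_all
  have mid: "poly (mid_poly R r \<beta> i j) V = V\<^sup>2 * of_real m"
    unfolding poly_mid_poly[OF V] m_def z_def \<rho>_def by simp
  have "poly (poly (torus_quartic R r \<kappa> \<epsilon> \<gamma> \<beta> i j) [:U:]) V =
      V\<^sup>2 * U\<^sup>2 * (\<kappa> * w\<^sup>2 + cnj \<kappa> * w'\<^sup>2 + (l * w + l' * w') + of_real m)"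
    unfolding torus_quartic_def w by (simp add: rho lin mid power2_eq_square algebra_simps)
  then show z: "poly (poly (torus_quartic R r \<kappa> \<epsilon> \<gamma> \<beta> i j) [:U:]) V = 0" by (simp add: q0)
  have "U * poly (poly (pderiv (torus_quartic R r \<kappa> \<epsilon> \<gamma> \<beta> i j)) [:U:]) V =
      V\<^sup>2 * U\<^sup>2 * (2 * (\<kappa> * w\<^sup>2 + cnj \<kappa> * w'\<^sup>2 + (l * w + l' * w') + of_real m) +
        (2 * (\<kappa> * w\<^sup>2 - cnj \<kappa> * w'\<^sup>2) + (l * w - l' * w')))"
    unfolding torus_quartic_def w
    by (simp add: rho lin mid power2_eq_square algebra_simps pderiv_pCons)
  then have "U * poly (poly (pderiv (torus_quartic R r \<kappa> \<epsilon> \<gamma> \<beta> i j)) [:U:]) V = 0"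
    by (simp only: q0 k0 mult_zero_right add_0_left)
  then show "poly (poly (pderiv (torus_quartic R r \<kappa> \<epsilon> \<gamma> \<beta> i j)) [:U:]) V = 0" using U by auto
qed

text \<open>
  Let \<open>P\<close> be a prime factor with infinitely many of the given zeros. If \<open>F = P G\<close> with \<open>G\<close> not
  divisible by \<open>P\<close>, then at these zeros either \<open>G\<close> or the derivative of \<open>P\<close> vanishes, and
  neither is possible infinitely often.
\<close>

lemma square_factor_of_double_zeros:
  fixes F :: "complex poly poly"
  assumes F0: "F \<noteq> 0" and inf: "infinite M" and fib: "\<And>x. finite {y. (x, y) \<in> M}"
    and zero: "\<And>x y. (x, y) \<in> M \<Longrightarrow> poly (poly F [:y:]) x = 0"
    and dzero: "\<And>x y. (x, y) \<in> M \<Longrightarrow> poly (poly (pderiv F) [:y:]) x = 0"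
  shows "\<exists>P E. F = P\<^sup>2 * E \<and> prime_elem P \<and> degree P > 0 \<and>
    infinite {(x, y) \<in> M. poly (poly P [:y:]) x = 0}"
proof -
  define Z where "Z G = {(x, y) \<in> M. poly (poly G [:y:]) x = 0}" for G
  have "\<exists>P. prime_elem P \<and> P dvd F \<and> infinite (Z P)"
  proof (rule prime_divisor_inherits[OF F0])
    have "Z F = M" using zero by (auto simp: Z_def)
    then show "infinite (Z F)" using inf by simp
  next
    fix G :: "complex poly poly" assume "is_unit G"
    then obtain g where g: "G = [:g:]" "is_unit g" unfolding is_unit_poly_iff[of G] by blast
    then obtain c where c: "g = [:c:]" "is_unit c" unfolding is_unit_poly_iff[of g] by blast
    then have "G = [:[:c:]:]" "c \<noteq> 0" using g by auto
    then show "\<not> infinite (Z G)" by (auto simp: Z_def)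
  next
    fix G H assume "infinite (Z (G * H))"
    moreover have "Z (G * H) = Z G \<union> Z H" by (auto simp: Z_def)
    ultimately show "infinite (Z G) \<or> infinite (Z H)" by auto
  qed
  then obtain P G where P: "prime_elem P" and G: "F = P * G" and infP: "infinite (Z P)" by auto
  have P0: "P \<noteq> 0" using P by auto
  have deg: "degree P > 0"
  proof (rule ccontr)
    assume "\<not> ?thesis"
    then obtain c where c: "P = [:c:]" using degree_eq_zeroE by blast
    then have "c \<noteq> 0" using P0 by auto
    then have "finite (SIGMA x:{x. poly c x = 0}. {y. (x, y) \<in> M})"
      using fib by (intro finite_SigmaI poly_roots_finite) auto
    moreover have "Z P \<subseteq> (SIGMA x:{x. poly c x = 0}. {y. (x, y) \<in> M})" by (auto simp: Z_def c)
    ultimately show False using infP finite_subset by blast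
  qed
  have "P dvd G"
  proof (rule ccontr)
    assume nd: "\<not> P dvd G"
    have "\<not> P dvd pderiv P"
    proof
      assume d: "P dvd pderiv P"
      have "pderiv P \<noteq> 0" using deg by (simp add: pderiv_eq_0_iff)
      then have "degree P \<le> degree (pderiv P)" using d by (rule dvd_imp_degree_le[rotated])
      then show False using deg by (simp add: degree_pderiv)
    qed
    note f = finite_common_zeros[OF P nd] finite_common_zeros[OF P this]
    have "Z P \<subseteq> {(x, y). poly (poly P [:y:]) x = 0 \<and> poly (poly G [:y:]) x = 0} \<union>
        {(x, y). poly (poly P [:y:]) x = 0 \<and> poly (poly (pderiv P) [:y:]) x = 0}"
    proof (clarsimp simp: Z_def)
      fix x y assume M: "(x, y) \<in> M" and Pz: "poly (poly P [:y:]) x = 0"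
        and "poly (poly (pderiv P) [:y:]) x \<noteq> 0"
      then show "poly (poly G [:y:]) x = 0"
        using dzero[OF M] unfolding G pderiv_mult by simp
    qed
    then show False using f infP finite_subset by blast
  qed
  then obtain E where "G = P * E" by auto
  then have "F = P\<^sup>2 * E" using G by (simp add: power2_eq_square mult.assoc)
  then show ?thesis using P deg infP unfolding Z_def by blast
qed

lemma rho_poly_roots:
  assumes r: "0 < r" and R: "r < R"
  obtains v where "v \<noteq> 0" "v\<^sup>2 \<noteq> 1" "r * v\<^sup>2 + 2 * R * v + r = 0"
    "\<And>x :: complex. poly (rho_poly R r) x = 0 \<Longrightarrow> x = of_real v \<or> x = of_real (inverse v)"
proof -
  define v where "v = (- R + sqrt (R\<^sup>2 - r\<^sup>2)) / r"
  have "0 \<le> R\<^sup>2 - r\<^sup>2" using r R by (simp add: power_mono)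
  then have "(r * v + R)\<^sup>2 = R\<^sup>2 - r\<^sup>2" using r by (simp add: v_def)
  then have "r * (r * v\<^sup>2 + 2 * R * v + r) = 0"
    by (simp add: power2_eq_square algebra_simps)
  then have v: "r * v\<^sup>2 + 2 * R * v + r = 0" using r by simp
  have v0: "v \<noteq> 0" using v r by auto
  have v1: "v\<^sup>2 \<noteq> 1"
  proof
    assume "v\<^sup>2 = 1"
    then have "v = 1 \<or> v = -1" by (simp add: power2_eq_1_iff)
    then show False using v r R by auto
  qed
  have roots: "x = of_real v \<or> x = of_real (inverse v)" if x: "poly (rho_poly R r) x = 0" for x :: complex
  proof -
    have "v * (2 * R + r * (v + inverse v)) = r * v\<^sup>2 + 2 * R * v + r"
      using v0 by (simp add: algebra_simps power2_eq_square)
    then have "2 * R + r * (v + inverse v) = 0" using v v0 by simp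
    then have "of_real (2 * R + r * (v + inverse v)) = (0::complex)" by (simp only: of_real_0)
    then have RR: "2 * of_real R = - (of_real r * (of_real v + of_real (inverse v)) :: complex)"
      by (simp only: of_real_add of_real_mult of_real_numeral eq_neg_iff_add_eq_0)
    have vv: "of_real v * of_real (inverse v) = (1::complex)" using v0 by simp
    have "of_real r + 2 * of_real R * x + of_real r * x * x = 0"
      using x by (simp add: rho_poly_def algebra_simps) (simp add: field_simps)
    moreover have "of_real r * ((x - a) * (x - b)) = of_real r * (a * b) + - (of_real r * (a + b)) * x
      + of_real r * x * x" for a b :: complex
      by (simp add: algebra_simps)
    ultimately have "of_real r * ((x - of_real v) * (x - of_real (inverse v))) = 0"
      unfolding RR by (simp only: vv mult_1_right)
    then show ?thesis using r by simp
  qed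
  show thesis using that v0 v1 v roots by blast
qed

lemma finite_unit_Re: "finite {V. cmod V = 1 \<and> Re V = c}"
proof -
  have "{V. cmod V = 1 \<and> Re V = c} \<subseteq> {Complex c (sqrt (1 - c\<^sup>2)), Complex c (- sqrt (1 - c\<^sup>2))}"
  proof
    fix V assume "V \<in> {V. cmod V = 1 \<and> Re V = c}"
    then have "(Im V)\<^sup>2 = 1 - c\<^sup>2" and c: "Re V = c"
      using cmod_power2[of V] by auto
    then have "\<bar>Im V\<bar> = sqrt (1 - c\<^sup>2)" by (metis real_sqrt_abs)
    then have "Im V = sqrt (1 - c\<^sup>2) \<or> Im V = - sqrt (1 - c\<^sup>2)" by linarith
    then show "V \<in> {Complex c (sqrt (1 - c\<^sup>2)), Complex c (- sqrt (1 - c\<^sup>2))}"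
      using c by (auto simp: complex_eq_iff)
  qed
  then show ?thesis by (rule finite_subset) simp
qed

lemma cmod_diff_real_square:
  assumes "cmod V = 1"
  shows "(cmod (V - of_real v))\<^sup>2 = 1 + v\<^sup>2 - 2 * v * Re V"
proof -
  have "(Re V)\<^sup>2 + (Im V)\<^sup>2 = 1" using assms cmod_power2[of V] by simp
  then show ?thesis unfolding cmod_power2 by (simp add: power2_eq_square algebra_simps)
qed

lemma rho_poly_divisor_cases:
  assumes r: "0 < r" and R: "r < R" and f: "f dvd rho_poly R r"
  obtains c where "c \<noteq> 0" "f = [:c:]"
  | c where "c \<noteq> 0" "f = smult c (rho_poly R r)"
  | c x where "c \<noteq> 0" "poly (rho_poly R r) x = 0" "f = smult c [:- x, 1:]"
proof -
  obtain g where g: "rho_poly R r = f * g" using f by auto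
  have nz: "f \<noteq> 0" "g \<noteq> 0" using g rho_poly_nz[of r R] r by auto
  have "degree f + degree g = 2" using nz g degree_rho_poly[of r R] r by (simp add: degree_mult_eq)
  then consider "degree f = 0" | "degree g = 0" | "degree f = 1" by linarith
  then show thesis
  proof cases
    case 1
    then show ?thesis using nz that(1) by (metis degree_eq_zeroE pCons_0_0)
  next
    case 2
    then obtain c where c: "g = [:c:]" using degree_eq_zeroE by blast
    then have "c \<noteq> 0" using nz by auto
    then have "f = smult (inverse c) (rho_poly R r)" using g c by simp
    then show ?thesis using that(2)[of "inverse c"] \<open>c \<noteq> 0\<close> by simp
  next
    case 3
    define a b where "a = coeff f 0" and "b = coeff f 1"
    have fab: "f = [:a, b:]"
      using 3 degree_le_2_poly_eq[of f] coeff_eq_0[of f 2] by (simp add: a_def b_def)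
    have b: "b \<noteq> 0" using 3 fab by auto
    then have fx: "f = smult b [:- (- a / b), 1:]" using fab by simp
    have "poly f (- a / b) = 0" using b by (simp add: fab)
    then have "poly (rho_poly R r) (- a / b) = 0" using g by simp
    then show ?thesis using that(3)[OF b _ fx] by blast
  qed
qed

text \<open>
  On the unit circle, the squared modulus of \<open>V - u\<close> with real \<open>u \<noteq> 0\<close>, and the modulus
  \<open>R + r Re V\<close> of \<open>rho_poly\<close>, are nonconstant affine functions of \<open>Re V\<close>.
\<close>

lemma rho_poly_divisor_const_modulus:
  assumes r: "0 < r" and R: "r < R" and f: "f dvd rho_poly R r"
    and N: "infinite N" "\<And>V. V \<in> N \<Longrightarrow> cmod V = 1 \<and> cmod (poly f V) = b"
  shows "degree f = 0"
  using r R f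
proof (cases rule: rho_poly_divisor_cases)
  case (2 c)
  have "N \<subseteq> {V. cmod V = 1 \<and> Re V = (b / cmod c - R) / r}"
  proof (clarsimp simp: N(2))
    fix V assume V: "V \<in> N"
    have pos: "R + r * Re V > 0" using torus_radius_pos[OF r R] N(2)[OF V] by simp
    have "poly f V = c * (V * of_real (R + r * Re V))"
      using N(2)[OF V] by (simp only: 2 poly_smult poly_rho_poly)
    then have "cmod (poly f V) = cmod c * (cmod V * \<bar>R + r * Re V\<bar>)"
      by (simp only: norm_mult norm_of_real)
    then have "b = cmod c * (R + r * Re V)" using N(2)[OF V] pos by simp
    then have "b / cmod c = R + r * Re V" using 2 by simp
    then show "Re V = (b / cmod c - R) / r" using r by simp
  qed
  then show ?thesis using N(1) finite_unit_Re finite_subset by blast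
next
  case (3 c x)
  obtain v where v: "v \<noteq> 0" and
    roots: "\<And>x :: complex. poly (rho_poly R r) x = 0 \<Longrightarrow> x = of_real v \<or> x = of_real (inverse v)"
    using rho_poly_roots[OF r R] by blast
  obtain u where u: "x = of_real u" "u \<noteq> 0"
    using roots[OF 3(2)] v inverse_nonzero_iff_nonzero by blast
  have "N \<subseteq> {V. cmod V = 1 \<and> Re V = (1 + u\<^sup>2 - (b / cmod c)\<^sup>2) / (2 * u)}"
  proof (clarsimp simp: N(2))
    fix V assume V: "V \<in> N"
    have "poly f V = c * (V - of_real u)" by (simp add: 3 u algebra_simps)
    then have "b = cmod c * cmod (V - of_real u)" using N(2)[OF V] by (simp add: norm_mult)
    then have "(b / cmod c)\<^sup>2 = (cmod (V - of_real u))\<^sup>2" using 3(1) by simp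
    then have "(b / cmod c)\<^sup>2 = 1 + u\<^sup>2 - 2 * u * Re V"
      using cmod_diff_real_square N(2)[OF V] by simp
    then show "Re V = (1 + u\<^sup>2 - (b / cmod c)\<^sup>2) / (2 * u)" using u(2) by (simp add: field_simps)
  qed
  then show ?thesis using N(1) finite_unit_Re finite_subset by blast
qed simp

lemma const_coeff_dvd_prime_elem:
  fixes P :: "complex poly poly"
  assumes P: "prime_elem P" "degree P > 0" and d: "[:c:] dvd P"
  shows "degree c = 0"
proof -
  from d obtain k where k: "P = [:c:] * k" by auto
  have "irreducible P" using P(1) by (rule prime_elem_imp_irreducible)
  with k consider "is_unit [:c:]" | "is_unit k" using irreducibleD by blast
  then show ?thesis
  proof cases
    case 1
    then have "is_unit c" by (simp only: is_unit_const_poly_iff)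
    then show ?thesis by (auto simp: is_unit_poly_iff)
  next
    case 2
    then have "degree k = 0" by (auto simp: is_unit_poly_iff)
    then have "degree P = 0" using k by (auto elim!: degree_eq_zeroE)
    then show ?thesis using P(2) by simp
  qed
qed

lemma smult_2: "smult 2 (p :: complex poly) = p + p"
  by (metis one_add_one smult_1_left smult_add_left)

text \<open>
  For \<open>\<kappa> = 0\<close> the double zero is the vertex of a quadratic polynomial in \<open>U\<close>, whose position
  turns out not to depend on \<open>V\<close>.
\<close>

lemma constant_longitude_contact:
  assumes r: "0 < r" and R: "r < R" and N: "infinite (fst ` M)"
    and unit: "\<And>V U. (V, U) \<in> M \<Longrightarrow> cmod V = 1 \<and> cmod U = 1"
    and zero: "\<And>V U. (V, U) \<in> M \<Longrightarrow> poly (poly (torus_quartic R r 0 \<epsilon> \<gamma> \<beta> i j) [:U:]) V = 0"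
    and dzero: "\<And>V U. (V, U) \<in> M \<Longrightarrow> poly (poly (pderiv (torus_quartic R r 0 \<epsilon> \<gamma> \<beta> i j)) [:U:]) V = 0"
  shows "\<exists>U. \<forall>m\<in>M. snd m = U"
proof -
  let ?q1 = "rho_poly R r * lin_poly r (cnj \<epsilon>) (cnj \<gamma>)" and ?q2 = "mid_poly R r \<beta> i j"
    and ?q3 = "rho_poly R r * lin_poly r \<epsilon> \<gamma>"
  have vertex: "poly ?q2 V = - 2 * poly ?q3 V * U \<and> poly ?q1 V = poly ?q3 V * U\<^sup>2" if m: "(V, U) \<in> M" for V U
  proof -
    define a b c where "a = poly ?q1 V" and "b = poly ?q2 V" and "c = poly ?q3 V"
    have U: "U \<noteq> 0" using unit[OF m] by auto
    have "U * (a + U * (b + U * c)) = 0"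
      using zero[OF m] by (simp add: torus_quartic_def a_def b_def c_def algebra_simps)
    then have 1: "a + U * (b + U * c) = 0" using U by simp
    have "a + U * (2 * b + U * (3 * c)) = 0"
      using dzero[OF m] by (simp add: torus_quartic_def a_def b_def c_def pderiv_pCons algebra_simps)
    moreover have "U * (b + 2 * c * U) = (a + U * (2 * b + U * (3 * c))) - (a + U * (b + U * c))"
      by (simp add: algebra_simps)
    ultimately have "U * (b + 2 * c * U) = 0" using 1 by simp
    then have 2: "b = - 2 * c * U" using U by (simp add: eq_neg_iff_add_eq_0)
    then have "a = c * U\<^sup>2" using 1 by (simp add: power2_eq_square algebra_simps)
    with 2 show ?thesis by (simp add: a_def b_def c_def)
  qed
  have "?q2\<^sup>2 - smult 4 (?q1 * ?q3) = 0"
  proof (rule ccontr)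
    assume "?q2\<^sup>2 - smult 4 (?q1 * ?q3) \<noteq> 0"
    then have "finite {V. poly (?q2\<^sup>2 - smult 4 (?q1 * ?q3)) V = 0}" by (rule poly_roots_finite)
    moreover have "fst ` M \<subseteq> {V. poly (?q2\<^sup>2 - smult 4 (?q1 * ?q3)) V = 0}"
    proof clarify
      fix V U assume "(V, U) \<in> M"
      note v = vertex[OF this]
      define b where "b = poly ?q3 V"
      have "poly (?q2\<^sup>2 - smult 4 (?q1 * ?q3)) V = (- 2 * b * U)\<^sup>2 - 4 * (b * U\<^sup>2 * b)"
        by (simp only: poly_diff poly_power poly_smult poly_mult[of ?q1 ?q3] v b_def)
      also have "\<dots> = 0" by (simp add: power2_eq_square)
      finally show "poly (?q2\<^sup>2 - smult 4 (?q1 * ?q3)) (fst (V, U)) = 0" by simp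
    qed
    ultimately show False using N finite_subset by blast
  qed
  then have "?q2\<^sup>2 = smult 4 ((rho_poly R r)\<^sup>2 * (lin_poly r \<epsilon> \<gamma> * lin_poly r (cnj \<epsilon>) (cnj \<gamma>)))"
    by (simp add: power2_eq_square ac_simps)
  from constant_longitude_coeffs[OF r R this]
  have \<epsilon>: "\<epsilon> = 0" and \<gamma>: "\<gamma> \<noteq> 0" and q2: "?q2 = rho_poly R r * [:0, of_real (2 * R):]" by auto
  have "U = - 2 * of_real R / \<gamma>" if m: "(V, U) \<in> M" for V U
  proof -
    have V: "cmod V = 1" using unit[OF m] by simp
    have "R + r * Re V \<noteq> 0" using torus_radius_pos[OF r R V] by simp
    then have "of_real (R + r * Re V) \<noteq> (0::complex)" using of_real_eq_0_iff by blast
    then have rho: "poly (rho_poly R r) V \<noteq> 0" using V unfolding poly_rho_poly[OF V] by auto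
    define \<rho> where "\<rho> = poly (rho_poly R r) V"
    have "\<rho> * (V * of_real (2 * R)) = - 2 * (\<rho> * (V * (\<gamma> / 2))) * U"
      using conjunct1[OF vertex[OF m]] poly_lin_poly[OF V, of r 0 \<gamma>] unfolding q2 \<epsilon> \<rho>_def
      by (simp add: ac_simps)
    then have "(\<rho> * V) * (of_real (2 * R) + \<gamma> * U) = 0" by (simp add: algebra_simps)
    moreover have "\<rho> * V \<noteq> 0" using rho V by (auto simp: \<rho>_def)
    ultimately have "of_real (2 * R) + \<gamma> * U = 0" using mult_eq_0_iff by blast
    then show ?thesis using \<gamma> by (simp add: field_simps add_eq_0_iff2)
  qed
  then show ?thesis by (intro exI[of _ "- 2 * of_real R / \<gamma>"]) auto
qed

text \<open>
  As the quartic has degree four in \<open>U\<close>, the degree of \<open>P\<close> is one or two.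
\<close>

lemma square_if_double_factor:
  assumes r: "0 < r" and R: "r < R" and \<kappa>: "\<kappa> \<noteq> 0"
    and F: "torus_quartic R r \<kappa> \<epsilon> \<gamma> \<beta> i j = P\<^sup>2 * E"
    and P: "prime_elem P" "degree P > 0"
    and N: "infinite (fst ` M)"
    and unit: "\<And>V U. (V, U) \<in> M \<Longrightarrow> cmod V = 1 \<and> cmod U = 1"
    and zero: "\<And>V U. (V, U) \<in> M \<Longrightarrow> poly (poly P [:U:]) V = 0"
  shows "square_coeffs \<kappa> \<epsilon> \<gamma> \<beta> i j \<or> (\<exists>U. \<forall>m\<in>M. snd m = U)"
proof -
  have rho0: "rho_poly R r \<noteq> 0" using r by (simp add: rho_poly_nz)
  have F4: "degree (torus_quartic R r \<kappa> \<epsilon> \<gamma> \<beta> i j) = 4"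
    using \<kappa> rho0 by (simp add: torus_quartic_def)
  then have nz: "P \<noteq> 0" "E \<noteq> 0" unfolding F by auto
  have "2 * degree P + degree E = 4"
    using F4 nz unfolding F by (simp add: degree_mult_eq degree_power_eq)
  then have "degree P = 2 \<and> degree E = 0 \<or> degree P = 1 \<and> degree E = 2"
    using P(2) by presburger
  then consider "degree P = 2" "degree E = 0" | "degree P = 1" "degree E = 2"
    by (elim disjE conjE)
  then show ?thesis
  proof cases
    case 1
    obtain P0 P1 P2 where Pe: "P = [:P0, P1, P2:]" using 1 degree_le_2_poly_eq[of P] by auto
    obtain E0 where Ee: "E = [:E0:]" using 1 degree_eq_zeroE by blast
    have "P\<^sup>2 * E = [:E0 * P0\<^sup>2, smult 2 (E0 * P1 * P0), E0 * (P1\<^sup>2 + smult 2 (P0 * P2)),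
        smult 2 (E0 * P1 * P2), E0 * P2\<^sup>2:]"
      unfolding Pe Ee smult_2 by (simp add: power2_eq_square algebra_simps)
    note c = F[unfolded this torus_quartic_def pCons_eq_iff]
    have "square_coeffs \<kappa> \<epsilon> \<gamma> \<beta> i j"
      by (rule square_if_double_conic[OF r R \<kappa>, of E0 P2 P1 _ _ P0]) (use c in auto)
    then show ?thesis ..
  next
    case 2
    obtain P0 P1 where Pe: "P = [:P0, P1:]"
      using 2 degree_le_2_poly_eq[of P] coeff_eq_0[of P 2] by auto
    obtain E0 E1 E2 where Ee: "E = [:E0, E1, E2:]" using 2 degree_le_2_poly_eq[of E] by auto
    have "P\<^sup>2 * E = [:P0\<^sup>2 * E0, P0\<^sup>2 * E1 + smult 2 (P1 * P0 * E0),
        P1\<^sup>2 * E0 + smult 2 (P1 * P0 * E1) + P0\<^sup>2 * E2, P1\<^sup>2 * E1 + smult 2 (P1 * P0 * E2), P1\<^sup>2 * E2:]"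
      unfolding Pe Ee smult_2 by (simp add: power2_eq_square algebra_simps)
    note c = F[unfolded this torus_quartic_def pCons_eq_iff]
    have e4: "P1\<^sup>2 * E2 = smult \<kappa> ((rho_poly R r)\<^sup>2)"
      and e3: "P1\<^sup>2 * E1 + smult 2 (P1 * P0 * E2) = rho_poly R r * lin_poly r \<epsilon> \<gamma>"
      and e2: "P1\<^sup>2 * E0 + smult 2 (P1 * P0 * E1) + P0\<^sup>2 * E2 = mid_poly R r \<beta> i j"
      and e1: "P0\<^sup>2 * E1 + smult 2 (P1 * P0 * E0) = rho_poly R r * lin_poly r (cnj \<epsilon>) (cnj \<gamma>)"
      and e0: "P0\<^sup>2 * E0 = smult (cnj \<kappa>) ((rho_poly R r)\<^sup>2)"
      using c by auto
    have "P1\<^sup>2 dvd smult \<kappa> ((rho_poly R r)\<^sup>2)" "P0\<^sup>2 dvd smult (cnj \<kappa>) ((rho_poly R r)\<^sup>2)"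
      unfolding e4[symmetric] e0[symmetric] by simp_all
    then have dvd: "P1 dvd rho_poly R r" "P0 dvd rho_poly R r"
      using \<kappa> by (simp_all add: dvd_smult_iff)
    have modulus: "cmod (poly P0 V) = cmod (poly P1 V)" if "V \<in> fst ` M" for V
    proof -
      from that obtain U where m: "(V, U) \<in> M" by auto
      have "poly P0 V = - (U * poly P1 V)"
        using zero[OF m] by (simp add: Pe eq_neg_iff_add_eq_0)
      then show ?thesis using unit[OF m] by (simp add: norm_mult)
    qed
    have common: "degree f = 0" if "f dvd P0" "f dvd P1" for f
      by (rule const_coeff_dvd_prime_elem[OF P]) (use that in \<open>auto simp: Pe const_poly_dvd_iff coeff_pCons split: nat.split\<close>)
    show ?thesis
    proof (cases "degree P0 = 0 \<or> degree P1 = 0")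
      case True
      have "degree P0 = 0 \<and> degree P1 = 0"
      proof (cases "degree P0 = 0")
        case True
        then obtain c0 where c0: "P0 = [:c0:]" using degree_eq_zeroE by blast
        have "degree P1 = 0"
          by (rule rho_poly_divisor_const_modulus[OF r R dvd(1) N, of "cmod c0"])
            (use modulus unit in \<open>force simp: c0\<close>)
        with True show ?thesis by simp
      next
        case False
        with \<open>degree P0 = 0 \<or> degree P1 = 0\<close> obtain c1 where c1: "P1 = [:c1:]"
          using degree_eq_zeroE by blast
        have "degree P0 = 0"
          by (rule rho_poly_divisor_const_modulus[OF r R dvd(2) N, of "cmod c1"])
            (use modulus unit in \<open>force simp: c1\<close>)
        with False show ?thesis by simp
      qed
      then obtain c0 c1 where c01: "P0 = [:c0:]" "P1 = [:c1:]" using degree_eq_zeroE by metis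
      have "c1 \<noteq> 0" using 2 unfolding Pe c01 by auto
      have "U = - c0 / c1" if m: "(V, U) \<in> M" for V U
        using zero[OF m] \<open>c1 \<noteq> 0\<close> by (simp add: Pe c01 field_simps add_eq_0_iff2)
      then have "\<forall>m\<in>M. snd m = - c0 / c1" by auto
      then show ?thesis by blast
    next
      case False
      \<comment> \<open>A nonconstant divisor of \<open>rho_poly\<close> other than \<open>rho_poly\<close> itself is linear; \<open>rho_poly\<close> itself is
          excluded because the other coefficient would be a common factor.\<close>
      obtain c1 x1 where c1: "c1 \<noteq> 0" "poly (rho_poly R r) x1 = 0" "P1 = smult c1 [:- x1, 1:]"
        using r R dvd(1)
      proof (cases rule: rho_poly_divisor_cases)
        case (2 c)
        then have "P0 dvd P1" using dvd(2) by (simp add: dvd_smult)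
        then have "degree P0 = 0" using common[of P0] by simp
        with False show ?thesis by simp
      qed (use False that in auto)
      obtain c0 x0 where c0: "c0 \<noteq> 0" "poly (rho_poly R r) x0 = 0" "P0 = smult c0 [:- x0, 1:]"
        using r R dvd(2)
      proof (cases rule: rho_poly_divisor_cases)
        case (2 c)
        then have "P1 dvd P0" using dvd(1) by (simp add: dvd_smult)
        then have "degree P1 = 0" using common[of P1] by simp
        with False show ?thesis by simp
      qed (use False that in auto)
      have "x0 \<noteq> x1"
      proof
        assume "x0 = x1"
        then have "degree [:- x1, 1:] = 0"
          unfolding c0(3) c1(3) by (intro common[unfolded c0(3) c1(3)] dvd_smult) simp_all
        then show False by simp
      qed
      obtain v' where v': "v' \<noteq> 0" "v'\<^sup>2 \<noteq> 1" "r * v'\<^sup>2 + 2 * R * v' + r = 0"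
        and roots: "\<And>x :: complex. poly (rho_poly R r) x = 0 \<Longrightarrow> x = of_real v' \<or> x = of_real (inverse v')"
        using rho_poly_roots[OF r R] by blast
      have inv': "r * (inverse v')\<^sup>2 + 2 * R * inverse v' + r = 0"
      proof -
        have "r * (inverse v')\<^sup>2 + 2 * R * inverse v' + r = (inverse v')\<^sup>2 * (r * v'\<^sup>2 + 2 * R * v' + r)"
          using v'(1) by (simp add: power2_eq_square field_simps)
        then show ?thesis using v'(3) by simp
      qed
      obtain v where v: "v \<noteq> 0" "v\<^sup>2 \<noteq> 1" "r * v\<^sup>2 + 2 * R * v + r = 0"
        and x1: "x1 = of_real v" and x0: "x0 = of_real (inverse v)"
      proof (cases "x1 = of_real v'")
        case True
        then have "x0 = of_real (inverse v')" using roots[OF c0(2)] \<open>x0 \<noteq> x1\<close> by auto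
        then show ?thesis using that[of v'] v' True by blast
      next
        case False
        then have "x1 = of_real (inverse v')" using roots[OF c1(2)] by auto
        moreover from this have "x0 = of_real v'" using roots[OF c0(2)] \<open>x0 \<noteq> x1\<close> by auto
        moreover have "(inverse v')\<^sup>2 \<noteq> 1" using v'(2) by (simp add: power_inverse)
        ultimately show ?thesis using that[of "inverse v'"] v'(1) inv' by simp
      qed
      define \<omega> where "\<omega> = c0 / (of_real v * c1)"
      have P0: "P0 = smult (c1 * \<omega>) [:- 1, of_real v:]"
        unfolding c0(3) x0 \<omega>_def using c1(1) v(1) by (simp add: field_simps)
      have P1: "P1 = smult c1 [:- of_real v, 1:]" using c1(3) x1 by simp
      have "fst ` M \<noteq> {}" using N by auto
      then obtain V where V: "V \<in> fst ` M" by blast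
      have V1: "cmod V = 1" using V unit by auto
      have "cmod (V * of_real v - 1) = cmod (V - of_real v)"
      proof -
        have "V * of_real v - 1 = V * cnj (of_real v - V)"
          using unit_mult_cnj[OF V1] by (simp add: algebra_simps)
        then have "cmod (V * of_real v - 1) = cmod (of_real v - V)"
          using V1 by (simp only: norm_mult complex_mod_cnj)
        then show ?thesis by (simp only: norm_minus_commute)
      qed
      moreover have "poly P0 V = (c1 * \<omega>) * (V * of_real v - 1)" "poly P1 V = c1 * (V - of_real v)"
        unfolding P0 P1 by (simp_all add: algebra_simps)
      ultimately have "cmod c1 * cmod \<omega> * cmod (V - of_real v) = cmod c1 * cmod (V - of_real v)"
        using modulus[OF V] by (simp only: norm_mult)
      moreover have "cmod (V - of_real v) \<noteq> 0"
      proof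
        assume "cmod (V - of_real v) = 0"
        then have "V = of_real v" by simp
        then have "\<bar>v\<bar> = 1" using V1 by simp
        then show False using v(2) by (metis one_power2 power2_abs)
      qed
      ultimately have \<omega>: "cmod \<omega> = 1" using c1(1) by simp
      have "square_coeffs \<kappa> \<epsilon> \<gamma> \<beta> i j"
        by (rule square_if_villarceau[OF r R v(3) \<omega>, where ?E0.0 = "smult (c1\<^sup>2) E0"
            and ?E1.0 = "smult (c1\<^sup>2) E1" and ?E2.0 = "smult (c1\<^sup>2) E2"])
          (unfold e4[symmetric] e3[symmetric] e2[symmetric] e1[symmetric] e0[symmetric] P0 P1,
           simp_all only: mult_smult_left mult_smult_right smult_smult smult_power power_mult_distrib,
           simp_all add: power2_eq_square ac_simps)
      then show ?thesis ..
    qed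
  qed
qed

text \<open>
  If infinitely many points share no \<open>V\<close>, then every infinite subset of \<open>M\<close> involves infinitely
  many \<open>V\<close>, as the polynomial arguments require.
\<close>

lemma torus_double_contact:
  assumes r: "0 < r" and R: "r < R" and inf: "infinite M"
    and unit: "\<And>V U. (V, U) \<in> M \<Longrightarrow> cmod V = 1 \<and> cmod U = 1"
    and zero: "\<And>m. m \<in> M \<Longrightarrow> torus_form R r \<kappa> \<epsilon> \<gamma> \<beta> i j m = 0"
    and dzero: "\<And>m. m \<in> M \<Longrightarrow> torus_form_deriv R r \<kappa> \<epsilon> \<gamma> m = 0"
  shows "square_coeffs \<kappa> \<epsilon> \<gamma> \<beta> i j \<or> (\<exists>V. infinite {U. (V, U) \<in> M}) \<or> (\<exists>U. infinite {V. (V, U) \<in> M})"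
proof (cases "\<exists>V. infinite {U. (V, U) \<in> M}")
  case False
  let ?F = "torus_quartic R r \<kappa> \<epsilon> \<gamma> \<beta> i j"
  have F: "poly (poly ?F [:U:]) V = 0" "poly (poly (pderiv ?F) [:U:]) V = 0" if "(V, U) \<in> M" for V U
    using torus_quartic_double_zero unit[OF that] zero[OF that] dzero[OF that] by blast+
  have fst_inf: "infinite (fst ` M')" if "infinite M'" "M' \<subseteq> M" for M'
  proof
    assume "finite (fst ` M')"
    then have "finite (SIGMA V:fst ` M'. {U. (V, U) \<in> M})" using False by blast
    moreover have "M' \<subseteq> (SIGMA V:fst ` M'. {U. (V, U) \<in> M})" using that(2) by force
    ultimately show False using that(1) finite_subset by blast
  qed
  have column: "infinite {V. (V, U) \<in> M}" if "infinite M'" "M' \<subseteq> M" "\<forall>m\<in>M'. snd m = U" for M' U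
  proof -
    have "fst ` M' \<subseteq> {V. (V, U) \<in> M}" using that(2,3) by force
    then show ?thesis using fst_inf[OF that(1,2)] finite_subset by blast
  qed
  show ?thesis
  proof (cases "\<kappa> = 0")
    case True
    have "\<exists>U. \<forall>m\<in>M. snd m = U"
      using constant_longitude_contact[OF r R fst_inf[OF inf subset_refl] unit] F unfolding True by blast
    then show ?thesis using column[OF inf subset_refl] by blast
  next
    case \<kappa>: False
    have "?F \<noteq> 0" using \<kappa> rho_poly_nz[of r R] r by (simp add: torus_quartic_def)
    then obtain P E where PE: "?F = P\<^sup>2 * E" "prime_elem P" "degree P > 0"
      and M': "infinite {(x, y) \<in> M. poly (poly P [:y:]) x = 0}"
      using square_factor_of_double_zeros[OF _ inf _ F] False by blast
    define M' where "M' = {(x, y) \<in> M. poly (poly P [:y:]) x = 0}"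
    have sub: "M' \<subseteq> M" by (auto simp: M'_def)
    have infM': "infinite M'" using M' by (simp add: M'_def)
    have "square_coeffs \<kappa> \<epsilon> \<gamma> \<beta> i j \<or> (\<exists>U. \<forall>m\<in>M'. snd m = U)"
      by (rule square_if_double_factor[OF r R \<kappa> PE fst_inf[OF infM' sub]])
        (use unit in \<open>auto simp: M'_def\<close>)
    then show ?thesis using column[OF infM' sub] by blast
  qed
qed blast

section \<open>Circles as irreducible real curves\<close>

text \<open>
  The restriction to the unit circle of a Laurent polynomial. If it has infinitely many zeros
  there, it is identically zero on the circle.
\<close>

definition laurent_on_circle :: "(complex \<Rightarrow> real) \<Rightarrow> bool" where
  "laurent_on_circle \<phi> \<longleftrightarrow> (\<exists>N G. \<forall>W. cmod W = 1 \<longrightarrow> W ^ N * of_real (\<phi> W) = poly G W)"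

lemma laurent_const: "laurent_on_circle (\<lambda>W. c)"
  unfolding laurent_on_circle_def by (intro exI[of _ 0] exI[of _ "[:of_real c:]"]) simp

lemma laurent_add:
  assumes "laurent_on_circle \<phi>" "laurent_on_circle \<psi>"
  shows "laurent_on_circle (\<lambda>W. \<phi> W + \<psi> W)"
proof -
  obtain N G N' G' where
    "\<And>W. cmod W = 1 \<Longrightarrow> W ^ N * of_real (\<phi> W) = poly G W"
    "\<And>W. cmod W = 1 \<Longrightarrow> W ^ N' * of_real (\<psi> W) = poly G' W"
    using assms unfolding laurent_on_circle_def by blast
  then have "W ^ (N + N') * of_real (\<phi> W + \<psi> W) = poly (monom 1 N' * G + monom 1 N * G') W"
    if "cmod W = 1" for W
    using that by (simp add: power_add poly_monom algebra_simps)
  then show ?thesis unfolding laurent_on_circle_def by blast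
qed

lemma laurent_mult:
  assumes "laurent_on_circle \<phi>" "laurent_on_circle \<psi>"
  shows "laurent_on_circle (\<lambda>W. \<phi> W * \<psi> W)"
proof -
  obtain N G N' G' where
    G: "\<And>W. cmod W = 1 \<Longrightarrow> W ^ N * of_real (\<phi> W) = poly G W"
    "\<And>W. cmod W = 1 \<Longrightarrow> W ^ N' * of_real (\<psi> W) = poly G' W"
    using assms unfolding laurent_on_circle_def by blast
  have "W ^ (N + N') * of_real (\<phi> W * \<psi> W) = poly (G * G') W" if "cmod W = 1" for W
    unfolding poly_mult G[OF that, symmetric] by (simp add: power_add mult_ac)
  then show ?thesis unfolding laurent_on_circle_def by blast
qed

lemma laurent_Re: "laurent_on_circle Re"
proof -
  have "W ^ 1 * of_real (Re W) = poly [:1/2, 0, 1/2:] W" if "cmod W = 1" for W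
  proof -
    have "W * of_real (Re W) = (W * W + W * cnj W) / 2"
      by (simp add: complex_eq_iff field_simps)
    then show ?thesis unfolding unit_mult_cnj[OF that] by (simp add: add_divide_distrib)
  qed
  then show ?thesis unfolding laurent_on_circle_def by blast
qed

lemma laurent_Im: "laurent_on_circle Im"
proof -
  have "W ^ 1 * of_real (Im W) = poly [:\<i>/2, 0, - \<i>/2:] W" if "cmod W = 1" for W
  proof -
    have "W * of_real (Im W) = \<i> * (W * cnj W - W * W) / 2"
      by (simp add: complex_eq_iff field_simps)
    then show ?thesis unfolding unit_mult_cnj[OF that] by (simp add: algebra_simps diff_divide_distrib)
  qed
  then show ?thesis unfolding laurent_on_circle_def by blast
qed

lemma laurent_eval3:
  fixes c p q :: "real ^ 3"
  shows "laurent_on_circle (\<lambda>W. eval3 F (c + Re W *\<^sub>R p + Im W *\<^sub>R q))"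
proof -
  define x where "x k W = c $ k + Re W * p $ k + Im W * q $ k" for k W
  have x: "laurent_on_circle (x k)" for k
    unfolding x_def by (intro laurent_add laurent_mult laurent_const laurent_Re laurent_Im)
  have 1: "laurent_on_circle (\<lambda>W. poly a (x 1 W))" for a
    by (induction a) (simp_all add: laurent_const laurent_add laurent_mult x)
  have 2: "laurent_on_circle (\<lambda>W. poly (poly a [:x 2 W:]) (x 1 W))" for a
    by (induction a) (simp_all add: laurent_const laurent_add laurent_mult x 1)
  have "laurent_on_circle (\<lambda>W. poly (poly (poly F [:[:x 3 W:]:]) [:x 2 W:]) (x 1 W))"
    by (induction F) (simp_all add: laurent_const laurent_add laurent_mult x 2)
  then show ?thesis by (simp add: eval3_def x_def)
qed

lemma vanishing_on_circle:
  fixes c p q :: "real ^ 3"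
  assumes N: "infinite N" "\<And>W. W \<in> N \<Longrightarrow> cmod W = 1 \<and> eval3 F (c + Re W *\<^sub>R p + Im W *\<^sub>R q) = 0"
    and W: "cmod W = 1"
  shows "eval3 F (c + Re W *\<^sub>R p + Im W *\<^sub>R q) = 0"
proof -
  obtain n G where G: "\<And>W. cmod W = 1 \<Longrightarrow> W ^ n * of_real (eval3 F (c + Re W *\<^sub>R p + Im W *\<^sub>R q)) = poly G W"
    using laurent_eval3[of F c p q] unfolding laurent_on_circle_def by blast
  have "G = 0"
  proof (rule ccontr)
    assume "G \<noteq> 0"
    then have "finite {W. poly G W = 0}" by (rule poly_roots_finite)
    moreover have "N \<subseteq> {W. poly G W = 0}" using N(2) G by fastforce
    ultimately show False using N(1) finite_subset by blast
  qed
  then show ?thesis using G[OF W] W by auto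
qed

text \<open>
  Algebraic sets that meet \<open>C\<close> in infinitely many points contain \<open>C\<close>. Hence \<open>C\<close> is irreducible and
  contained in \<open>D\<close>; if they were different, a point, \<open>C\<close> and \<open>D\<close> would form a chain of length two.
\<close>

lemma curve_eq_circle:
  fixes c p q :: "real ^ 3"
  defines "\<phi> \<equiv> \<lambda>W. c + Re W *\<^sub>R p + Im W *\<^sub>R q"
  assumes D: "irreducible_set D" "alg_dim D = 1" and C: "algebraic_set C" "C = \<phi> ` {W. cmod W = 1}"
    and p: "p \<noteq> 0" and N: "infinite N" "\<And>W. W \<in> N \<Longrightarrow> cmod W = 1 \<and> \<phi> W \<in> D"
  shows "D = C"
proof -
  have alg: "C \<subseteq> A" if A: "algebraic_set A" and N': "infinite N'" "\<And>W. W \<in> N' \<Longrightarrow> cmod W = 1 \<and> \<phi> W \<in> A" for A N'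
  proof -
    obtain S where S: "A = (\<Inter>F\<in>S. zero_set F)" using A unfolding algebraic_set_def by blast
    have "eval3 F (\<phi> W) = 0" if "F \<in> S" "cmod W = 1" for F W
      unfolding \<phi>_def
      by (rule vanishing_on_circle[OF N'(1) _ that(2)])
        (use N'(2) that(1) in \<open>auto simp: S zero_set_def \<phi>_def\<close>)
    then show ?thesis unfolding C(2) S by (auto simp: zero_set_def)
  qed
  have CD: "C \<subseteq> D" using alg[OF _ N] D(1) by (simp add: irreducible_set_def)
  have irr: "irreducible_set C"
    unfolding irreducible_set_def
  proof (intro conjI allI impI C(1))
    have "(1::complex) \<in> {W. cmod W = 1}" by simp
    then show "C \<noteq> {}" unfolding C(2) by blast
    fix A B assume AB: "algebraic_set A \<and> algebraic_set B \<and> C = A \<union> B"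
    have "N = {W \<in> N. \<phi> W \<in> A} \<union> {W \<in> N. \<phi> W \<in> B}"
      using N(2) AB C(2) by blast
    then have "infinite {W \<in> N. \<phi> W \<in> A} \<or> infinite {W \<in> N. \<phi> W \<in> B}"
      using N(1) finite_UnI by metis
    then have "C \<subseteq> A \<or> C \<subseteq> B" using alg[of A "{W \<in> N. \<phi> W \<in> A}"] alg[of B "{W \<in> N. \<phi> W \<in> B}"] AB N(2) by blast
    then show "C = A \<or> C = B" using AB by blast
  qed
  show ?thesis
  proof (rule ccontr)
    assume "D \<noteq> C"
    define W where "W k = (if k = 0 then {\<phi> 1} else if k = 1 then C else D)" for k :: nat
    have 1: "\<phi> 1 \<in> C" "\<phi> (- 1) \<in> C" unfolding C(2) by simp_all
    moreover have "\<phi> 1 - \<phi> (- 1) = 2 *\<^sub>R p" by (simp add: \<phi>_def scaleR_2)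
    then have "\<phi> 1 \<noteq> \<phi> (- 1)" using p by auto
    ultimately have "{\<phi> 1} \<subset> C" by (metis insert_absorb insert_subset psubsetI singletonD empty_subsetI)
    moreover have "C \<subset> D" using CD \<open>D \<noteq> C\<close> by blast
    ultimately have "enat 2 \<le> alg_dim D"
      using D(1) irr irreducible_set_singleton
      by (intro alg_dim_ge[of _ W]) (auto simp: W_def less_2_cases_iff)
    then show False using D(2) by (simp add: one_enat_def)
  qed
qed

lemma algebraic_set_circle3:
  assumes "\<rho> \<ge> 0"
  shows "algebraic_set (circle3 c n \<rho>)"
proof -
  define F where "F = C3 (n $ 1) * (X3 - C3 (c $ 1)) + C3 (n $ 2) * (Y3 - C3 (c $ 2)) + C3 (n $ 3) * (Z3 - C3 (c $ 3))"
  define G where "G = (X3 - C3 (c $ 1))\<^sup>2 + (Y3 - C3 (c $ 2))\<^sup>2 + (Z3 - C3 (c $ 3))\<^sup>2 - C3 (\<rho>\<^sup>2)"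
  have "dist v c = \<rho> \<longleftrightarrow> (dist v c)\<^sup>2 = \<rho>\<^sup>2" for v using assms by (simp add: power2_eq_iff_nonneg)
  moreover have "(dist v c)\<^sup>2 = (v $ 1 - c $ 1)\<^sup>2 + (v $ 2 - c $ 2)\<^sup>2 + (v $ 3 - c $ 3)\<^sup>2" for v
    unfolding dist_norm power2_norm_eq_inner by (simp add: inner_vec_def sum_3 power2_eq_square)
  ultimately have "circle3 c n \<rho> = zero_set F \<inter> zero_set G"
    by (auto simp: circle3_def zero_set_def F_def G_def inner_vec_def sum_3)
  then show ?thesis by (simp add: algebraic_set_Int algebraic_set_zero_set)
qed

section \<open>Parallel and meridian circles of the torus\<close>

text \<open>
  The angles are encoded by the complex numbers \<open>V\<close> and \<open>U\<close> of modulus one: \<open>V\<close> runs through a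
  meridian circle and \<open>U\<close> through a parallel circle.
\<close>

definition torus_point :: "real \<Rightarrow> real \<Rightarrow> complex \<times> complex \<Rightarrow> real ^ 3" where
  "torus_point R r = (\<lambda>(V, U). vector [(R + r * Re V) * Re U, (R + r * Re V) * Im U, r * Im V])"

lemma torus_point_nth:
  "torus_point R r (V, U) $ 1 = (R + r * Re V) * Re U"
  "torus_point R r (V, U) $ 2 = (R + r * Re V) * Im U"
  "torus_point R r (V, U) $ 3 = r * Im V"
  by (simp_all add: torus_point_def)

lemma eval3_torus_poly:
  "eval3 (torus_poly R r) v = ((v $ 1)\<^sup>2 + (v $ 2)\<^sup>2 + (v $ 3)\<^sup>2 + R\<^sup>2 - r\<^sup>2)\<^sup>2 - 4 * R\<^sup>2 * ((v $ 1)\<^sup>2 + (v $ 2)\<^sup>2)"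
  by (simp add: torus_poly_def torus_p2_def torus_p0_def power2_eq_square power4_eq_xxxx algebra_simps)

lemma unit_Re_Im: "cmod V = 1 \<Longrightarrow> (Re V)\<^sup>2 + (Im V)\<^sup>2 = 1"
  using cmod_power2[of V] by simp

lemma torus_point_radius:
  assumes "cmod U = 1"
  shows "(torus_point R r (V, U) $ 1)\<^sup>2 + (torus_point R r (V, U) $ 2)\<^sup>2 = (R + r * Re V)\<^sup>2"
proof -
  have "(torus_point R r (V, U) $ 1)\<^sup>2 + (torus_point R r (V, U) $ 2)\<^sup>2 =
      (R + r * Re V)\<^sup>2 * ((Re U)\<^sup>2 + (Im U)\<^sup>2)"
    by (simp only: torus_point_nth power_mult_distrib distrib_left)
  then show ?thesis using unit_Re_Im[OF assms] by simp
qed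

lemma torus_point_norm:
  assumes "cmod V = 1" "cmod U = 1"
  shows "(torus_point R r (V, U) $ 1)\<^sup>2 + (torus_point R r (V, U) $ 2)\<^sup>2 + (torus_point R r (V, U) $ 3)\<^sup>2 =
    R\<^sup>2 + r\<^sup>2 + 2 * R * r * Re V"
proof -
  have "(R + r * Re V)\<^sup>2 + (r * Im V)\<^sup>2 = R\<^sup>2 + r\<^sup>2 * ((Re V)\<^sup>2 + (Im V)\<^sup>2) + 2 * R * r * Re V"
    by (simp add: power2_eq_square algebra_simps)
  then show ?thesis
    unfolding torus_point_radius[OF assms(2)] torus_point_nth(3) unit_Re_Im[OF assms(1)] by simp
qed

lemma torus_point_in_torus:
  assumes "cmod V = 1" "cmod U = 1"
  shows "torus_point R r (V, U) \<in> zero_set (torus_poly R r)"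
  unfolding zero_set_def mem_Collect_eq eval3_torus_poly torus_point_norm[OF assms]
  unfolding torus_point_radius[OF assms(2)]
  by (simp add: power2_eq_square algebra_simps)

text \<open>
  The equation of the torus reads \<open>(\<rho>\<^sup>2 + z\<^sup>2 + R\<^sup>2 - r\<^sup>2)\<^sup>2 = (2 R \<rho>)\<^sup>2\<close> with \<open>\<rho>\<close> the distance from the
  axis, and both bases are nonnegative.
\<close>

lemma torus_param:
  assumes r: "0 < r" and R: "r < R" and v: "v \<in> zero_set (torus_poly R r)"
  shows "\<exists>V U. cmod V = 1 \<and> cmod U = 1 \<and> v = torus_point R r (V, U)"
proof -
  define x y z where "x = v $ 1" and "y = v $ 2" and "z = v $ 3"
  define \<rho> where "\<rho> = sqrt (x\<^sup>2 + y\<^sup>2)"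
  have \<rho>2: "\<rho>\<^sup>2 = x\<^sup>2 + y\<^sup>2" and \<rho>0: "0 \<le> \<rho>" by (simp_all add: \<rho>_def)
  have "r\<^sup>2 < R\<^sup>2" using r R by (simp add: power_strict_mono)
  then have pos: "0 < x\<^sup>2 + y\<^sup>2 + z\<^sup>2 + R\<^sup>2 - r\<^sup>2"
    using zero_le_power2[of x] zero_le_power2[of y] zero_le_power2[of z] by linarith
  have "(x\<^sup>2 + y\<^sup>2 + z\<^sup>2 + R\<^sup>2 - r\<^sup>2)\<^sup>2 = (2 * R * \<rho>)\<^sup>2"
    using v unfolding zero_set_def mem_Collect_eq eval3_torus_poly
    by (simp add: x_def y_def z_def power_mult_distrib \<rho>2)
  then have N: "x\<^sup>2 + y\<^sup>2 + z\<^sup>2 + R\<^sup>2 - r\<^sup>2 = 2 * R * \<rho>"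
    using pos \<rho>0 r R by (simp add: power2_eq_iff_nonneg)
  then have "\<rho> \<noteq> 0" using pos by auto
  then have \<rho>: "0 < \<rho>" using \<rho>0 by simp
  have circ: "(\<rho> - R)\<^sup>2 + z\<^sup>2 = r\<^sup>2" using N \<rho>2 by (simp add: power2_eq_square algebra_simps)
  define V U where "V = Complex ((\<rho> - R) / r) (z / r)" and "U = Complex (x / \<rho>) (y / \<rho>)"
  have "cmod V = 1"
    using circ r by (simp add: V_def cmod_def power_divide add_divide_distrib[symmetric])
  moreover have "cmod U = 1"
    using \<rho> by (simp add: U_def cmod_def power_divide add_divide_distrib[symmetric] \<rho>2[symmetric])
  moreover have "v = torus_point R r (V, U)"
    using r \<rho> by (simp add: vec_eq_iff forall_3 torus_point_nth V_def U_def x_def y_def z_def)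
  ultimately show ?thesis by blast
qed

lemma eval3_quadric_torus_point:
  assumes "cmod U = 1"
  shows "eval3 (quadric_poly a b d e f g h i j) (torus_point R r (V, U)) =
    torus_form R r (Complex ((a - b) / 4) (- d / 4)) (Complex e (- f)) (Complex g (- h)) ((a + b) / 2) i j (V, U)"
proof -
  define x y z where "x = torus_point R r (V, U) $ 1" and "y = torus_point R r (V, U) $ 2"
    and "z = torus_point R r (V, U) $ 3"
  have w: "of_real (R + r * Re V) * U = Complex x y"
    by (simp add: complex_eq_iff x_def y_def torus_point_nth)
  have \<rho>: "(R + r * Re V)\<^sup>2 = x\<^sup>2 + y\<^sup>2"
    unfolding x_def y_def torus_point_radius[OF assms] ..
  have z: "r * Im V = z" by (simp add: z_def torus_point_nth)
  have "torus_form R r (Complex ((a - b) / 4) (- d / 4)) (Complex e (- f)) (Complex g (- h)) ((a + b) / 2) i j (V, U) =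
      a * x\<^sup>2 + b * y\<^sup>2 + d * x * y + g * x + h * y + j + (e * x + f * y + i) * z + z\<^sup>2"
    unfolding torus_form_def Let_def prod.case w \<rho> z
    by (simp add: power2_eq_square field_simps)
  then show ?thesis
    by (simp add: quadric_poly_def quadric_q1_def quadric_q0_def x_def y_def z_def algebra_simps)
qed

text \<open>
  The factor \<open>Re V\<close> is there because the gradient of the torus is vertical on the top and the
  bottom circle.
\<close>

lemma eval3_jacobian_torus_point:
  assumes "cmod V = 1" "cmod U = 1"
  shows "eval3 (jacobian_xy (torus_poly R r) (quadric_poly a b d e f g h i j)) (torus_point R r (V, U)) =
    8 * R * r * Re V *
      torus_form_deriv R r (Complex ((a - b) / 4) (- d / 4)) (Complex e (- f)) (Complex g (- h)) (V, U)"
proof -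
  define v where "v = torus_point R r (V, U)"
  define x y z where "x = v $ 1" and "y = v $ 2" and "z = v $ 3"
  let ?Q = "quadric_poly a b d e f g h i j"
  have Tx: "eval3 (partial_x (torus_poly R r)) v = 4 * x * (x\<^sup>2 + y\<^sup>2 + z\<^sup>2 - R\<^sup>2 - r\<^sup>2)"
    unfolding x_def y_def z_def
    by (rule eval3_partial_x_eqI, unfold eval3_torus_poly)
      (auto intro!: derivative_eq_intros simp: power2_eq_square algebra_simps)
  have Ty: "eval3 (partial_y (torus_poly R r)) v = 4 * y * (x\<^sup>2 + y\<^sup>2 + z\<^sup>2 - R\<^sup>2 - r\<^sup>2)"
    unfolding x_def y_def z_def
    by (rule eval3_partial_y_eqI, unfold eval3_torus_poly)
      (auto intro!: derivative_eq_intros simp: power2_eq_square algebra_simps)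
  have Qx: "eval3 (partial_x ?Q) v = 2 * a * x + d * y + e * z + g"
    unfolding x_def y_def z_def
    by (rule eval3_partial_x_eqI, unfold quadric_poly_def quadric_q1_def quadric_q0_def)
      (auto intro!: derivative_eq_intros simp: power2_eq_square algebra_simps)
  have Qy: "eval3 (partial_y ?Q) v = 2 * b * y + d * x + f * z + h"
    unfolding x_def y_def z_def
    by (rule eval3_partial_y_eqI, unfold quadric_poly_def quadric_q1_def quadric_q0_def)
      (auto intro!: derivative_eq_intros simp: power2_eq_square algebra_simps)
  have n: "x\<^sup>2 + y\<^sup>2 + z\<^sup>2 - R\<^sup>2 - r\<^sup>2 = 2 * R * r * Re V"
    unfolding x_def y_def z_def v_def torus_point_norm[OF assms] by simp
  have w: "of_real (R + r * Re V) * U = Complex x y"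
    by (simp add: complex_eq_iff x_def y_def v_def torus_point_nth)
  have z: "r * Im V = z" by (simp add: z_def v_def torus_point_nth)
  have K: "torus_form_deriv R r (Complex ((a - b) / 4) (- d / 4)) (Complex e (- f)) (Complex g (- h)) (V, U) =
      x * (2 * b * y + d * x + f * z + h) - y * (2 * a * x + d * y + e * z + g)"
    unfolding torus_form_deriv_def Let_def prod.case w z
    by (simp add: power2_eq_square field_simps)
  have "eval3 (jacobian_xy (torus_poly R r) ?Q) v = 4 * (x\<^sup>2 + y\<^sup>2 + z\<^sup>2 - R\<^sup>2 - r\<^sup>2) *
      (x * (2 * b * y + d * x + f * z + h) - y * (2 * a * x + d * y + e * z + g))"
    unfolding jacobian_xy_def eval3_simps Tx Ty Qx Qy by (simp add: algebra_simps)
  then show ?thesis unfolding n K[symmetric] v_def by simp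
qed

lemma quadric_square_if_square_coeffs:
  assumes "square_coeffs (Complex ((a - b) / 4) (- d / 4)) (Complex e (- f)) (Complex g (- h)) ((a + b) / 2) i j"
  shows "quadric_poly a b d e f g h i j = (Z3 + C3 (e / 2) * X3 + C3 (f / 2) * Y3 + C3 (i / 2))\<^sup>2"
proof -
  have "(Complex e (- f))\<^sup>2 = 16 * Complex ((a - b) / 4) (- d / 4)"
    and \<beta>: "(a + b) / 2 = (cmod (Complex e (- f)))\<^sup>2 / 8"
    and \<gamma>: "Complex g (- h) = Complex e (- f) * of_real i / 2" and j: "j = i\<^sup>2 / 4"
    using assms by (simp_all add: square_coeffs_def)
  then have 1: "e\<^sup>2 - f\<^sup>2 = 4 * (a - b)" "d = e * f / 2"
    by (simp_all add: complex_eq_iff power2_eq_square)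
  have 2: "4 * (a + b) = e\<^sup>2 + f\<^sup>2" using \<beta> by (simp add: cmod_power2)
  have ab: "a = (e / 2)\<^sup>2" "b = (f / 2)\<^sup>2" using 1(1) 2 by (simp_all add: power_divide)
  have gh: "g = e * i / 2" "h = f * i / 2" using \<gamma> by (simp_all add: complex_eq_iff)
  show ?thesis
    unfolding quadric_poly_pCons
    by (simp add: Z3_def C3_def X3_def Y3_def power2_eq_square one_pCons ab gh j 1(2) field_simps)
qed

lemma square_not_irreducible:
  "\<not> irreducible ((Z3 + C3 u * X3 + C3 v * Y3 + C3 w)\<^sup>2)"
proof
  let ?L = "Z3 + C3 u * X3 + C3 v * Y3 + C3 w"
  assume "irreducible (?L\<^sup>2)"
  then have "is_unit ?L" using irreducibleD[of "?L\<^sup>2" ?L ?L] by (auto simp: power2_eq_square)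
  moreover have "?L = [:[:[:w, u:], [:v:]:], 1:]"
    by (simp add: Z3_def C3_def X3_def Y3_def one_pCons)
  ultimately show False by (auto simp: is_unit_poly_iff)
qed

lemma parallel_circle_torus:
  assumes r: "0 < r" and R: "r < R" and V: "cmod V = 1"
  defines "C \<equiv> (\<lambda>U. torus_point R r (V, U)) ` {U. cmod U = 1}"
  shows "C = circle3 (vector [0, 0, r * Im V]) (axis 3 1) (R + r * Re V)"
    and "parallel_circle R r C"
proof -
  let ?c = "vector [0, 0, r * Im V] :: real ^ 3" and ?\<rho> = "R + r * Re V"
  have \<rho>: "0 < ?\<rho>" using torus_radius_pos[OF r R V] .
  have mem: "v \<in> circle3 ?c (axis 3 1) ?\<rho> \<longleftrightarrow> v $ 3 = r * Im V \<and> (v $ 1)\<^sup>2 + (v $ 2)\<^sup>2 = ?\<rho>\<^sup>2" for v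
  proof -
    have "dist v ?c = ?\<rho> \<longleftrightarrow> (dist v ?c)\<^sup>2 = ?\<rho>\<^sup>2" using \<rho> by (simp add: power2_eq_iff_nonneg)
    moreover have "(dist v ?c)\<^sup>2 = (v $ 1)\<^sup>2 + (v $ 2)\<^sup>2 + (v $ 3 - r * Im V)\<^sup>2"
      unfolding dist_norm power2_norm_eq_inner by (simp add: inner_vec_def sum_3 power2_eq_square)
    ultimately show ?thesis by (auto simp: circle3_def inner_axis')
  qed
  show C: "C = circle3 ?c (axis 3 1) ?\<rho>"
  proof (intro equalityI subsetI)
    fix v assume "v \<in> C"
    then show "v \<in> circle3 ?c (axis 3 1) ?\<rho>"
      unfolding mem C_def using torus_point_radius by (auto simp: torus_point_nth)
  next
    fix v assume "v \<in> circle3 ?c (axis 3 1) ?\<rho>"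
    then have v: "v $ 3 = r * Im V" "(v $ 1)\<^sup>2 + (v $ 2)\<^sup>2 = ?\<rho>\<^sup>2" using mem by auto
    define U where "U = Complex (v $ 1 / ?\<rho>) (v $ 2 / ?\<rho>)"
    have "cmod U = 1"
      using v(2) \<rho> by (simp add: U_def cmod_def power_divide add_divide_distrib[symmetric])
    moreover have "v = torus_point R r (V, U)"
      using v(1) \<rho> by (simp add: vec_eq_iff forall_3 torus_point_nth U_def)
    ultimately show "v \<in> C" unfolding C_def by blast
  qed
  have "C \<subseteq> zero_set (torus_poly R r)" unfolding C_def using torus_point_in_torus[OF V] by blast
  moreover have "?c \<in> z_axis" by (simp add: z_axis_def)
  ultimately show "parallel_circle R r C" unfolding parallel_circle_def using C \<rho> by blast
qed

lemma meridian_circle_torus: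
  assumes r: "0 < r" and R: "r < R" and U: "cmod U = 1"
  defines "C \<equiv> (\<lambda>V. torus_point R r (V, U)) ` {V. cmod V = 1}"
  shows "C = circle3 (vector [R * Re U, R * Im U, 0]) (vector [- Im U, Re U, 0]) r"
    and "meridian_circle R r C"
proof -
  have circle: "(\<lambda>V. torus_point R r (V, U)) ` {V. cmod V = 1} =
      circle3 (vector [R * Re U, R * Im U, 0]) (vector [- Im U, Re U, 0]) r" if U: "cmod U = 1" for U
  proof -
    let ?c = "vector [R * Re U, R * Im U, 0] :: real ^ 3" and ?n = "vector [- Im U, Re U, 0] :: real ^ 3"
    have UU: "Re U * Re U + Im U * Im U = 1" using unit_Re_Im[OF U] by (simp add: power2_eq_square)
    have mem: "v \<in> circle3 ?c ?n r \<longleftrightarrow> Re U * v $ 2 = Im U * v $ 1 \<and>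
        (v $ 1 - R * Re U)\<^sup>2 + (v $ 2 - R * Im U)\<^sup>2 + (v $ 3)\<^sup>2 = r\<^sup>2" for v
    proof -
      have "dist v ?c = r \<longleftrightarrow> (dist v ?c)\<^sup>2 = r\<^sup>2" using r by (simp add: power2_eq_iff_nonneg)
      moreover have "(dist v ?c)\<^sup>2 = (v $ 1 - R * Re U)\<^sup>2 + (v $ 2 - R * Im U)\<^sup>2 + (v $ 3)\<^sup>2"
        unfolding dist_norm power2_norm_eq_inner by (simp add: inner_vec_def sum_3 power2_eq_square)
      ultimately show ?thesis by (auto simp: circle3_def inner_vec_def sum_3 algebra_simps)
    qed
    show ?thesis
    proof (intro equalityI subsetI)
      fix v assume "v \<in> (\<lambda>V. torus_point R r (V, U)) ` {V. cmod V = 1}"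
      then obtain V where V: "cmod V = 1" and v: "v = torus_point R r (V, U)" by blast
      have "(v $ 1 - R * Re U)\<^sup>2 + (v $ 2 - R * Im U)\<^sup>2 + (v $ 3)\<^sup>2 =
          r\<^sup>2 * ((Re V)\<^sup>2 * (Re U * Re U + Im U * Im U) + (Im V)\<^sup>2)"
        by (simp add: v torus_point_nth power2_eq_square algebra_simps)
      also have "\<dots> = r\<^sup>2" unfolding UU using unit_Re_Im[OF V] by simp
      finally show "v \<in> circle3 ?c ?n r" unfolding mem by (simp add: v torus_point_nth)
    next
      fix v assume "v \<in> circle3 ?c ?n r"
      then have v: "Re U * v $ 2 = Im U * v $ 1"
          "(v $ 1 - R * Re U)\<^sup>2 + (v $ 2 - R * Im U)\<^sup>2 + (v $ 3)\<^sup>2 = r\<^sup>2"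
        using mem by auto
      define t where "t = Re U * v $ 1 + Im U * v $ 2"
      have "t * Re U = v $ 1 * (Re U * Re U) + Im U * (Re U * v $ 2)" by (simp add: t_def algebra_simps)
      also have "\<dots> = v $ 1 * (Re U * Re U + Im U * Im U)" unfolding v(1) by (simp add: algebra_simps)
      finally have t1: "t * Re U = v $ 1" unfolding UU by simp
      have "t * Im U = Re U * (Im U * v $ 1) + v $ 2 * (Im U * Im U)" by (simp add: t_def algebra_simps)
      also have "\<dots> = v $ 2 * (Re U * Re U + Im U * Im U)" unfolding v(1)[symmetric] by (simp add: algebra_simps)
      finally have t2: "t * Im U = v $ 2" unfolding UU by simp
      have "(t - R)\<^sup>2 * (Re U * Re U + Im U * Im U) + (v $ 3)\<^sup>2 = r\<^sup>2"
        unfolding v(2)[symmetric] t1[symmetric] t2[symmetric] by (simp add: power2_eq_square algebra_simps)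
      then have t3: "(t - R)\<^sup>2 + (v $ 3)\<^sup>2 = r\<^sup>2" unfolding UU by simp
      define V where "V = Complex ((t - R) / r) (v $ 3 / r)"
      have "cmod V = 1"
        using t3 r by (simp add: V_def cmod_def power_divide add_divide_distrib[symmetric])
      moreover have "v = torus_point R r (V, U)"
        using r t1 t2 by (simp add: vec_eq_iff forall_3 torus_point_nth V_def)
      ultimately show "v \<in> (\<lambda>V. torus_point R r (V, U)) ` {V. cmod V = 1}" by blast
    qed
  qed
  let ?c = "\<lambda>U. vector [R * Re U, R * Im U, 0] :: real ^ 3"
    and ?n = "vector [- Im U, Re U, 0] :: real ^ 3"
  show C: "C = circle3 (?c U) ?n r" unfolding C_def by (rule circle[OF U])
  have U': "cmod (- U) = 1" using U by simp
  have C': "(\<lambda>V. torus_point R r (V, - U)) ` {V. cmod V = 1} = circle3 (?c (- U)) ?n r"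
  proof -
    have "vector [- Im (- U), Re (- U), 0] = - ?n" by (simp add: vec_eq_iff forall_3)
    moreover have "circle3 c (- n) \<rho> = circle3 c n \<rho>" for c n \<rho> by (simp add: circle3_def)
    ultimately show ?thesis using circle[OF U'] by simp
  qed
  have UU: "Re U * Re U + Im U * Im U = 1" using unit_Re_Im[OF U] by (simp add: power2_eq_square)
  have n_inner: "?n \<bullet> v = Re U * v $ 2 - Im U * v $ 1" for v
    by (simp add: inner_vec_def sum_3)
  show "meridian_circle R r C"
    unfolding meridian_circle_def
  proof (intro exI conjI)
    show "?n \<noteq> 0" using U by (auto simp: vec_eq_iff forall_3 cmod_def)
    show "z_axis \<subseteq> {v. ?n \<bullet> v = 0}" by (auto simp: z_axis_def n_inner)
    show "?n \<bullet> ?c U = 0" "?n \<bullet> ?c (- U) = 0" by (simp_all add: n_inner)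
    show "C = circle3 (?c U) ?n r" by (rule C)
    show "circle3 (?c U) ?n r \<noteq> circle3 (?c (- U)) ?n r"
    proof
      assume eq: "circle3 (?c U) ?n r = circle3 (?c (- U)) ?n r"
      have "torus_point R r (1, U) \<in> circle3 (?c U) ?n r" using C unfolding C_def by (auto intro: rev_image_eqI)
      then obtain V where V: "cmod V = 1" "torus_point R r (1, U) = torus_point R r (V, - U)"
        unfolding eq C'[symmetric] by blast
      then have "(R + r) * Re U = - ((R + r * Re V) * Re U)" "(R + r) * Im U = - ((R + r * Re V) * Im U)"
        using torus_point_nth[of R r 1 U] torus_point_nth[of R r V "- U"] by simp_all
      then have "(R + r + (R + r * Re V)) * Re U = 0" "(R + r + (R + r * Re V)) * Im U = 0"
        by (simp_all add: algebra_simps)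
      moreover have "R + r + (R + r * Re V) \<noteq> 0" using torus_radius_pos[OF r R V(1)] r R by linarith
      ultimately have "U = 0" by (simp add: complex_eq_iff)
      then show False using U by simp
    qed
    show "zero_set (torus_poly R r) \<inter> {v. ?n \<bullet> v = 0} = circle3 (?c U) ?n r \<union> circle3 (?c (- U)) ?n r"
    proof (intro equalityI subsetI)
      fix v assume v: "v \<in> zero_set (torus_poly R r) \<inter> {v. ?n \<bullet> v = 0}"
      then obtain V W where V: "cmod V = 1" "cmod W = 1" "v = torus_point R r (V, W)"
        using torus_param[OF r R] by blast
      have "(R + r * Re V) * (Re U * Im W - Im U * Re W) = 0"
        using v by (simp add: n_inner V(3) torus_point_nth algebra_simps)
      then have "Im (cnj U * W) = 0" using torus_radius_pos[OF r R V(1)] by simp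
      moreover have "cmod (cnj U * W) = 1" using U V(2) by (simp add: norm_mult)
      ultimately have "cnj U * W = 1 \<or> cnj U * W = - 1"
        by (auto simp: complex_eq_iff cmod_def power2_eq_1_iff)
      then have "U * cnj U * W = U \<or> U * cnj U * W = - U" by (auto simp: mult.assoc)
      then have "W = U \<or> W = - U" unfolding unit_mult_cnj[OF U] by simp
      then show "v \<in> circle3 (?c U) ?n r \<union> circle3 (?c (- U)) ?n r"
        unfolding C[symmetric] C'[symmetric] C_def using V by blast
    next
      fix v assume v: "v \<in> circle3 (?c U) ?n r \<union> circle3 (?c (- U)) ?n r"
      have "?n \<bullet> v = 0"
        using v by (auto simp: circle3_def n_inner algebra_simps)
      moreover have "v \<in> zero_set (torus_poly R r)"
        using v torus_point_in_torus U U' unfolding C[symmetric] C'[symmetric] C_def by blast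
      ultimately show "v \<in> zero_set (torus_poly R r) \<inter> {v. ?n \<bullet> v = 0}" by blast
    qed
  qed
qed

section \<open>The multiple component\<close>

theorem theorem3p17:
  fixes r R a b d e f g h i j :: real and D :: "(real ^ 3) set"
  assumes "0 < r" and "r < R"
    and "irreducible (quadric_poly a b d e f g h i j)"
    and "multiple_component D (torus_poly R r) (quadric_poly a b d e f g h i j)"
  shows "parallel_circle R r D \<or> meridian_circle R r D"
proof -
  note r = assms(1) and R = assms(2)
  let ?T = "torus_poly R r" and ?Q = "quadric_poly a b d e f g h i j"
  let ?\<kappa> = "Complex ((a - b) / 4) (- d / 4)" and ?\<epsilon> = "Complex e (- f)" and ?\<gamma> = "Complex g (- h)"
  have D: "irreducible_set D" and sub: "D \<subseteq> zero_set ?T \<inter> zero_set ?Q" and dim: "alg_dim D = 1"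
    using assms(4) by (auto simp: multiple_component_def irreducible_component_def)
  have "infinite D" using dim by (intro infinite_if_alg_dim_pos) simp
  define M where "M = {(V, U). cmod V = 1 \<and> cmod U = 1 \<and> torus_point R r (V, U) \<in> D}"
  have unit: "cmod V = 1 \<and> cmod U = 1" if "(V, U) \<in> M" for V U using that by (auto simp: M_def)
  have "D \<subseteq> torus_point R r ` M"
  proof
    fix v assume v: "v \<in> D"
    then obtain V U where "cmod V = 1" "cmod U = 1" "v = torus_point R r (V, U)"
      using torus_param[OF r R, of v] sub by blast
    with v show "v \<in> torus_point R r ` M" by (auto simp: M_def)
  qed
  with \<open>infinite D\<close> have infM: "infinite M" using finite_surj by blast
  have zero: "torus_form R r ?\<kappa> ?\<epsilon> ?\<gamma> ((a + b) / 2) i j m = 0" if mM: "m \<in> M" for m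
  proof -
    obtain V U where m: "m = (V, U)" "cmod U = 1" "torus_point R r (V, U) \<in> D"
      using mM by (auto simp: M_def)
    then have "eval3 ?Q (torus_point R r (V, U)) = 0" using sub by (auto simp: zero_set_def)
    then show ?thesis unfolding eval3_quadric_torus_point[OF m(2)] m(1) .
  qed
  have dzero: "Re (fst m) * torus_form_deriv R r ?\<kappa> ?\<epsilon> ?\<gamma> m = 0" if mM: "m \<in> M" for m
  proof -
    obtain V U where m: "m = (V, U)" "cmod V = 1" "cmod U = 1" "torus_point R r (V, U) \<in> D"
      using mM by (auto simp: M_def)
    have "eval3 (jacobian_xy ?T ?Q) (torus_point R r (V, U)) = 0"
      using jacobian_vanishes_on_multiple_component[OF assms] m(4) by (auto simp: vanishing_ideal_def)
    then show ?thesis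
      unfolding eval3_jacobian_torus_point[OF m(2,3)] using r R by (simp add: m(1))
  qed
  \<comment> \<open>On the top and the bottom circle, where \<open>Re V = 0\<close>, the minor of the Jacobian carries no
      information; infinitely many points there lie on one of these two parallel circles anyway.\<close>
  have "(\<exists>V. infinite {U. (V, U) \<in> M}) \<or> (\<exists>U. infinite {V. (V, U) \<in> M})"
  proof (cases "finite {m \<in> M. torus_form_deriv R r ?\<kappa> ?\<epsilon> ?\<gamma> m = 0}")
    case True
    have "M \<subseteq> {m \<in> M. torus_form_deriv R r ?\<kappa> ?\<epsilon> ?\<gamma> m = 0} \<union>
        (SIGMA V:{V. cmod V = 1 \<and> Re V = 0}. {U. (V, U) \<in> M})"
      using dzero unit by fastforce
    then have "infinite (SIGMA V:{V. cmod V = 1 \<and> Re V = 0}. {U. (V, U) \<in> M})"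
      using infM True finite_subset by blast
    then have "\<exists>V. infinite {U. (V, U) \<in> M}"
      using finite_SigmaI[OF finite_unit_Re[of 0], of "\<lambda>V. {U. (V, U) \<in> M}"] by metis
    then show ?thesis ..
  next
    case False
    let ?M = "{m \<in> M. torus_form_deriv R r ?\<kappa> ?\<epsilon> ?\<gamma> m = 0}"
    have "square_coeffs ?\<kappa> ?\<epsilon> ?\<gamma> ((a + b) / 2) i j \<or> (\<exists>V. infinite {U. (V, U) \<in> ?M}) \<or>
        (\<exists>U. infinite {V. (V, U) \<in> ?M})"
      using unit zero by (intro torus_double_contact[OF r R False]) auto
    moreover have "\<not> square_coeffs ?\<kappa> ?\<epsilon> ?\<gamma> ((a + b) / 2) i j"
      using quadric_square_if_square_coeffs square_not_irreducible assms(3) by metis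
    moreover have "infinite {U. (V, U) \<in> M}" if "infinite {U. (V, U) \<in> ?M}" for V
      using that by (rule contrapos_nn) (auto elim: rev_finite_subset)
    moreover have "infinite {V. (V, U) \<in> M}" if "infinite {V. (V, U) \<in> ?M}" for U
      using that by (rule contrapos_nn) (auto elim: rev_finite_subset)
    ultimately show ?thesis by blast
  qed
  then show ?thesis
  proof (elim disjE exE)
    fix V assume inf: "infinite {U. (V, U) \<in> M}"
    then obtain U where "(V, U) \<in> M" using not_finite_existsD by blast
    then have V: "cmod V = 1" using unit by blast
    define C where "C = (\<lambda>U. torus_point R r (V, U)) ` {U. cmod U = 1}"
    have \<rho>: "0 < R + r * Re V" using torus_radius_pos[OF r R V] .
    let ?c = "vector [0, 0, r * Im V] :: real ^ 3" and ?p = "vector [R + r * Re V, 0, 0] :: real ^ 3"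
      and ?q = "vector [0, R + r * Re V, 0] :: real ^ 3"
    have \<phi>: "torus_point R r (V, U) = ?c + Re U *\<^sub>R ?p + Im U *\<^sub>R ?q" for U
      by (simp add: vec_eq_iff forall_3 torus_point_nth)
    have "D = C"
    proof (rule curve_eq_circle[OF D dim, of C ?c ?p ?q])
      show "algebraic_set C"
        unfolding C_def parallel_circle_torus(1)[OF r R V] using \<rho> by (intro algebraic_set_circle3) simp
      show "C = (\<lambda>W. ?c + Re W *\<^sub>R ?p + Im W *\<^sub>R ?q) ` {W. cmod W = 1}" unfolding C_def \<phi> ..
      show "?p \<noteq> 0" using \<rho> by (auto simp: vec_eq_iff forall_3)
      show "infinite {U. (V, U) \<in> M}" by (rule inf)
      show "cmod W = 1 \<and> ?c + Re W *\<^sub>R ?p + Im W *\<^sub>R ?q \<in> D" if "W \<in> {U. (V, U) \<in> M}" for W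
        using that unfolding \<phi>[symmetric] by (simp add: M_def)
    qed
    then show ?thesis using parallel_circle_torus(2)[OF r R V] unfolding C_def by simp
  next
    fix U assume inf: "infinite {V. (V, U) \<in> M}"
    then obtain V where "(V, U) \<in> M" using not_finite_existsD by blast
    then have U: "cmod U = 1" using unit by blast
    define C where "C = (\<lambda>V. torus_point R r (V, U)) ` {V. cmod V = 1}"
    let ?c = "vector [R * Re U, R * Im U, 0] :: real ^ 3" and ?p = "vector [r * Re U, r * Im U, 0] :: real ^ 3"
      and ?q = "vector [0, 0, r] :: real ^ 3"
    have \<phi>: "torus_point R r (V, U) = ?c + Re V *\<^sub>R ?p + Im V *\<^sub>R ?q" for V
      by (simp add: vec_eq_iff forall_3 torus_point_nth algebra_simps)
    have "D = C"
    proof (rule curve_eq_circle[OF D dim, of C ?c ?p ?q])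
      show "algebraic_set C"
        unfolding C_def meridian_circle_torus(1)[OF r R U] using r by (intro algebraic_set_circle3) simp
      show "C = (\<lambda>W. ?c + Re W *\<^sub>R ?p + Im W *\<^sub>R ?q) ` {W. cmod W = 1}" unfolding C_def \<phi> ..
      show "?p \<noteq> 0" using r U by (auto simp: vec_eq_iff forall_3 cmod_def)
      show "infinite {V. (V, U) \<in> M}" by (rule inf)
      show "cmod W = 1 \<and> ?c + Re W *\<^sub>R ?p + Im W *\<^sub>R ?q \<in> D" if "W \<in> {V. (V, U) \<in> M}" for W
        using that unfolding \<phi>[symmetric] by (simp add: M_def)
    qed
    then show ?thesis using meridian_circle_torus(2)[OF r R U] unfolding C_def by simp
  qed
qed

end
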